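(* Let $Z=H(p_1,p_2,\dots)$ be the Hawaiian Earring. Two reduced tame words over the alphabet $\{p_1,p_2,\dots\}$ represent the same element in the first singular homology group $H_1(Z)$ if and only if each of them can be transformed to the same tame word by applying a finite number of transformations of type (ii) and finally of type (iii): (ii) deletion of two distinct mutually inverse countable subwords: $AXBX^{-1}C\to ABC$; (iii) permuting two consecutive countable subwords: $AXYB\to AYXB$.
   Context: Words. For an alphabet $X$ put $X^{\pm}=X\cup X^{-1}$ (letters and formal inverses). A countable word over $X$ is a family $W=(x_i)_{i\in I}$ with $I$ a countable (possibly finite or empty) linearly ordered set and $x_i\in X^{\pm}$. Words $(x_i)_{i\in I}$, $(y_j)_{j\in J}$ are regarded as equal (written $\equiv$) if there is an order-preserving bijection $\varphi:I\to J$ with $y_{\varphi(i)}=x_i$. A subword is the restriction to an order-convex subset of $I$. Concatenation $UV$ puts the indices of $U$ before those of $V$. $U^{-1}$ is obtained by reversing the order and inverting all letters. A word is restricted if each letter of $X^{\pm}$ occurs only finitely many times in it. An arch-system for $W$ is a set of pairwise disjoint two-element subsets $\{i\prec j\}$ of $I$ (arches) such that: $x_j=x_i^{-1}$; no two arches cross; and if $\{i\prec j\}$ is an arch, every $k$ with $i\prec k\prec j$ belongs to an arch both of whose elements lie strictly between $i$ and $j$. $W$ is reduced if its only arch-system is the empty one. Every restricted word $W$ has a unique reduced form: the word obtained by deleting the endpoints of all arches of a maximal (under inclusion) arch-system. A reduced tame word is a restricted reduced countable word; a tame word is a finite concatenation of reduced tame words. Space. The Hawaiian Earring $H(p_1,p_2,\dots)$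 is the union of circles of radii $1/n$ ($n\ge1$) in the plane, pairwise meeting only in one common base point, on the same side of a common tangent, with the subspace topology; the circle of radius $1/n$, and also the loop traversing it once counterclockwise, is called $p_n$. Representation. A restricted word $U=(x_i)_{i\in I}$ over $\{p_1,p_2,\dots\}$ represents the class of a loop $f_U:[0,1]\to Z$: choose disjoint open intervals $J_i\subset(0,1)$, ordered as $I$; let $f_U$ traverse the loop $x_i$ (the inverse loop if $x_i$ is an inverse letter) on $J_i$, and be the base point elsewhere. The based homotopy class of $f_U$ is well defined and depends only on the reduced form of $U$. The element of $H_1(Z)$ represented by $U$ is the image of this class under $\pi_1(Z)\to H_1(Z)=\pi_1(Z)^{\mathrm{ab}}$. *)

theory Defs
  imports "HOL-Homology.Homology_Groups"
begin

section \<open>Countable words\<close>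

text \<open>The alphabet \<open>X\<close> is the type \<open>'a\<close>; \<open>'a letter\<close> is the set of letters and formal inverses.\<close>

datatype 'a letter = Gen 'a | GenInv 'a

primrec inv_letter :: "'a letter \<Rightarrow> 'a letter" where
  "inv_letter (Gen a) = GenInv a"
| "inv_letter (GenInv a) = Gen a"

text \<open>
  The index set of a word is the field of the (reflexive) relation \<open>le W\<close>. The
  function \<open>letter_at W\<close> is irrelevant outside the index set, and words are only ever
  compared by \<open>word_eq\<close>.
\<close>

datatype ('i, 'a) word = Word (le: "'i rel") (letter_at: "'i \<Rightarrow> 'a letter")

definition idx :: "('i, 'a) word \<Rightarrow> 'i set" where
  "idx W = Field (le W)"

definition prec :: "('i, 'a) word \<Rightarrow> 'i \<Rightarrow> 'i \<Rightarrow> bool" where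
  "prec W i j \<longleftrightarrow> (i, j) \<in> le W \<and> i \<noteq> j"

definition countable_word :: "('i, 'a) word \<Rightarrow> bool" where
  "countable_word W \<longleftrightarrow> countable (idx W) \<and> linear_order_on (idx W) (le W)"

definition word_eq :: "('i, 'a) word \<Rightarrow> ('j, 'a) word \<Rightarrow> bool" where
  "word_eq V W \<longleftrightarrow>
     (\<exists>\<phi>. bij_betw \<phi> (idx V) (idx W) \<and>
          (\<forall>i\<in>idx V. \<forall>j\<in>idx V. (i, j) \<in> le V \<longleftrightarrow> (\<phi> i, \<phi> j) \<in> le W) \<and>
          (\<forall>i\<in>idx V. letter_at W (\<phi> i) = letter_at V i))"

definition inv_word :: "('i, 'a) word \<Rightarrow> ('i, 'a) word" where
  "inv_word W = Word ((le W)\<inverse>) (\<lambda>i. inv_letter (letter_at W i))"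

text \<open>Finite concatenation; the index \<open>(k, i)\<close> is the index \<open>i\<close> of the \<open>k\<close>-th factor.\<close>

definition concat_words :: "('i, 'a) word list \<Rightarrow> (nat \<times> 'i, 'a) word" where
  "concat_words Ws = Word
     {((k, i), (l, j)). k < length Ws \<and> l < length Ws \<and> i \<in> idx (Ws ! k) \<and> j \<in> idx (Ws ! l) \<and>
                        (k < l \<or> k = l \<and> (i, j) \<in> le (Ws ! k))}
     (\<lambda>(k, i). letter_at (Ws ! k) i)"

definition restricted :: "('i, 'a) word \<Rightarrow> bool" where
  "restricted W \<longleftrightarrow> (\<forall>x. finite {i \<in> idx W. letter_at W i = x})"

text \<open>An arch \<open>{i \<prec> j}\<close> is encoded as the ordered pair \<open>(i, j)\<close>.\<close>

definition arch_system :: "('i, 'a) word \<Rightarrow> ('i \<times> 'i) set \<Rightarrow> bool" where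
  "arch_system W S \<longleftrightarrow>
     (\<forall>(i, j)\<in>S. prec W i j \<and> letter_at W j = inv_letter (letter_at W i)) \<and>
     (\<forall>(i, j)\<in>S. \<forall>(k, l)\<in>S. (i, j) \<noteq> (k, l) \<longrightarrow> {i, j} \<inter> {k, l} = {}) \<and>
     (\<forall>(i, j)\<in>S. \<forall>(k, l)\<in>S. \<not> (prec W i k \<and> prec W k j \<and> prec W j l)) \<and>
     (\<forall>(i, j)\<in>S. \<forall>k. prec W i k \<and> prec W k j \<longrightarrow>
        (\<exists>(a, b)\<in>S. k \<in> {a, b} \<and> prec W i a \<and> prec W a j \<and> prec W i b \<and> prec W b j))"

definition reduced :: "('i, 'a) word \<Rightarrow> bool" where
  "reduced W \<longleftrightarrow> (\<forall>S. arch_system W S \<longrightarrow> S = {})"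

definition reduced_tame :: "('i, 'a) word \<Rightarrow> bool" where
  "reduced_tame W \<longleftrightarrow> countable_word W \<and> restricted W \<and> reduced W"

text \<open>
  From here on \<open>nat\<close> serves as a universal index type: every countable linear order
  is isomorphic to one whose underlying set consists of natural numbers (the order being
  arbitrary), so every countable word is \<open>word_eq\<close> to a word indexed in \<open>nat\<close>.
\<close>

definition tame :: "('i, 'a) word \<Rightarrow> bool" where
  "tame W \<longleftrightarrow>
     (\<exists>Ws :: (nat, 'a) word list. (\<forall>V\<in>set Ws. reduced_tame V) \<and> word_eq W (concat_words Ws))"


section \<open>The transformations\<close>

text \<open>Type (ii): \<open>A X B X\<inverse> C \<rightarrow> A B C\<close>.\<close>

inductive delete_step :: "(nat, 'a) word \<Rightarrow> (nat, 'a) word \<Rightarrow> bool" where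
  "\<lbrakk>countable_word (A :: (nat, 'a) word); countable_word X; countable_word B; countable_word C;
    word_eq V (concat_words [A, X, B, inv_word X, C]);
    word_eq W (concat_words [A, B, C])\<rbrakk> \<Longrightarrow> delete_step V W"

text \<open>Type (iii): \<open>A X Y B \<rightarrow> A Y X B\<close>.\<close>

inductive permute_step :: "(nat, 'a) word \<Rightarrow> (nat, 'a) word \<Rightarrow> bool" where
  "\<lbrakk>countable_word (A :: (nat, 'a) word); countable_word X; countable_word Y; countable_word B;
    word_eq V (concat_words [A, X, Y, B]);
    word_eq W (concat_words [A, Y, X, B])\<rbrakk> \<Longrightarrow> permute_step V W"

text \<open>
  Finitely many steps of type (ii) followed by finitely many steps of type (iii); the
  outer \<open>word_eq\<close> only replace words by equal ones.
\<close>

definition transforms_to :: "('i, 'a) word \<Rightarrow> (nat, 'a) word \<Rightarrow> bool" where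
  "transforms_to U T \<longleftrightarrow>
     (\<exists>U\<^sub>0 U\<^sub>1 U\<^sub>2. word_eq U U\<^sub>0 \<and> delete_step\<^sup>*\<^sup>* U\<^sub>0 U\<^sub>1 \<and> permute_step\<^sup>*\<^sup>* U\<^sub>1 U\<^sub>2 \<and> word_eq U\<^sub>2 T)"


section \<open>The Hawaiian Earring and its first homology group\<close>

text \<open>
  The plane is \<open>complex\<close>, the base point is \<open>0\<close> and the common tangent is the imaginary
  axis. The natural number \<open>n\<close>, as a letter, stands for the circle of radius
  \<open>1 / (n + 1)\<close>, so that the alphabet \<open>p\<^sub>1, p\<^sub>2, \<dots>\<close> is the whole type \<open>nat\<close>.
\<close>

definition hawaiian_earring :: "complex set" where
  "hawaiian_earring = (\<Union>n. sphere (of_real (1 / real (Suc n))) (1 / real (Suc n)))"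

text \<open>Starts at \<open>0\<close> and runs once counterclockwise around the centre \<open>1 / (n + 1)\<close>.\<close>

definition circle_loop :: "nat \<Rightarrow> real \<Rightarrow> complex" where
  "circle_loop n t = of_real (1 / real (Suc n)) * (1 - exp (2 * of_real pi * \<i> * of_real t))"

primrec letter_loop :: "nat letter \<Rightarrow> real \<Rightarrow> complex" where
  "letter_loop (Gen n) = circle_loop n"
| "letter_loop (GenInv n) = reversepath (circle_loop n)"

text \<open>\<open>word_loop U f\<close>: on \<open>[0,1]\<close>, \<open>f\<close> is a loop \<open>f\<^sub>U\<close>; the interval \<open>J\<^sub>i\<close> is \<open>{l i<..<r i}\<close>.\<close>

definition word_loop :: "('i, nat) word \<Rightarrow> (real \<Rightarrow> complex) \<Rightarrow> bool" where
  "word_loop U f \<longleftrightarrow>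
     (\<exists>l r. (\<forall>i\<in>idx U. 0 \<le> l i \<and> l i < r i \<and> r i \<le> 1) \<and>
            (\<forall>i j. prec U i j \<longrightarrow> r i \<le> l j) \<and>
            (\<forall>i\<in>idx U. \<forall>t\<in>{l i<..<r i}.
               f t = letter_loop (letter_at U i) ((t - l i) / (r i - l i))) \<and>
            (\<forall>t\<in>{0..1}. (\<forall>i\<in>idx U. t \<notin> {l i<..<r i}) \<longrightarrow> f t = 0))"

text \<open>
  The image of the class of a loop under the Hurewicz map \<open>\<pi>\<^sub>1 \<rightarrow> H\<^sub>1\<close>: the homology class
  (an element of \<open>homology_group 1\<close>) of the loop viewed as a singular 1-simplex. The
  standard 1-simplex is parametrised by its barycentric coordinate \<open>x 1\<close>.
\<close>

definition loop_homology_class :: "'b::topological_space set \<Rightarrow> (real \<Rightarrow> 'b) \<Rightarrow> 'b chain set" where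
  "loop_homology_class S f =
     homologous_rel_set 1 (top_of_set S) {} (frag_of (restrict (\<lambda>x. f (x 1)) (standard_simplex 1)))"

text \<open>
  A relation rather than a function, because \<open>f\<^sub>U\<close> depends on the choice of the
  intervals; its homology class does not.
\<close>

definition represents :: "('i, nat) word \<Rightarrow> complex chain set \<Rightarrow> bool" where
  "represents U c \<longleftrightarrow> (\<exists>f. word_loop U f \<and> c = loop_homology_class hawaiian_earring f)"

end

theory Submission
  imports Defs "HOL-Analysis.Uniform_Limit" "HOL-Library.Diagonal_Subsequence"
begin

text \<open>
  The easy half is additivity of homology. The loop of a concatenation is a concatenation of
  loops, so the class of a word is additive, an inverse word has the opposite class, and neither
  deleting \<open>X\<close> together with \<open>X\<inverse>\<close> nor exchanging two neighbouring blocks changes the class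
  (\<open>transforms_to_word_chain\<close>).

  For the converse, suppose that the loops of \<open>U\<close> and \<open>V\<close> differ by the boundary of a singular
  2-chain. Everything that is needed about paths in the earring is contained in their values in
  free groups: for each \<open>N\<close>, a path is sent to the element of the free group on the first \<open>N\<close>
  circles that records its passages through the points of these circles opposite to the base
  point. A passage is detected by any two sufficiently close points of the path. It is
  therefore a locally defined cocycle, which has a lift on a square, and so the values of the
  three sides of a singular triangle satisfy the evident relation (\<open>path_value_triangle\<close>). Each
  path has a countable word with the same values (\<open>path_word_exists\<close>), and removing as
  many letters as possible without changing the values makes this word irreducible
  (\<open>irreducible_on_exists\<close>).

  The 2-chain thus yields a finite list of irreducible words, namely \<open>V\<inverse>\<close>, \<open>U\<close> and the words of
  finitely many paths and inverse paths, whose concatenation has trivial value for every \<open>N\<close>. By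
  compactness, a word with finitely many occurrences of every letter and with trivial values has a
  complete noncrossing pairing \<open>P\<close> of inverse letters (\<open>word_value_nc_pairing\<close>). No two letters of the same
  irreducible word are paired, and noncrossing pairs between finitely many words form finitely
  many parallel bundles. On the other hand, since the boundary of the 2-chain is the difference of
  the two loops, the paths other than \<open>U\<close> and \<open>V\<close> occur equally often with either sign, and
  mirroring each occurrence onto an opposite one gives a second pairing \<open>Q\<close>.

  Starting from a letter of \<open>U\<close> or \<open>V\<inverse>\<close> and applying \<open>P\<close> and \<open>Q\<close> alternately, one moves within
  the finitely many occurrences of one letter and its inverse, and hence ends in \<open>U\<close> or
  \<open>V\<inverse>\<close> again. The lengths of these trajectories are not bounded a priori, but as for interval
  exchange transformations they follow only finitely many itineraries: two neighbouring
  itineraries are separated where the trajectories meet a boundary between two bundles, and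
  different neighbours are separated at different boundaries (locale \<open>interval_exchange\<close>). The
  letters with a common itinerary form a convex piece of \<open>U\<close> or \<open>V\<inverse>\<close>, and the trajectories
  match these finitely many pieces in mutually inverse pairs. A pair inside \<open>U\<close> or inside \<open>V\<close> is
  deleted. The remaining pieces of \<open>U\<close> are those of \<open>V\<close> in a different order.
\<close>

section \<open>Words up to order isomorphism\<close>

lemma inv_letter_inv [simp]: "inv_letter (inv_letter x) = x"
  by (cases x) auto

lemma inv_letter_neq [simp]: "inv_letter x \<noteq> x" "x \<noteq> inv_letter x"
  by (cases x; auto)+

lemma inv_letter_inject [simp]: "inv_letter x = inv_letter y \<longleftrightarrow> x = y"
  by (metis inv_letter_inv)

lemma word_eq_refl: "word_eq V V"
  unfolding word_eq_def by (rule exI[of _ id]) auto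

lemma word_eq_sym:
  assumes "word_eq V W" shows "word_eq W V"
proof -
  obtain f where f: "bij_betw f (idx V) (idx W)"
    "\<forall>i\<in>idx V. \<forall>j\<in>idx V. (i, j) \<in> le V \<longleftrightarrow> (f i, f j) \<in> le W"
    "\<forall>i\<in>idx V. letter_at W (f i) = letter_at V i"
    using assms unfolding word_eq_def by blast
  let ?g = "inv_into (idx V) f"
  have g: "bij_betw ?g (idx W) (idx V)" "\<And>y. y \<in> idx W \<Longrightarrow> ?g y \<in> idx V \<and> f (?g y) = y"
    using f(1) by (metis bij_betw_inv_into) (metis f(1) bij_betw_def f_inv_into_f inv_into_into)
  show ?thesis
    unfolding word_eq_def
    by (rule exI[of _ ?g]) (use f(2,3) g in metis)
qed

lemma word_eq_trans:
  assumes "word_eq U V" "word_eq V W" shows "word_eq U W"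
proof -
  obtain f where f: "bij_betw f (idx U) (idx V)"
    "\<forall>i\<in>idx U. \<forall>j\<in>idx U. (i, j) \<in> le U \<longleftrightarrow> (f i, f j) \<in> le V"
    "\<forall>i\<in>idx U. letter_at V (f i) = letter_at U i"
    using assms unfolding word_eq_def by blast
  obtain g where g: "bij_betw g (idx V) (idx W)"
    "\<forall>i\<in>idx V. \<forall>j\<in>idx V. (i, j) \<in> le V \<longleftrightarrow> (g i, g j) \<in> le W"
    "\<forall>i\<in>idx V. letter_at W (g i) = letter_at V i"
    using assms unfolding word_eq_def by blast
  have "f i \<in> idx V" if "i \<in> idx U" for i using f(1) that by (auto simp: bij_betw_def)
  then show ?thesis
    unfolding word_eq_def
    by (intro exI[of _ "g \<circ> f"]) (use f g in \<open>auto intro: bij_betw_trans\<close>)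
qed

lemma idx_le: "(i, j) \<in> le W \<Longrightarrow> i \<in> idx W \<and> j \<in> idx W"
  by (auto simp: idx_def Field_def)

lemma self_idx: "i \<in> idx A \<longleftrightarrow> (\<exists>j. (i, j) \<in> le A \<or> (j, i) \<in> le A)"
  by (auto simp: idx_def Field_def)

lemma prec_idx: "prec W i j \<Longrightarrow> i \<in> idx W \<and> j \<in> idx W"
  by (auto simp: prec_def dest: idx_le)

lemma countable_word_refl: "countable_word W \<Longrightarrow> i \<in> idx W \<Longrightarrow> (i, i) \<in> le W"
  unfolding countable_word_def linear_order_on_def partial_order_on_def preorder_on_def refl_on_def
  by blast

lemma countable_word_trans: "countable_word W \<Longrightarrow> (i, j) \<in> le W \<Longrightarrow> (j, k) \<in> le W \<Longrightarrow> (i, k) \<in> le W"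
  unfolding countable_word_def linear_order_on_def partial_order_on_def preorder_on_def trans_def
  by blast

lemma countable_word_antisym: "countable_word W \<Longrightarrow> (i, j) \<in> le W \<Longrightarrow> (j, i) \<in> le W \<Longrightarrow> i = j"
  unfolding countable_word_def linear_order_on_def partial_order_on_def antisym_def
  by blast

lemma countable_word_total: "countable_word W \<Longrightarrow> i \<in> idx W \<Longrightarrow> j \<in> idx W \<Longrightarrow> (i, j) \<in> le W \<or> (j, i) \<in> le W"
  by (metis countable_word_refl countable_word_def linear_order_on_def total_on_def)

lemma countable_wordI:
  assumes "countable (idx W)"
    "\<And>i. i \<in> idx W \<Longrightarrow> (i, i) \<in> le W"
    "\<And>i j k. (i, j) \<in> le W \<Longrightarrow> (j, k) \<in> le W \<Longrightarrow> (i, k) \<in> le W"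
    "\<And>i j. (i, j) \<in> le W \<Longrightarrow> (j, i) \<in> le W \<Longrightarrow> i = j"
    "\<And>i j. i \<in> idx W \<Longrightarrow> j \<in> idx W \<Longrightarrow> (i, j) \<in> le W \<or> (j, i) \<in> le W"
  shows "countable_word W"
  unfolding countable_word_def linear_order_on_def partial_order_on_def preorder_on_def
    refl_on_def trans_def antisym_def total_on_def
  using assms by (auto dest: idx_le)

lemma word_eq_countable_word:
  assumes "word_eq V W" "countable_word V" shows "countable_word W"
proof -
  obtain f where f: "bij_betw f (idx W) (idx V)"
    "\<forall>i\<in>idx W. \<forall>j\<in>idx W. (i, j) \<in> le W \<longleftrightarrow> (f i, f j) \<in> le V"
    using word_eq_sym[OF assms(1)] unfolding word_eq_def by blast
  have m: "f i \<in> idx V" if "i \<in> idx W" for i using f(1) that by (auto simp: bij_betw_def)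
  have inj: "i = j" if "f i = f j" "i \<in> idx W" "j \<in> idx W" for i j
    using f(1) that by (auto simp: bij_betw_def inj_on_def)
  show ?thesis
  proof (rule countable_wordI)
    show "countable (idx W)"
      using f(1) assms(2) by (metis bij_betw_imp_inj_on bij_betw_imp_surj_on countable_image_inj_on countable_word_def)
  next
    fix i assume "i \<in> idx W" then show "(i, i) \<in> le W"
      using f(2) m countable_word_refl[OF assms(2)] by blast
  next
    fix i j k assume a: "(i, j) \<in> le W" "(j, k) \<in> le W"
    then show "(i, k) \<in> le W"
      using f(2) countable_word_trans[OF assms(2)] idx_le by metis
  next
    fix i j assume a: "(i, j) \<in> le W" "(j, i) \<in> le W"
    then show "i = j"
      using f(2) countable_word_antisym[OF assms(2)] idx_le inj by metis
  next
    fix i j assume a: "i \<in> idx W" "j \<in> idx W"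
    then show "(i, j) \<in> le W \<or> (j, i) \<in> le W"
      using f(2) countable_word_total[OF assms(2)] m by metis
  qed
qed

lemma word_eq_restricted:
  assumes "word_eq V W" "restricted V" shows "restricted W"
  unfolding restricted_def
proof
  fix x
  obtain f where f: "bij_betw f (idx V) (idx W)" "\<forall>i\<in>idx V. letter_at W (f i) = letter_at V i"
    using assms(1) unfolding word_eq_def by blast
  have "{i \<in> idx W. letter_at W i = x} \<subseteq> f ` {i \<in> idx V. letter_at V i = x}"
  proof
    fix i assume i: "i \<in> {i \<in> idx W. letter_at W i = x}"
    then obtain j where "j \<in> idx V" "i = f j" using f(1) by (auto simp: bij_betw_def)
    then show "i \<in> f ` {i \<in> idx V. letter_at V i = x}" using f(2) i by auto
  qed
  then show "finite {i \<in> idx W. letter_at W i = x}"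
    by (rule finite_subset) (use assms(2) in \<open>simp add: restricted_def\<close>)
qed

lemma word_eq_prec:
  assumes "\<forall>i\<in>idx V. \<forall>j\<in>idx V. (i, j) \<in> le V \<longleftrightarrow> (f i, f j) \<in> le W" "inj_on f (idx V)"
    "i \<in> idx V" "j \<in> idx V"
  shows "prec W (f i) (f j) \<longleftrightarrow> prec V i j"
  using assms by (auto simp: prec_def inj_on_def)

lemma arch_systemI:
  assumes "\<And>i j. (i, j) \<in> S \<Longrightarrow> prec W i j \<and> letter_at W j = inv_letter (letter_at W i)"
    "\<And>i j k l. (i, j) \<in> S \<Longrightarrow> (k, l) \<in> S \<Longrightarrow> (i, j) \<noteq> (k, l) \<Longrightarrow> {i, j} \<inter> {k, l} = {}"
    "\<And>i j k l. (i, j) \<in> S \<Longrightarrow> (k, l) \<in> S \<Longrightarrow> prec W i k \<Longrightarrow> prec W k j \<Longrightarrow> \<not> prec W j l"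
    "\<And>i j k. (i, j) \<in> S \<Longrightarrow> prec W i k \<Longrightarrow> prec W k j \<Longrightarrow>
        \<exists>(a, b)\<in>S. k \<in> {a, b} \<and> prec W i a \<and> prec W a j \<and> prec W i b \<and> prec W b j"
  shows "arch_system W S"
  unfolding arch_system_def
proof (intro conjI ballI)
  fix p assume p: "p \<in> S"
  obtain i j where ij: "p = (i, j)" by (cases p)
  show "case p of (i, j) \<Rightarrow> prec W i j \<and> letter_at W j = inv_letter (letter_at W i)"
    using assms(1)[of i j] p unfolding ij prod.case .
  show "case p of (i, j) \<Rightarrow> \<forall>k. prec W i k \<and> prec W k j \<longrightarrow>
      (\<exists>(a, b)\<in>S. k \<in> {a, b} \<and> prec W i a \<and> prec W a j \<and> prec W i b \<and> prec W b j)"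
    using assms(4)[of i j] p unfolding ij prod.case by (intro allI impI) (elim conjE)
  show "case p of (i, j) \<Rightarrow> \<forall>(k, l)\<in>S. (i, j) \<noteq> (k, l) \<longrightarrow> {i, j} \<inter> {k, l} = {}"
    unfolding ij prod.case
  proof (rule ballI)
    fix q assume q: "q \<in> S"
    obtain k l where kl: "q = (k, l)" by (cases q)
    show "case q of (k, l) \<Rightarrow> (i, j) \<noteq> (k, l) \<longrightarrow> {i, j} \<inter> {k, l} = {}"
      using assms(2)[of i j k l] p q unfolding ij kl prod.case by (intro impI)
  qed
  show "case p of (i, j) \<Rightarrow> \<forall>(k, l)\<in>S. \<not> (prec W i k \<and> prec W k j \<and> prec W j l)"
    using assms(3)[of i j] p unfolding ij prod.case by blast
qed

text \<open>Convexity of the image is needed because every letter under an arch has to belong to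
  an arch.\<close>

lemma arch_system_image:
  assumes S: "arch_system V S"
    and inj: "inj_on f (idx V)" and ran: "f ` idx V \<subseteq> idx W"
    and ord: "\<forall>i\<in>idx V. \<forall>j\<in>idx V. (i, j) \<in> le V \<longleftrightarrow> (f i, f j) \<in> le W"
    and lab: "\<forall>i\<in>idx V. letter_at W (f i) = letter_at V i"
    and conv: "\<And>i j k. i \<in> idx V \<Longrightarrow> j \<in> idx V \<Longrightarrow> prec W (f i) k \<Longrightarrow> prec W k (f j) \<Longrightarrow> k \<in> f ` idx V"
  shows "arch_system W ((\<lambda>(i, j). (f i, f j)) ` S)"
proof -
  note S' = S[unfolded arch_system_def]
  note S1' = S'[THEN conjunct1] and S2' = S'[THEN conjunct2, THEN conjunct1]
    and S3' = S'[THEN conjunct2, THEN conjunct2, THEN conjunct1]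
    and S4' = S'[THEN conjunct2, THEN conjunct2, THEN conjunct2]
  have S1: "\<And>i j. (i, j) \<in> S \<Longrightarrow> prec V i j \<and> letter_at V j = inv_letter (letter_at V i)"
    using S1' by fast
  have S2: "\<And>i j k l. (i, j) \<in> S \<Longrightarrow> (k, l) \<in> S \<Longrightarrow> (i, j) \<noteq> (k, l) \<Longrightarrow> {i, j} \<inter> {k, l} = {}"
    using S2' by fast
  have S3: "\<And>i j k l. (i, j) \<in> S \<Longrightarrow> (k, l) \<in> S \<Longrightarrow> \<not> (prec V i k \<and> prec V k j \<and> prec V j l)"
    using S3' by fast
  have S4: "\<exists>(a, b)\<in>S. k \<in> {a, b} \<and> prec V i a \<and> prec V a j \<and> prec V i b \<and> prec V b j"
    if "(i, j) \<in> S" "prec V i k" "prec V k j" for i j k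
  proof -
    have "\<forall>k. prec V i k \<and> prec V k j \<longrightarrow>
      (\<exists>(a, b)\<in>S. k \<in> {a, b} \<and> prec V i a \<and> prec V a j \<and> prec V i b \<and> prec V b j)"
      using bspec[OF S4' that(1)] by (simp only: prod.case)
    from mp[OF spec[OF this] conjI[OF that(2,3)]] show ?thesis .
  qed
  have I: "\<And>i j. (i, j) \<in> S \<Longrightarrow> i \<in> idx V \<and> j \<in> idx V"
    using S1 prec_idx by metis
  note P = word_eq_prec[OF ord inj]
  have J: "f i = f j \<longleftrightarrow> i = j" if "i \<in> idx V" "j \<in> idx V" for i j
    using inj that by (auto simp: inj_on_def)
  let ?S = "(\<lambda>(i, j). (f i, f j)) ` S"
  have im: "\<exists>i j. (i, j) \<in> S \<and> x = f i \<and> y = f j" if "(x, y) \<in> ?S" for x y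
    using that by auto
  show ?thesis
  proof (rule arch_systemI)
    fix x y assume "(x, y) \<in> ?S"
    then obtain i j where ij: "(i, j) \<in> S" "x = f i" "y = f j" using im by blast
    show "prec W x y \<and> letter_at W y = inv_letter (letter_at W x)"
      using S1[OF ij(1)] I[OF ij(1)] P lab unfolding ij(2,3) by simp
  next
    fix x y x' y' assume a: "(x, y) \<in> ?S" "(x', y') \<in> ?S" "(x, y) \<noteq> (x', y')"
    obtain i j where ij: "(i, j) \<in> S" "x = f i" "y = f j" using im[OF a(1)] by blast
    obtain k l where kl: "(k, l) \<in> S" "x' = f k" "y' = f l" using im[OF a(2)] by blast
    have "(i, j) \<noteq> (k, l)" using a(3) ij kl by auto
    from S2[OF ij(1) kl(1) this] show "{x, y} \<inter> {x', y'} = {}"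
      using J I[OF ij(1)] I[OF kl(1)] unfolding ij(2,3) kl(2,3) by auto
  next
    fix x y x' y' assume a: "(x, y) \<in> ?S" "(x', y') \<in> ?S" "prec W x x'" "prec W x' y"
    obtain i j where ij: "(i, j) \<in> S" "x = f i" "y = f j" using im[OF a(1)] by blast
    obtain k l where kl: "(k, l) \<in> S" "x' = f k" "y' = f l" using im[OF a(2)] by blast
    show "\<not> prec W y y'"
      using S3[OF ij(1) kl(1)] a(3,4) P I[OF ij(1)] I[OF kl(1)] unfolding ij(2,3) kl(2,3) by simp
  next
    fix x y k assume a: "(x, y) \<in> ?S" "prec W x k" "prec W k y"
    obtain i j where ij: "(i, j) \<in> S" "x = f i" "y = f j" using im[OF a(1)] by blast
    obtain k' where k': "k' \<in> idx V" "k = f k'"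
      using conv[of i j k] I[OF ij(1)] a(2,3) unfolding ij(2,3) by blast
    have "prec V i k'" "prec V k' j" using a(2,3) k' P I[OF ij(1)] unfolding ij(2,3) by simp_all
    from S4[OF ij(1) this] obtain c d where cd: "(c, d) \<in> S" "k' \<in> {c, d}"
      "prec V i c" "prec V c j" "prec V i d" "prec V d j" by blast
    have "(f c, f d) \<in> ?S" using cd(1) by auto
    then show "\<exists>(a, b)\<in>?S. k \<in> {a, b} \<and> prec W x a \<and> prec W a y \<and> prec W x b \<and> prec W b y"
      by (rule rev_bexI) (use cd(2-) I[OF ij(1)] I[OF cd(1)] P k'(2) in \<open>auto simp: ij(2,3)\<close>)
  qed
qed

lemma reduced_embed:
  assumes "reduced W" "inj_on f (idx V)" "f ` idx V \<subseteq> idx W"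
    "\<forall>i\<in>idx V. \<forall>j\<in>idx V. (i, j) \<in> le V \<longleftrightarrow> (f i, f j) \<in> le W"
    "\<forall>i\<in>idx V. letter_at W (f i) = letter_at V i"
    "\<And>i j k. i \<in> idx V \<Longrightarrow> j \<in> idx V \<Longrightarrow> prec W (f i) k \<Longrightarrow> prec W k (f j) \<Longrightarrow> k \<in> f ` idx V"
  shows "reduced V"
  unfolding reduced_def
proof (intro allI impI)
  fix S assume "arch_system V S"
  then have "arch_system W ((\<lambda>(i, j). (f i, f j)) ` S)"
    by (rule arch_system_image[OF _ assms(2-5)]) (rule assms(6))
  then have "(\<lambda>(i, j). (f i, f j)) ` S = {}"
    using assms(1) unfolding reduced_def by blast
  then show "S = {}" by simp
qed

lemma word_eq_reduced:
  assumes "word_eq V W" "reduced W" shows "reduced V"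
proof -
  obtain f where f: "bij_betw f (idx V) (idx W)"
    "\<forall>i\<in>idx V. \<forall>j\<in>idx V. (i, j) \<in> le V \<longleftrightarrow> (f i, f j) \<in> le W"
    "\<forall>i\<in>idx V. letter_at W (f i) = letter_at V i"
    using assms unfolding word_eq_def by blast
  show ?thesis
    by (rule reduced_embed[OF assms(2), of f]) (use f in \<open>auto simp: bij_betw_def dest: prec_idx\<close>)
qed

lemma word_eq_reduced_tame: "word_eq V W \<Longrightarrow> reduced_tame V \<Longrightarrow> reduced_tame W"
  unfolding reduced_tame_def
  using word_eq_reduced word_eq_restricted word_eq_countable_word word_eq_sym by metis

text \<open>Steps of the transformations are defined for words indexed by numbers only; this chooses such
  a copy of any countable word.\<close>

definition nat_word :: "('i, 'a) word \<Rightarrow> (nat, 'a) word" where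
  "nat_word W = (SOME N. word_eq W N)"

lemma nat_word_eq:
  assumes "countable_word W" shows "word_eq W (nat_word W)"
proof -
  let ?f = "to_nat_on (idx W)"
  let ?N = "Word {(?f i, ?f j) | i j. (i, j) \<in> le W} (\<lambda>n. letter_at W (inv_into (idx W) ?f n))"
  have c: "countable (idx W)" using assms by (simp add: countable_word_def)
  have inj: "inj_on ?f (idx W)" using c by (rule inj_on_to_nat_on)
  have idx: "idx ?N = ?f ` idx W"
    by (force simp: self_idx)
  have "word_eq W ?N"
    unfolding word_eq_def
  proof (intro exI conjI ballI)
    show "bij_betw ?f (idx W) (idx ?N)" unfolding idx using inj by (simp add: bij_betw_def)
    show "((i, j) \<in> le W) = ((?f i, ?f j) \<in> le ?N)" if "i \<in> idx W" "j \<in> idx W" for i j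
    proof
      assume "(?f i, ?f j) \<in> le ?N"
      then obtain i' j' where ij: "?f i = ?f i'" "?f j = ?f j'" "(i', j') \<in> le W" by auto
      then have "i = i'" "j = j'" using inj that idx_le by (metis inj_onD)+
      then show "(i, j) \<in> le W" using ij by simp
    qed auto
    show "letter_at ?N (?f i) = letter_at W i" if "i \<in> idx W" for i
      using that inj by simp
  qed
  then show ?thesis unfolding nat_word_def by (rule someI)
qed

section \<open>Concatenation and inversion\<close>

text \<open>Concatenation on the disjoint sum of the index sets. Unlike \<open>concat_words\<close> it is associative by
  a mere reshuffling of summands, and finite concatenations are compared through it.\<close>

definition cat2 :: "('i, 'a) word \<Rightarrow> ('j, 'a) word \<Rightarrow> ('i + 'j, 'a) word" where
  "cat2 A B = Word ((\<lambda>(i, j). (Inl i, Inl j)) ` le A \<union> (\<lambda>(i, j). (Inr i, Inr j)) ` le B \<union>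
                    (Inl ` idx A) \<times> (Inr ` idx B))
                   (case_sum (letter_at A) (letter_at B))"

lemma le_cat2 [simp]:
  "(Inl i, Inl i') \<in> le (cat2 A B) \<longleftrightarrow> (i, i') \<in> le A"
  "(Inr j, Inr j') \<in> le (cat2 A B) \<longleftrightarrow> (j, j') \<in> le B"
  "(Inl i, Inr j) \<in> le (cat2 A B) \<longleftrightarrow> i \<in> idx A \<and> j \<in> idx B"
  "(Inr j, Inl i) \<notin> le (cat2 A B)"
  unfolding cat2_def by force+

lemma letter_at_cat2 [simp]:
  "letter_at (cat2 A B) (Inl i) = letter_at A i"
  "letter_at (cat2 A B) (Inr j) = letter_at B j"
  unfolding cat2_def by auto

lemma idx_cat2:
  fixes A :: "('i, 'a) word" and B :: "('j, 'a) word"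
  shows "idx (cat2 A B) = Inl ` idx A \<union> Inr ` idx B"
proof (intro Set.set_eqI)
  fix x :: "'i + 'j" show "x \<in> idx (cat2 A B) \<longleftrightarrow> x \<in> Inl ` idx A \<union> Inr ` idx B"
  proof (cases x)
    case (Inl a)
    have "x \<in> idx (cat2 A B) \<longleftrightarrow> a \<in> idx A"
      unfolding Inl self_idx[of _ "cat2 A B"] split_sum_ex using self_idx[of _ A] self_idx[of _ B] by (auto dest: idx_le)
    then show ?thesis using Inl by auto
  next
    case (Inr b)
    have "x \<in> idx (cat2 A B) \<longleftrightarrow> b \<in> idx B"
      unfolding Inr self_idx[of _ "cat2 A B"] split_sum_ex using self_idx[of _ A] self_idx[of _ B] by (auto dest: idx_le)
    then show ?thesis using Inr by auto
  qed
qed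

lemma cat2_cong:
  assumes "word_eq A A'" "word_eq B B'" shows "word_eq (cat2 A B) (cat2 A' B')"
proof -
  obtain f where f: "bij_betw f (idx A) (idx A')"
    "\<forall>i\<in>idx A. \<forall>j\<in>idx A. (i, j) \<in> le A \<longleftrightarrow> (f i, f j) \<in> le A'"
    "\<forall>i\<in>idx A. letter_at A' (f i) = letter_at A i"
    using assms unfolding word_eq_def by blast
  obtain g where g: "bij_betw g (idx B) (idx B')"
    "\<forall>i\<in>idx B. \<forall>j\<in>idx B. (i, j) \<in> le B \<longleftrightarrow> (g i, g j) \<in> le B'"
    "\<forall>i\<in>idx B. letter_at B' (g i) = letter_at B i"
    using assms unfolding word_eq_def by blast
  have m: "\<And>i. i \<in> idx A \<Longrightarrow> f i \<in> idx A'" "\<And>i. i \<in> idx B \<Longrightarrow> g i \<in> idx B'"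
    using f(1) g(1) by (auto simp: bij_betw_def)
  have b: "bij_betw (map_sum f g) (idx (cat2 A B)) (idx (cat2 A' B'))"
  proof (rule bij_betw_imageI)
    show "inj_on (map_sum f g) (idx (cat2 A B))"
    proof (rule inj_onI)
      fix x y assume "x \<in> idx (cat2 A B)" "y \<in> idx (cat2 A B)" "map_sum f g x = map_sum f g y"
      then show "x = y" using f(1) g(1) unfolding idx_cat2 bij_betw_def
        by (cases x; cases y) (auto dest: inj_onD)
    qed
    have "f ` idx A = idx A'" "g ` idx B = idx B'" using f(1) g(1) by (auto simp: bij_betw_def)
    then show "map_sum f g ` idx (cat2 A B) = idx (cat2 A' B')"
      by (simp add: idx_cat2 image_Un image_image flip: \<open>f ` idx A = idx A'\<close> \<open>g ` idx B = idx B'\<close>)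
  qed
  show ?thesis
    unfolding word_eq_def
    by (intro exI[of _ "map_sum f g"] conjI b) (use f g m in \<open>auto simp: idx_cat2\<close>)
qed

lemma cat2_assoc: "word_eq (cat2 (cat2 A B) C) (cat2 A (cat2 B C))"
proof -
  let ?f = "case_sum (case_sum Inl (Inr \<circ> Inl)) (Inr \<circ> Inr)"
  have "bij_betw ?f (idx (cat2 (cat2 A B) C)) (idx (cat2 A (cat2 B C)))"
    unfolding idx_cat2 bij_betw_def inj_on_def by (auto simp: image_Un image_image)
  then show ?thesis
    unfolding word_eq_def
    by (intro exI[of _ ?f]) (auto simp: idx_cat2)
qed

lemma cat2_empty_left: "idx E = {} \<Longrightarrow> word_eq (cat2 E A) A"
  unfolding word_eq_def
  by (intro exI[of _ "case_sum undefined id"]) (auto simp: idx_cat2 bij_betw_def inj_on_def image_image)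

lemma cat2_countable_word:
  assumes "countable_word A" "countable_word B" shows "countable_word (cat2 A B)"
proof (rule countable_wordI)
  show "countable (idx (cat2 A B))" using assms by (simp add: idx_cat2 countable_word_def)
  show "\<And>i. i \<in> idx (cat2 A B) \<Longrightarrow> (i, i) \<in> le (cat2 A B)"
    using assms by (auto simp: idx_cat2 countable_word_refl)
  show "(i, k) \<in> le (cat2 A B)" if "(i, j) \<in> le (cat2 A B)" "(j, k) \<in> le (cat2 A B)" for i j k
    using that by (cases i; cases j; cases k)
      (auto dest: idx_le intro: countable_word_trans[OF assms(1)] countable_word_trans[OF assms(2)])
  show "i = j" if "(i, j) \<in> le (cat2 A B)" "(j, i) \<in> le (cat2 A B)" for i j
    using that countable_word_antisym[OF assms(1)] countable_word_antisym[OF assms(2)]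
    by (cases i; cases j; auto)
  show "(i, j) \<in> le (cat2 A B) \<or> (j, i) \<in> le (cat2 A B)" if "i \<in> idx (cat2 A B)" "j \<in> idx (cat2 A B)" for i j
    using that by (auto simp: idx_cat2 dest: countable_word_total[OF assms(1)] countable_word_total[OF assms(2)])
qed

lemma restricted_cat2: "restricted (cat2 A B) \<longleftrightarrow> restricted A \<and> restricted B"
proof -
  have "{i \<in> idx (cat2 A B). letter_at (cat2 A B) i = x} =
     Inl ` {i \<in> idx A. letter_at A i = x} \<union> Inr ` {i \<in> idx B. letter_at B i = x}" for x
    by (auto simp: idx_cat2)
  then show ?thesis unfolding restricted_def by (auto simp: finite_image_iff)
qed

lemma le_concat_words:
  "((k, i), (l, j)) \<in> le (concat_words Ws) \<longleftrightarrow>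
    k < length Ws \<and> l < length Ws \<and> i \<in> idx (Ws ! k) \<and> j \<in> idx (Ws ! l) \<and> (k < l \<or> k = l \<and> (i, j) \<in> le (Ws ! k))"
  unfolding concat_words_def by auto

lemma letter_at_concat_words [simp]: "letter_at (concat_words Ws) (k, i) = letter_at (Ws ! k) i"
  unfolding concat_words_def by simp

lemma idx_concat_words:
  "idx (concat_words Ws) \<subseteq> {(k, i). k < length Ws \<and> i \<in> idx (Ws ! k)}"
  "\<forall>V\<in>set Ws. countable_word V \<Longrightarrow> idx (concat_words Ws) = {(k, i). k < length Ws \<and> i \<in> idx (Ws ! k)}"
proof -
  show A: "idx (concat_words Ws) \<subseteq> {(k, i). k < length Ws \<and> i \<in> idx (Ws ! k)}"
  proof (rule subrelI)
    fix k i assume "(k, i) \<in> idx (concat_words Ws)"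
    then obtain p where "((k, i), p) \<in> le (concat_words Ws) \<or> (p, (k, i)) \<in> le (concat_words Ws)"
      unfolding self_idx[of _ "concat_words Ws"] by blast
    then show "(k, i) \<in> {(k, i). k < length Ws \<and> i \<in> idx (Ws ! k)}"
      by (cases p) (auto simp: le_concat_words)
  qed
  assume c: "\<forall>V\<in>set Ws. countable_word V"
  have "(k, i) \<in> idx (concat_words Ws)" if "k < length Ws" "i \<in> idx (Ws ! k)" for k i
  proof -
    have "(i, i) \<in> le (Ws ! k)" by (rule countable_word_refl) (use c that nth_mem in auto)
    then have "((k, i), (k, i)) \<in> le (concat_words Ws)" using that by (simp add: le_concat_words)
    then show ?thesis by (rule idx_le[THEN conjunct1])
  qed
  with A show "idx (concat_words Ws) = {(k, i). k < length Ws \<and> i \<in> idx (Ws ! k)}" by auto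
qed

lemma concat_words_Nil: "idx (concat_words []) = {}"
  using idx_concat_words(1)[of "[]"] by auto

lemma concat_words_Cons:
  assumes "countable_word A" "\<forall>V\<in>set Ws. countable_word V"
  shows "word_eq (concat_words (A # Ws)) (cat2 A (concat_words Ws))"
proof -
  let ?f = "\<lambda>(k, i). if k = 0 then Inl i else Inr (k - 1, i)"
  let ?g = "case_sum (\<lambda>i. (0, i)) (\<lambda>(k, i). (Suc k, i))"
  have i1: "idx (concat_words (A # Ws)) = {(k, i). k < length (A # Ws) \<and> i \<in> idx ((A # Ws) ! k)}"
    using assms by (intro idx_concat_words) auto
  have i2: "idx (concat_words Ws) = {(k, i). k < length Ws \<and> i \<in> idx (Ws ! k)}"
    using assms by (intro idx_concat_words) auto
  have "bij_betw ?f (idx (concat_words (A # Ws))) (idx (cat2 A (concat_words Ws)))"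
    unfolding i1 idx_cat2 i2
    by (rule bij_betw_byWitness[where f' = ?g]) (auto simp: nth_Cons split: nat.splits if_splits)
  then show ?thesis
    unfolding word_eq_def
    by (intro exI[of _ ?f])
       (auto simp: i1 i2 le_concat_words nth_Cons split: nat.splits if_splits)
qed

lemma concat_words_countable:
  assumes "\<forall>V\<in>set Ws. countable_word V" shows "countable_word (concat_words Ws)"
  using assms
proof (induction Ws)
  case Nil
  show ?case by (rule countable_wordI) (auto simp: concat_words_Nil dest: idx_le)
next
  case (Cons A Ws)
  then show ?case
    using word_eq_countable_word[OF word_eq_sym[OF concat_words_Cons] cat2_countable_word] by auto
qed

lemma concat_words_cong_Cons:
  assumes "countable_word A" "countable_word A'" "\<forall>V\<in>set Ws. countable_word V" "\<forall>V\<in>set Ws'. countable_word V"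
    "word_eq A A'" "word_eq (concat_words Ws) (concat_words Ws')"
  shows "word_eq (concat_words (A # Ws)) (concat_words (A' # Ws'))"
  using assms word_eq_trans[OF concat_words_Cons word_eq_trans[OF cat2_cong word_eq_sym[OF concat_words_Cons]]]
  by blast

lemma concat_words_append:
  assumes "\<forall>V\<in>set Ws. countable_word V" "\<forall>V\<in>set Ws'. countable_word V"
  shows "word_eq (concat_words (Ws @ Ws')) (cat2 (concat_words Ws) (concat_words Ws'))"
  using assms
proof (induction Ws)
  case Nil
  show ?case using word_eq_sym[OF cat2_empty_left[OF concat_words_Nil]] by simp
next
  case (Cons A Ws)
  have 1: "word_eq (concat_words (A # (Ws @ Ws'))) (cat2 A (concat_words (Ws @ Ws')))"
    using Cons.prems by (intro concat_words_Cons) auto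
  have 2: "word_eq (cat2 A (concat_words (Ws @ Ws'))) (cat2 A (cat2 (concat_words Ws) (concat_words Ws')))"
    using Cons by (intro cat2_cong word_eq_refl) auto
  have 3: "word_eq (cat2 (cat2 A (concat_words Ws)) (concat_words Ws')) (cat2 (concat_words (A # Ws)) (concat_words Ws'))"
    using Cons.prems by (intro cat2_cong word_eq_refl word_eq_sym[OF concat_words_Cons]) auto
  show ?case
    using word_eq_trans[OF 1 word_eq_trans[OF 2 word_eq_trans[OF word_eq_sym[OF cat2_assoc] 3]]] by simp
qed

text \<open>Steps of the transformations group a word into four or five blocks, each of which may itself
  be a concatenation of many pieces.\<close>

lemma concat_words_flatten:
  assumes "\<forall>V\<in>set Xs. countable_word V" "\<forall>V\<in>set Ys. countable_word V"
  shows "word_eq (concat_words (Xs @ Ys)) (concat_words (nat_word (concat_words Xs) # Ys))"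
proof -
  have c: "countable_word (concat_words Xs)" using assms concat_words_countable by blast
  then have c': "countable_word (nat_word (concat_words Xs))"
    using nat_word_eq word_eq_countable_word by blast
  show ?thesis
    using word_eq_trans[OF concat_words_append[OF assms]
        word_eq_trans[OF cat2_cong[OF nat_word_eq[OF c] word_eq_refl] word_eq_sym[OF concat_words_Cons[OF c' assms(2)]]]] .
qed

lemma idx_inv_word [simp]: "idx (inv_word W) = idx W"
  by (simp add: inv_word_def idx_def Field_def Un_commute)

lemma le_inv_word [simp]: "(i, j) \<in> le (inv_word W) \<longleftrightarrow> (j, i) \<in> le W"
  by (simp add: inv_word_def)

lemma letter_at_inv_word [simp]: "letter_at (inv_word W) i = inv_letter (letter_at W i)"
  by (simp add: inv_word_def)

lemma inv_word_inv [simp]: "inv_word (inv_word W) = W"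
  by (cases W) (simp add: inv_word_def)

lemma inv_word_cong: "word_eq V W \<Longrightarrow> word_eq (inv_word V) (inv_word W)"
  unfolding word_eq_def by auto

lemma countable_inv_word [simp]: "countable_word (inv_word W) \<longleftrightarrow> countable_word W"
proof -
  have *: "countable_word (inv_word W)" if "countable_word W" for W :: "('i, 'b) word"
  proof (rule countable_wordI)
    show "countable (idx (inv_word W))" using that by (simp add: countable_word_def)
  qed (use countable_word_refl[OF that] countable_word_antisym[OF that] countable_word_trans[OF that]
         countable_word_total[OF that] in \<open>(simp; blast)+\<close>)
  from *[of W] *[of "inv_word W"] show ?thesis by auto
qed

section \<open>Words on subsets of a linear order\<close>

definition word_on :: "('b::linorder \<Rightarrow> 'a letter) \<Rightarrow> 'b set \<Rightarrow> ('b, 'a) word" where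
  "word_on lab M = Word {(x, y). x \<in> M \<and> y \<in> M \<and> x \<le> y} lab"

lemma le_word_on [simp]: "(x, y) \<in> le (word_on lab M) \<longleftrightarrow> x \<in> M \<and> y \<in> M \<and> x \<le> y"
  by (simp add: word_on_def)

lemma idx_word_on [simp]: "idx (word_on lab M) = M"
  by (auto simp: idx_def word_on_def Field_def)

lemma letter_at_word_on [simp]: "letter_at (word_on lab M) = lab"
  by (simp add: word_on_def)

lemma prec_word_on [simp]: "prec (word_on lab M) x y \<longleftrightarrow> x \<in> M \<and> y \<in> M \<and> x < y"
  by (auto simp: prec_def)

lemma countable_word_on: "countable M \<Longrightarrow> countable_word (word_on lab M)"
  by (intro countable_wordI) auto

lemma word_on_Un:
  assumes "\<And>x y. x \<in> A \<Longrightarrow> y \<in> B \<Longrightarrow> x < y"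
  shows "word_eq (word_on lab (A \<union> B)) (cat2 (word_on lab A) (word_on lab B))"
proof -
  let ?f = "\<lambda>x. if x \<in> A then Inl x else Inr x"
  have d: "x \<notin> B" if "x \<in> A" for x using assms that by blast
  have "bij_betw ?f (A \<union> B) (idx (cat2 (word_on lab A) (word_on lab B)))"
    unfolding idx_cat2 bij_betw_def inj_on_def using d by (auto simp: image_iff)
  then show ?thesis
    unfolding word_eq_def
    by (intro exI[of _ ?f]) (use d assms in \<open>auto simp: less_imp_le dest: leD\<close>)
qed

lemma word_on_image:
  assumes "\<And>x y. x \<in> M \<Longrightarrow> y \<in> M \<Longrightarrow> x < y \<Longrightarrow> f x < f y" "\<And>x. x \<in> M \<Longrightarrow> lab' (f x) = lab x"
  shows "word_eq (word_on lab M) (word_on lab' (f ` M))"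
proof -
  have m: "f x \<le> f y \<longleftrightarrow> x \<le> y" if "x \<in> M" "y \<in> M" for x y
    using assms(1) that by (metis leD le_less_linear less_imp_le order.order_iff_strict)
  have "inj_on f M" by (rule inj_onI) (metis m antisym order_refl)
  then show ?thesis
    unfolding word_eq_def
    by (intro exI[of _ f]) (use m assms(2) in \<open>auto simp: bij_betw_def\<close>)
qed

lemma word_on_image_anti:
  assumes "\<And>x y. x \<in> M \<Longrightarrow> y \<in> M \<Longrightarrow> x < y \<Longrightarrow> f y < f x" "\<And>x. x \<in> M \<Longrightarrow> lab' (f x) = inv_letter (lab x)"
  shows "word_eq (inv_word (word_on lab M)) (word_on lab' (f ` M))"
proof -
  have m: "f x \<le> f y \<longleftrightarrow> y \<le> x" if "x \<in> M" "y \<in> M" for x y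
    using assms(1) that by (metis leD le_less_linear less_imp_le order.order_iff_strict)
  have "inj_on f M" by (rule inj_onI) (metis m antisym order_refl)
  then show ?thesis
    unfolding word_eq_def
    by (intro exI[of _ f]) (use m assms(2) in \<open>auto simp: bij_betw_def\<close>)
qed

text \<open>Fibres that are convex do not interleave, so finitely many of them are linearly ordered, and
  the fibre containing the least of chosen representatives comes first.\<close>

lemma word_on_blocks:
  assumes "finite (key ` M)" "countable M"
    and conv: "\<And>x y z. x \<in> M \<Longrightarrow> y \<in> M \<Longrightarrow> z \<in> M \<Longrightarrow> x < y \<Longrightarrow> y < z \<Longrightarrow> key x = key z \<Longrightarrow> key y = key x"
  shows "\<exists>ks. distinct ks \<and> set ks = key ` M \<and>
    word_eq (word_on lab M) (concat_words (map (\<lambda>k. nat_word (word_on lab {x \<in> M. key x = k})) ks))"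
  using assms
proof (induction "card (key ` M)" arbitrary: M)
  case 0
  then have "M = {}" by auto
  then show ?case
    by (intro exI[of _ "[]"]) (auto simp: word_eq_def bij_betw_def concat_words_Nil)
next
  case (Suc n M)
  have "\<forall>k\<in>key ` M. \<exists>x. x \<in> M \<and> key x = k" by auto
  then obtain r where r: "\<And>k. k \<in> key ` M \<Longrightarrow> r k \<in> M \<and> key (r k) = k" by metis
  have ne: "key ` M \<noteq> {}" using Suc.hyps(2) by auto
  define k0 where "k0 = arg_min_on r (key ` M)"
  have k0: "k0 \<in> key ` M" "\<And>k. k \<in> key ` M \<Longrightarrow> r k0 \<le> r k"
    using arg_min_if_finite(1)[OF Suc.prems(1) ne, of r] arg_min_least[OF Suc.prems(1) ne, of _ r]
    unfolding k0_def by auto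
  define A where "A = {x \<in> M. key x = k0}"
  define B where "B = {x \<in> M. key x \<noteq> k0}"
  have AB: "x < y" if "x \<in> A" "y \<in> B" for x y
  proof (rule ccontr)
    assume "\<not> x < y"
    then have yx: "y < x" using that unfolding A_def B_def by (auto simp: not_less order.order_iff_strict)
    let ?k = "key y"
    have y: "y \<in> M" "?k \<in> key ` M" "?k \<noteq> k0" and x: "x \<in> M" "key x = k0"
      using that unfolding A_def B_def by auto
    have r0: "r k0 < r ?k" using k0(2)[OF y(2)] r[OF y(2)] r[OF k0(1)] y(3)
      by (metis order.not_eq_order_implies_strict)
    \<comment> \<open>Either way a member of one fibre lies between two members of the other.\<close>
    consider "r k0 < y" | "y < r k0" using r[OF k0(1)] y(3) by (metis neqE)
    then show False
    proof cases
      case 1 then show ?thesis using Suc.prems(3)[of "r k0" y x] r[OF k0(1)] y x yx by auto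
    next
      case 2 then show ?thesis using Suc.prems(3)[of y "r k0" "r ?k"] r[OF k0(1)] r[OF y(2)] y r0 by auto
    qed
  qed
  have M: "M = A \<union> B" unfolding A_def B_def by auto
  have kB: "key ` B = key ` M - {k0}" unfolding B_def by auto
  have "n = card (key ` B)" using Suc.hyps(2) k0(1) Suc.prems(1) by (simp add: kB)
  moreover have cA: "countable A" and cB: "countable B" using Suc.prems(2) M by auto
  moreover have "finite (key ` B)" using kB Suc.prems(1) by simp
  moreover have "key y = key x" if "x \<in> B" "y \<in> B" "z \<in> B" "x < y" "y < z" "key x = key z" for x y z
    using Suc.prems(3)[of x y z] that M by blast
  ultimately obtain ks where ks: "distinct ks" "set ks = key ` B"
    "word_eq (word_on lab B) (concat_words (map (\<lambda>k. nat_word (word_on lab {x \<in> B. key x = k})) ks))"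
    using Suc.hyps(1)[of B] by blast
  have eq: "map (\<lambda>k. nat_word (word_on lab {x \<in> B. key x = k})) ks = map (\<lambda>k. nat_word (word_on lab {x \<in> M. key x = k})) ks"
    using ks(2) by (intro map_cong refl arg_cong[of _ _ "\<lambda>X. nat_word (word_on lab X)"]) (auto simp: B_def)
  let ?f = "\<lambda>k. nat_word (word_on lab {x \<in> M. key x = k})"
  have cf: "countable_word (?f k)" for k
    using Suc.prems(2) by (intro word_eq_countable_word[OF nat_word_eq] countable_word_on) auto
  have "word_eq (word_on lab M) (cat2 (word_on lab A) (word_on lab B))"
    unfolding M by (rule word_on_Un) (rule AB)
  moreover have "word_eq (cat2 (word_on lab A) (word_on lab B)) (cat2 (?f k0) (concat_words (map ?f ks)))"
    using ks(3) nat_word_eq[OF countable_word_on[OF cA]] unfolding eq A_def by (intro cat2_cong)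
  moreover have "word_eq (cat2 (?f k0) (concat_words (map ?f ks))) (concat_words (map ?f (k0 # ks)))"
    using cf by (simp, intro word_eq_sym[OF concat_words_Cons]) auto
  ultimately have "word_eq (word_on lab M) (concat_words (map ?f (k0 # ks)))"
    by (blast intro: word_eq_trans)
  moreover have "distinct (k0 # ks)" "set (k0 # ks) = key ` M" using ks kB k0(1) by auto
  ultimately show ?case by blast
qed

section \<open>Free groups\<close>

text \<open>Left multiplication by a letter, acting on reduced lists. Cancellation only ever concerns the
  head, so reducing a list is a \<open>foldr\<close>, and the free group can be taken as lists modulo equal
  reductions.\<close>

fun push :: "'a letter \<Rightarrow> 'a letter list \<Rightarrow> 'a letter list" where
  "push x [] = [x]"
| "push x (y # ys) = (if y = inv_letter x then ys else x # y # ys)"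

definition fred :: "'a letter list \<Rightarrow> 'a letter list" where
  "fred w = foldr push w []"

fun freduced :: "'a letter list \<Rightarrow> bool" where
  "freduced (x # y # w) \<longleftrightarrow> y \<noteq> inv_letter x \<and> freduced (y # w)"
| "freduced _ \<longleftrightarrow> True"

lemma freduced_Cons: "freduced (x # w) \<Longrightarrow> freduced w"
  by (cases w) auto

lemma freduced_push: "freduced s \<Longrightarrow> freduced (push x s)"
  by (cases s) (auto dest: freduced_Cons)

lemma freduced_foldr: "freduced s \<Longrightarrow> freduced (foldr push w s)"
  by (induction w) (auto simp: freduced_push)

lemma push_push: "freduced s \<Longrightarrow> push x (push (inv_letter x) s) = s"
  by (cases s; cases "tl s") auto

lemma push_push': "freduced s \<Longrightarrow> push (inv_letter x) (push x s) = s"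
  using push_push[of s "inv_letter x"] by simp

text \<open>A letter and its inverse act by mutually inverse maps, so a list acts as its reduction does.
  This makes the reduction of a product depend on the reductions of the factors only.\<close>

lemma foldr_push_fred: "freduced s \<Longrightarrow> foldr push (fred w) s = foldr push w s"
proof (induction w)
  case (Cons x w)
  have r: "freduced (fred w)" unfolding fred_def by (rule freduced_foldr) simp
  show ?case
  proof (cases "\<exists>ys. fred w = inv_letter x # ys")
    case True
    then obtain ys where ys: "fred w = inv_letter x # ys" by blast
    have "fred (x # w) = ys" using ys by (simp add: fred_def)
    moreover have "foldr push w s = push (inv_letter x) (foldr push ys s)"
      using Cons ys by simp
    ultimately show ?thesis using push_push[OF freduced_foldr[OF Cons.prems]] by simp
  next
    case False
    then have "fred (x # w) = x # fred w" by (cases "fred w") (auto simp: fred_def)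
    then show ?thesis using Cons by simp
  qed
qed (simp add: fred_def)

lemma fred_id: "freduced w \<Longrightarrow> fred w = w"
proof (induction w)
  case (Cons x w)
  then have "fred w = w" by (auto dest: freduced_Cons)
  then show ?case using Cons.prems by (cases w) (auto simp: fred_def)
qed (simp add: fred_def)

lemma fred_append: "fred (u @ v) = foldr push (fred u) (fred v)"
  using foldr_push_fred[OF freduced_foldr[of "[]" v], of u] by (simp add: fred_def)

lemma fred_fred [simp]: "fred (fred u) = fred u"
  by (rule fred_id) (simp add: fred_def freduced_foldr)

lemma fred_append': "fred (u @ v) = fred (fred u @ fred v)"
  by (simp add: fred_append)

definition finv :: "'a letter list \<Rightarrow> 'a letter list" where
  "finv w = rev (map inv_letter w)"

lemma fred_finv_left: "fred (finv w @ w) = []"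
proof (induction w)
  case (Cons x w)
  have "fred (finv (x # w) @ x # w) = foldr push (finv w) (push (inv_letter x) (push x (foldr push w [])))"
    by (simp add: finv_def fred_def)
  also have "\<dots> = fred (finv w @ w)"
    by (simp add: fred_def push_push' freduced_foldr)
  finally show ?case using Cons by simp
qed (simp add: fred_def finv_def)

lemma finv_finv [simp]: "finv (finv w) = w"
  by (simp add: finv_def rev_map comp_def)

lemma fred_finv_right: "fred (w @ finv w) = []"
  using fred_finv_left[of "finv w"] by simp

lemma fred_finv_cong:
  assumes "fred u = fred v" shows "fred (finv u) = fred (finv v)"
proof -
  have "fred (finv u) = fred (finv u @ (v @ finv v))"
    using fred_append'[of "finv u" "v @ finv v"] fred_append'[of "finv u" "[]"] 
    by (simp add: fred_finv_right)
  also have "\<dots> = fred ((finv u @ u) @ finv v)"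
    using fred_append'[of "finv u @ v" "finv v"] fred_append'[of "finv u" v] fred_append'[of "finv u" u]
      fred_append'[of "finv u @ u" "finv v"] assms by simp
  also have "\<dots> = fred (finv v)"
    using fred_append'[of "finv u @ u" "finv v"] fred_append'[of "[]" "finv v"]
    by (simp add: fred_finv_left)
  finally show ?thesis .
qed

quotient_type 'a fgrp = "'a letter list" / "\<lambda>u v. fred u = fred v"
  by (auto intro!: equivpI reflpI sympI transpI)

text \<open>The group operation is written additively: \<open>group_add\<close> is the type class of groups that need
  not be commutative.\<close>

instantiation fgrp :: (type) group_add
begin

lift_definition zero_fgrp :: "'a fgrp" is "[]" .
lift_definition plus_fgrp :: "'a fgrp \<Rightarrow> 'a fgrp \<Rightarrow> 'a fgrp" is "(@)"
  by (metis fred_append')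
lift_definition uminus_fgrp :: "'a fgrp \<Rightarrow> 'a fgrp" is finv
  by (rule fred_finv_cong)
definition minus_fgrp :: "'a fgrp \<Rightarrow> 'a fgrp \<Rightarrow> 'a fgrp" where "minus_fgrp a b = a + - b"

instance
proof
  fix a b c :: "'a fgrp"
  show "a + b + c = a + (b + c)" by transfer simp
  show "0 + a = a" by transfer simp
  show "a + 0 = a" by transfer simp
  show "- a + a = 0" by transfer (simp only: fred_finv_left, simp add: fred_def)
  show "a + - b = a - b" by (simp add: minus_fgrp_def)
qed
end

lift_definition fgen :: "'a letter \<Rightarrow> 'a fgrp" is "\<lambda>x. [x]" .

definition fval :: "'a letter list \<Rightarrow> 'a fgrp" where
  "fval w = sum_list (map fgen w)"

lemma fval_simps [simp]: "fval [] = 0" "fval (x # w) = fgen x + fval w" "fval (u @ v) = fval u + fval v"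
  by (simp_all add: fval_def)

lemma fval_abs: "fval w = abs_fgrp w"
proof (induction w)
  case Nil show ?case by (simp add: zero_fgrp_def)
next
  case (Cons x w)
  have "fgen x + abs_fgrp w = abs_fgrp (x # w)"
    by (simp add: fgen.abs_eq plus_fgrp.abs_eq)
  then show ?case using Cons by simp
qed

lemma fval_eq_0: "fval w = 0 \<longleftrightarrow> fred w = []"
  unfolding fval_abs zero_fgrp_def fgrp.abs_eq_iff by (simp add: fred_def)

lemma fgen_inv [simp]: "fgen (inv_letter x) = - fgen x"
  by transfer (simp add: finv_def)

lemma fval_finv: "fval (finv w) = - fval w"
  by (induction w) (auto simp: finv_def minus_add)

section \<open>Values of words in free groups\<close>

primrec gen_of :: "'a letter \<Rightarrow> 'a" where
  "gen_of (Gen a) = a" | "gen_of (GenInv a) = a"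

lemma gen_of_inv [simp]: "gen_of (inv_letter x) = gen_of x"
  by (cases x) auto

text \<open>The positions of a word that survive in the projection to the free group on the generators
  below \<open>N\<close>. If every letter occurs finitely often there are only finitely many.\<close>

definition low_letters :: "nat \<Rightarrow> ('b \<Rightarrow> nat letter) \<Rightarrow> 'b set \<Rightarrow> 'b set" where
  "low_letters N lab M = {x \<in> M. gen_of (lab x) < N}"

definition word_value :: "nat \<Rightarrow> ('b::linorder \<Rightarrow> nat letter) \<Rightarrow> 'b set \<Rightarrow> nat fgrp" where
  "word_value N lab M = fval (map lab (sorted_list_of_set (low_letters N lab M)))"

text \<open>Restrictedness, in the form in which a generator and its inverse are counted together.\<close>

definition fin_letters :: "('b \<Rightarrow> nat letter) \<Rightarrow> 'b set \<Rightarrow> bool" where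
  "fin_letters lab M \<longleftrightarrow> (\<forall>n. finite {x \<in> M. gen_of (lab x) = n})"

lemma fin_letters_finite: "fin_letters lab M \<Longrightarrow> finite (low_letters N lab M)"
proof -
  have "low_letters N lab M = (\<Union>n<N. {x \<in> M. gen_of (lab x) = n})" unfolding low_letters_def by auto
  then show "fin_letters lab M \<Longrightarrow> finite (low_letters N lab M)" unfolding fin_letters_def by auto
qed

lemma fin_letters_subset: "fin_letters lab M \<Longrightarrow> M' \<subseteq> M \<Longrightarrow> fin_letters lab M'"
  unfolding fin_letters_def by (auto intro: finite_subset[of _ "{x \<in> M. _ x}"])

lemma fin_letters_countable:
  assumes "fin_letters lab M" shows "countable M"
proof -
  have "M = (\<Union>n. {x \<in> M. gen_of (lab x) = n})" by auto
  then show ?thesis using assms unfolding fin_letters_def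
    by (metis (lifting) countable_UN countable_finite countableI_type)
qed

lemma fin_letters_restricted: "fin_letters lab M \<longleftrightarrow> restricted (word_on lab M)"
proof
  assume "fin_letters lab M"
  then show "restricted (word_on lab M)" unfolding restricted_def fin_letters_def
    by (intro allI finite_subset[of "{i \<in> idx (word_on lab M). letter_at (word_on lab M) i = x}" "{i \<in> M. gen_of (lab i) = gen_of x}" for x]) auto
next
  assume r: "restricted (word_on lab M)"
  have "{x \<in> M. gen_of (lab x) = n} = {x \<in> M. lab x = Gen n} \<union> {x \<in> M. lab x = GenInv n}" for n
    by (auto; metis gen_of.simps letter.exhaust)
  then show "fin_letters lab M" using r unfolding restricted_def fin_letters_def by simp
qed

lemma sorted_list_Un:
  assumes "finite A" "finite B" "\<And>x y. x \<in> A \<Longrightarrow> y \<in> B \<Longrightarrow> x < (y::'b::linorder)"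
  shows "sorted_list_of_set (A \<union> B) = sorted_list_of_set A @ sorted_list_of_set B"
proof (rule sorted_distinct_set_unique)
  show "sorted (sorted_list_of_set A @ sorted_list_of_set B)"
    using assms by (auto simp: sorted_append less_imp_le)
  show "distinct (sorted_list_of_set A @ sorted_list_of_set B)"
    using assms(1,2) assms(3) by fastforce
qed (use assms in auto)

lemma word_value_Un:
  assumes "fin_letters lab (A \<union> B)" "\<And>x y. x \<in> A \<Longrightarrow> y \<in> B \<Longrightarrow> x < y"
  shows "word_value N lab (A \<union> B) = word_value N lab A + word_value N lab B"
proof -
  have "low_letters N lab (A \<union> B) = low_letters N lab A \<union> low_letters N lab B" unfolding low_letters_def by auto
  moreover have "finite (low_letters N lab A)" "finite (low_letters N lab B)"
    using assms(1) by (auto intro!: fin_letters_finite elim: fin_letters_subset)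
  moreover have "sorted_list_of_set (low_letters N lab A \<union> low_letters N lab B) =
      sorted_list_of_set (low_letters N lab A) @ sorted_list_of_set (low_letters N lab B)"
    using calculation(2,3) by (rule sorted_list_Un) (use assms(2) in \<open>auto simp: low_letters_def\<close>)
  ultimately show ?thesis by (simp add: word_value_def)
qed

lemma word_value_empty [simp]: "word_value N lab {} = 0"
  by (simp add: word_value_def low_letters_def)

lemma word_value_image:
  assumes "fin_letters lab M"
    and mono: "\<And>x y. x \<in> M \<Longrightarrow> y \<in> M \<Longrightarrow> x < y \<Longrightarrow> f x < (f y :: 'c::linorder)"
    and lab: "\<And>x. x \<in> M \<Longrightarrow> lab' (f x) = lab x"
  shows "word_value N lab' (f ` M) = word_value N lab M" "fin_letters lab' (f ` M)"
proof -
  show "fin_letters lab' (f ` M)" unfolding fin_letters_def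
  proof
    fix n
    have "{x \<in> f ` M. gen_of (lab' x) = n} = f ` {x \<in> M. gen_of (lab x) = n}" using lab by auto
    then show "finite {x \<in> f ` M. gen_of (lab' x) = n}" using assms(1) by (simp add: fin_letters_def)
  qed
  let ?L = "low_letters N lab M"
  have fin: "finite ?L" by (rule fin_letters_finite[OF assms(1)])
  have eq: "low_letters N lab' (f ` M) = f ` ?L" using lab unfolding low_letters_def by auto
  have "sorted_wrt (<) (map f (sorted_list_of_set ?L))"
    unfolding sorted_wrt_map
    by (rule sorted_wrt_mono_rel[OF _ strict_sorted_list_of_set]) (use fin mono in \<open>auto simp: low_letters_def\<close>)
  then have "sorted_list_of_set (f ` ?L) = map f (sorted_list_of_set ?L)"
    using fin by (intro sorted_distinct_set_unique) (auto simp: strict_sorted_iff)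
  then show "word_value N lab' (f ` M) = word_value N lab M"
    unfolding word_value_def eq using lab fin by (auto intro!: arg_cong[of _ _ fval] simp: low_letters_def)
qed

lemma word_value_image_anti:
  assumes "fin_letters lab M"
    and mono: "\<And>x y. x \<in> M \<Longrightarrow> y \<in> M \<Longrightarrow> x < y \<Longrightarrow> f y < (f x :: 'c::linorder)"
    and lab: "\<And>x. x \<in> M \<Longrightarrow> lab' (f x) = inv_letter (lab x)"
  shows "word_value N lab' (f ` M) = - word_value N lab M" "fin_letters lab' (f ` M)"
proof -
  show "fin_letters lab' (f ` M)" unfolding fin_letters_def
  proof
    fix n
    have "{x \<in> f ` M. gen_of (lab' x) = n} = f ` {x \<in> M. gen_of (lab x) = n}" using lab by auto
    then show "finite {x \<in> f ` M. gen_of (lab' x) = n}" using assms(1) by (simp add: fin_letters_def)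
  qed
  let ?L = "low_letters N lab M"
  have fin: "finite ?L" by (rule fin_letters_finite[OF assms(1)])
  have eq: "low_letters N lab' (f ` M) = f ` ?L" using lab unfolding low_letters_def by auto
  have "sorted_wrt (<) (rev (map f (sorted_list_of_set ?L)))"
    unfolding sorted_wrt_rev sorted_wrt_map
    by (rule sorted_wrt_mono_rel[OF _ strict_sorted_list_of_set]) (use fin mono in \<open>auto simp: low_letters_def\<close>)
  then have s: "sorted_list_of_set (f ` ?L) = rev (map f (sorted_list_of_set ?L))"
    using fin by (intro sorted_distinct_set_unique) (auto simp: strict_sorted_iff)
  have "map lab' (rev (map f (sorted_list_of_set ?L))) = finv (map lab (sorted_list_of_set ?L))"
    unfolding finv_def using lab fin by (auto simp: rev_map low_letters_def)
  then show "word_value N lab' (f ` M) = - word_value N lab M"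
    unfolding word_value_def eq s by (simp add: fval_finv)
qed

section \<open>Noncrossing pairings\<close>

text \<open>A complete pairing of inverse letters, given as an involution on the positions.\<close>

definition nc_pairing :: "('b::linorder \<Rightarrow> nat letter) \<Rightarrow> 'b set \<Rightarrow> ('b \<Rightarrow> 'b) \<Rightarrow> bool" where
  "nc_pairing lab M p \<longleftrightarrow>
     (\<forall>x\<in>M. p x \<in> M \<and> p (p x) = x \<and> lab (p x) = inv_letter (lab x)) \<and>
     (\<forall>x\<in>M. \<forall>y\<in>M. \<not> (x < y \<and> y < p x \<and> p x < p y))"

lemma nc_pairingD:
  assumes "nc_pairing lab M p" "x \<in> M"
  shows "p x \<in> M" "p (p x) = x" "lab (p x) = inv_letter (lab x)" "p x \<noteq> x"
proof -
  have *: "p x \<in> M \<and> p (p x) = x \<and> lab (p x) = inv_letter (lab x)"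
    using assms unfolding nc_pairing_def by blast
  then show "p x \<in> M" "p (p x) = x" "lab (p x) = inv_letter (lab x)" by auto
  with inv_letter_neq(1)[of "lab x"] show "p x \<noteq> x" by auto
qed

lemma nc_pairing_nc: "nc_pairing lab M p \<Longrightarrow> x \<in> M \<Longrightarrow> y \<in> M \<Longrightarrow> x < y \<Longrightarrow> y < p x \<Longrightarrow> p x < p y \<Longrightarrow> False"
  unfolding nc_pairing_def by blast

lemma nc_pairing_inside:
  assumes "nc_pairing lab M p" "x \<in> M" "y \<in> M" "x < y" "y < p x"
  shows "x < p y" "p y < p x"
proof -
  note D = nc_pairingD[OF assms(1)]
  have "\<not> p x < p y" using nc_pairing_nc[OF assms] by blast
  moreover have "p y \<noteq> p x" using D(2) assms by (metis less_irrefl)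
  ultimately show "p y < p x" by auto
  have "p y \<noteq> x" using D(2)[OF assms(3)] assms by auto
  moreover have "\<not> p y < x"
    using nc_pairing_nc[OF assms(1) D(1)[OF assms(3)] assms(2)] D(2)[OF assms(3)] assms by auto
  ultimately show "x < p y" by auto
qed

lemma nc_pairing_outside:
  assumes "nc_pairing lab M p" "x \<in> M" "y \<in> M" "x < p x" "y < x \<or> p x < y"
  shows "p y < x \<or> p x < p y"
proof (rule ccontr)
  note D = nc_pairingD[OF assms(1)]
  assume "\<not> (p y < x \<or> p x < p y)"
  moreover have "p y \<noteq> x" using D(2)[OF assms(3)] assms(4,5) by (metis less_irrefl less_trans)
  moreover have "p y \<noteq> p x" using D(2)[OF assms(3)] D(2)[OF assms(2)] assms(4,5) by (metis less_irrefl less_asym)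
  ultimately have "x < p y" "p y < p x" by auto
  from nc_pairing_inside[OF assms(1,2) D(1)[OF assms(3)] this] D(2)[OF assms(3)] assms(5) show False by auto
qed

lemma nc_pairing_restrict:
  assumes "nc_pairing lab M p" "A \<subseteq> M" "\<And>x. x \<in> A \<Longrightarrow> p x \<in> A" shows "nc_pairing lab A p"
  using assms unfolding nc_pairing_def by (meson subsetD)

lemma not_freduced_split:
  "\<not> freduced w \<Longrightarrow> \<exists>u x v. w = u @ [x, inv_letter x] @ v"
proof (induction w rule: freduced.induct)
  case (1 x y w)
  show ?case
  proof (cases "y = inv_letter x")
    case True then show ?thesis by (intro exI[of _ "[]"]) auto
  next
    case False
    then obtain u z v where "y # w = u @ [z, inv_letter z] @ v" using 1 by auto
    then show ?thesis by (intro exI[of _ "x # u"] exI[of _ z] exI[of _ v]) auto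
  qed
qed auto

text \<open>A nonempty list of trivial value contains two adjacent inverse letters; pair them and
  continue with the rest.\<close>

lemma nc_pairing_of_list:
  assumes "sorted_wrt (<) xs" "fval (map lab xs) = 0"
  shows "\<exists>p. nc_pairing lab (set xs) p"
  using assms
proof (induction "length xs" arbitrary: xs rule: less_induct)
  case less
  show ?case
  proof (cases "xs = []")
    case True then show ?thesis by (auto simp: nc_pairing_def)
  next
    case False
    have "fred (map lab xs) = []" using less.prems fval_eq_0 by blast
    then have "\<not> freduced (map lab xs)" using fred_id[of "map lab xs"] False by auto
    then obtain u x v where "map lab xs = u @ [x, inv_letter x] @ v" using not_freduced_split by blast
    then obtain us a b vs where xs: "xs = us @ a # b # vs" "lab b = inv_letter (lab a)"
      by (auto simp: map_eq_append_conv map_eq_Cons_conv)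
    let ?ys = "us @ vs"
    have "sorted_wrt (<) ?ys" using less.prems(1) unfolding xs(1) by (auto simp: sorted_wrt_append)
    moreover have "fval (map lab ?ys) = 0" using less.prems(2) unfolding xs(1) by (simp add: xs(2) add.assoc[symmetric])
    ultimately obtain p where p: "nc_pairing lab (set ?ys) p"
      using less.hyps[of ?ys] xs(1) by auto
    define q where "q = p(a := b, b := a)"
    have ab: "a < b" "a \<notin> set ?ys" "b \<notin> set ?ys"
      using less.prems(1) unfolding xs(1) by (auto simp: sorted_wrt_append)
    have adj: "y < a \<or> b < y" if "y \<in> set ?ys" for y
      using less.prems(1) that unfolding xs(1) by (auto simp: sorted_wrt_append)
    have q: "q y = p y" if "y \<in> set ?ys" for y using that ab by (auto simp: q_def)
    have pm: "p y \<in> set ?ys" if "y \<in> set ?ys" for y using nc_pairingD(1)[OF p that] .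
    have qa: "q a = b" "q b = a" using ab by (auto simp: q_def)
    have set: "set xs = insert a (insert b (set ?ys))" unfolding xs(1) by auto
    have "nc_pairing lab (set xs) q"
      unfolding nc_pairing_def
    proof (rule conjI; intro ballI)
      fix y assume "y \<in> set xs"
      then consider "y = a" | "y = b" | "y \<in> set ?ys" using set by blast
      then show "q y \<in> set xs \<and> q (q y) = y \<and> lab (q y) = inv_letter (lab y)"
      proof cases
        case 3
        then show ?thesis using q[OF 3] q[OF pm[OF 3]] nc_pairingD[OF p 3] set by auto
      qed (use qa xs set in auto)
    next
      fix y z assume yz: "y \<in> set xs" "z \<in> set xs"
      show "\<not> (y < z \<and> z < q y \<and> q y < q z)"
      proof
        assume c: "y < z \<and> z < q y \<and> q y < q z"
        have "y \<noteq> a"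
        proof
          assume "y = a"
          then have z: "a < z" "z < b" using c qa by auto
          then have "z \<in> set ?ys" using yz(2) set by auto
          from adj[OF this] z show False by auto
        qed
        moreover have "y \<noteq> b" using c qa ab by auto
        ultimately have y: "y \<in> set ?ys" using yz set by blast
        have "z \<noteq> a" using c qa q[OF y] adj[OF pm[OF y]] by auto
        moreover have "z \<noteq> b" using c qa q[OF y] adj[OF pm[OF y]] ab by auto
        ultimately have z: "z \<in> set ?ys" using yz set by blast
        show False using nc_pairing_nc[OF p y z] c q[OF y] q[OF z] by auto
      qed
    qed
    then show ?thesis by blast
  qed
qed

text \<open>The last position that is paired to its right is adjacent to its partner, for a letter between
  them would be paired inside, giving a later such position.\<close>

lemma nc_pairing_finite_val:
  assumes "finite F" "nc_pairing lab F p" shows "fval (map lab (sorted_list_of_set F)) = 0"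
  using assms
proof (induction "card F" arbitrary: F rule: less_induct)
  case less
  show ?case
  proof (cases "F = {}")
    case False
    note D = nc_pairingD[OF less.prems(2)]
    let ?O = "{x \<in> F. x < p x}"
    have "?O \<noteq> {}"
    proof -
      obtain x where x: "x \<in> F" using False by blast
      then have "x < p x \<or> p x < p (p x)" using D(2,4)[OF x] by (metis neqE)
      then show ?thesis using x D(1) by blast
    qed
    then have "Max ?O \<in> ?O" using less.prems by (intro Max_in) auto
    then obtain a where a: "a \<in> F" "a < p a" "a = Max ?O" by auto
    have max: "x \<le> a" if "x \<in> F" "x < p x" for x using less.prems that by (simp add: a(3))
    define b where "b = p a"
    have b: "b \<in> F" "p b = a" "a < b" "lab b = inv_letter (lab a)" using D[OF a(1)] a b_def by auto
    have empty: "\<not> (a < y \<and> y < b)" if y: "y \<in> F" for y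
    proof
      assume c: "a < y \<and> y < b"
      then have i: "a < p y" "p y < b" using nc_pairing_inside[OF less.prems(2) a(1) y] b_def by auto
      have "y < p y \<or> p y < p (p y)" using D(2,4)[OF y] by (metis neqE)
      then show False using max[OF y] max[OF D(1)[OF y]] c i by auto
    qed
    let ?A = "{x \<in> F. x < a}" and ?B = "{x \<in> F. b < x}"
    have F: "F = ?A \<union> ({a} \<union> ({b} \<union> ?B))" using a(1) b(1) empty b(3) by (auto, force)
    have fin: "finite ?A" "finite ?B" using less.prems by auto
    have "nc_pairing lab (?A \<union> ?B) p"
    proof (rule nc_pairing_restrict[OF less.prems(2)])
      fix x assume x: "x \<in> ?A \<union> ?B"
      then have "p x < a \<or> b < p x" using nc_pairing_outside[OF less.prems(2) a(1) _ a(2)] b_def by auto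
      then show "p x \<in> ?A \<union> ?B" using x D(1) by auto
    qed auto
    moreover have "card (?A \<union> ?B) < card F"
    proof (rule psubset_card_mono[OF less.prems(1)])
      have "a \<notin> ?A \<union> ?B" using b(3) by auto
      then show "?A \<union> ?B \<subset> F" using a(1) by blast
    qed
    ultimately have "fval (map lab (sorted_list_of_set (?A \<union> ?B))) = 0"
      using less.hyps fin by blast
    moreover have "sorted_list_of_set (?A \<union> ?B) = sorted_list_of_set ?A @ sorted_list_of_set ?B"
      using fin b(3) by (intro sorted_list_Un) auto
    moreover have "sorted_list_of_set F = sorted_list_of_set ?A @ [a] @ [b] @ sorted_list_of_set ?B"
    proof -
      have "sorted_list_of_set F = sorted_list_of_set ?A @ sorted_list_of_set ({a} \<union> ({b} \<union> ?B))"
        by (subst F, rule sorted_list_Un) (use fin b(3) in auto)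
      also have "sorted_list_of_set ({a} \<union> ({b} \<union> ?B)) = sorted_list_of_set {a} @ sorted_list_of_set ({b} \<union> ?B)"
        by (rule sorted_list_Un) (use fin b(3) in auto)
      also have "sorted_list_of_set ({b} \<union> ?B) = sorted_list_of_set {b} @ sorted_list_of_set ?B"
        by (rule sorted_list_Un) (use fin b(3) in auto)
      finally show ?thesis by simp
    qed
    ultimately show ?thesis by (simp add: b(4) add.assoc[symmetric])
  qed simp
qed

lemma nc_pairing_val:
  assumes "fin_letters lab M" "nc_pairing lab M p" shows "word_value N lab M = 0"
  unfolding word_value_def
proof (rule nc_pairing_finite_val[OF fin_letters_finite[OF assms(1)]])
  show "nc_pairing lab (low_letters N lab M) p"
    by (rule nc_pairing_restrict[OF assms(2)]) (use nc_pairingD[OF assms(2)] in \<open>auto simp: low_letters_def\<close>)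
qed

text \<open>A compactness argument. For each \<open>N\<close> the letters below \<open>N\<close> have a noncrossing pairing. Each
  position has only finitely many possible partners, so a diagonal subsequence of these pairings is
  eventually constant at every position. The limit is a pairing, since each of the required
  properties involves at most two positions and their partners.\<close>

lemma word_value_nc_pairing:
  assumes fin: "fin_letters lab M" and v: "\<And>N. word_value N lab M = 0" shows "\<exists>p. nc_pairing lab M p"
proof (cases "M = {}")
  case False
  have "\<forall>N. \<exists>p. nc_pairing lab (low_letters N lab M) p"
  proof
    fix N
    have "finite (low_letters N lab M)" by (rule fin_letters_finite[OF fin])
    then show "\<exists>p. nc_pairing lab (low_letters N lab M) p"
      using nc_pairing_of_list[of "sorted_list_of_set (low_letters N lab M)" lab] v[of N] by (simp add: word_value_def)
  qed
  then obtain P where P: "\<And>N. nc_pairing lab (low_letters N lab M) (P N)" by metis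
  obtain e where e: "M = range (e :: nat \<Rightarrow> 'a)"
    using fin_letters_countable[OF fin] False by (metis uncountable_def)
  define Q where "Q n s \<longleftrightarrow> (\<exists>y. \<exists>K. \<forall>k\<ge>K. P (s k) (e n) = y)" for n and s :: "nat \<Rightarrow> nat"
  interpret subseqs Q
  proof
    fix n and s :: "nat \<Rightarrow> nat" assume s: "strict_mono s"
    let ?m = "gen_of (lab (e n))"
    have inM: "e n \<in> M" using e by auto
    \<comment> \<open>From this index on, the pairings are defined at the position in question.\<close>
    have "P (s (k + Suc ?m)) (e n) \<in> {x \<in> M. gen_of (lab x) = ?m}" for k
    proof -
      have "?m < s (k + Suc ?m)" using strict_mono_imp_increasing[OF s, of "k + Suc ?m"] by linarith
      then have "e n \<in> low_letters (s (k + Suc ?m)) lab M" using inM by (simp add: low_letters_def)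
      from nc_pairingD[OF P this] show ?thesis by (auto simp: low_letters_def)
    qed
    then have "finite (range (\<lambda>k. P (s (k + Suc ?m)) (e n)))"
      using fin unfolding fin_letters_def by (meson finite_subset image_subsetI)
    then obtain k0 where inf: "infinite {k. P (s (k + Suc ?m)) (e n) = P (s (k0 + Suc ?m)) (e n)}"
      using pigeonhole_infinite[of "UNIV :: nat set"] by auto
    let ?I = "{k. P (s (k + Suc ?m)) (e n) = P (s (k0 + Suc ?m)) (e n)}"
    define r where "r = (\<lambda>i. enumerate ?I i + Suc ?m)"
    have "strict_mono r" unfolding r_def strict_mono_def using strict_mono_enumerate[OF inf] by (auto simp: strict_mono_def)
    moreover have "Q n (s \<circ> r)" unfolding Q_def r_def
      using enumerate_in_set[OF inf] by auto
    ultimately show "\<exists>r'. strict_mono r' \<and> Q n (s \<circ> r')" by blast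
  qed
  have stab: "\<And>r s n. strict_mono r \<Longrightarrow> Q n s \<Longrightarrow> Q n (s \<circ> r)"
  proof -
    fix r s :: "nat \<Rightarrow> nat" and n assume r: "strict_mono r" and "Q n s"
    then obtain y K where K: "\<And>k. k \<ge> K \<Longrightarrow> P (s k) (e n) = y" unfolding Q_def by blast
    have "P ((s \<circ> r) k) (e n) = y" if "k \<ge> K" for k
      using K[of "r k"] strict_mono_imp_increasing[OF r, of k] that by simp
    then show "Q n (s \<circ> r)" unfolding Q_def by blast
  qed
  define d where "d = diagseq"
  have dm: "k \<le> d k" for k using strict_mono_imp_increasing[OF subseq_diagseq, of k] by (simp add: d_def)
  have "\<exists>y K. \<forall>k\<ge>K. P (d k) x = y" if "x \<in> M" for x
  proof -
    obtain n where n: "x = e n" using e \<open>x \<in> M\<close> by blast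
    obtain y K where K: "\<And>k. k \<ge> K \<Longrightarrow> P ((diagseq \<circ> (+) (Suc n)) k) (e n) = y"
      using diagseq_holds[OF stab, of n] unfolding Q_def by blast
    have "P (d k) x = y" if "k \<ge> K + Suc n" for k
      using K[of "k - Suc n"] that n by (simp add: d_def)
    then show ?thesis by blast
  qed
  then obtain p K where pK: "\<And>x k. x \<in> M \<Longrightarrow> k \<ge> K x \<Longrightarrow> P (d k) x = p x" by metis
  define L where "L x = max (K x) (Suc (gen_of (lab x)))" for x
  have L: "x \<in> low_letters (d k) lab M" "P (d k) x = p x" if "x \<in> M" "k \<ge> L x" for x k
    using pK[OF that(1)] that dm[of k] by (auto simp: L_def low_letters_def)
  have pm: "p x \<in> M" if "x \<in> M" for x
    using L[OF that order_refl] nc_pairingD(1)[OF P] by (metis (no_types, lifting) low_letters_def mem_Collect_eq)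
  have "nc_pairing lab M p"
    unfolding nc_pairing_def
  proof (intro conjI ballI)
    fix x assume x: "x \<in> M"
    show "p x \<in> M" using pm[OF x] .
    define k where "k = max (L x) (L (p x))"
    note 1 = L[OF x, of k] L[OF pm[OF x], of k]
    show "p (p x) = x" "lab (p x) = inv_letter (lab x)"
      using nc_pairingD[OF P 1(1)] 1 by (auto simp: k_def)
  next
    fix x y assume xy: "x \<in> M" "y \<in> M"
    define k where "k = max (L x) (L y)"
    note 1 = L[OF xy(1), of k] L[OF xy(2), of k]
    show "\<not> (x < y \<and> y < p x \<and> p x < p y)"
      using nc_pairing_nc[OF P 1(1) 1(3)] 1 by (auto simp: k_def)
  qed
  then show ?thesis by blast
qed (auto simp: nc_pairing_def)

section \<open>Irreducible words\<close>

text \<open>The form of reducedness that is used for words of paths: in terms of values it passes to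
  shifted and mirrored words at once, and a maximal removal of letters attains it.\<close>

definition irreducible_on :: "('b::linorder \<Rightarrow> nat letter) \<Rightarrow> 'b set \<Rightarrow> bool" where
  "irreducible_on lab M \<longleftrightarrow> (\<forall>i\<in>M. \<forall>j\<in>M. i \<le> j \<longrightarrow> (\<exists>N. word_value N lab (M \<inter> {i..j}) \<noteq> 0))"

text \<open>The pairing of a block of trivial values is an arch-system of the whole word.\<close>

lemma reduced_irreducible:
  assumes "fin_letters lab M" "reduced (word_on lab M)" shows "irreducible_on lab M"
  unfolding irreducible_on_def
proof (intro ballI impI, rule ccontr)
  fix i j assume ij: "i \<in> M" "j \<in> M" "i \<le> j" and c: "\<nexists>N. word_value N lab (M \<inter> {i..j}) \<noteq> 0"
  let ?B = "M \<inter> {i..j}"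
  obtain p where p: "nc_pairing lab ?B p"
    using word_value_nc_pairing[of lab ?B] c fin_letters_subset[OF assms(1)] by auto
  note D = nc_pairingD[OF p]
  let ?S = "{(x, p x) | x. x \<in> ?B \<and> x < p x}"
  have S: "j = p i \<and> i \<in> ?B \<and> i < p i \<and> p i \<in> ?B" if "(i, j) \<in> ?S" for i j
  proof -
    from that have *: "j = p i" "i \<in> ?B" "i < p i" by auto
    with D(1)[OF *(2)] show ?thesis by blast
  qed
  have "arch_system (word_on lab M) ?S"
  proof (rule arch_systemI)
    fix x y assume "(x, y) \<in> ?S"
    from S[OF this] D[of x]
    show "prec (word_on lab M) x y \<and> letter_at (word_on lab M) y = inv_letter (letter_at (word_on lab M) x)" by auto
  next
    fix x y x' y' assume a: "(x, y) \<in> ?S" "(x', y') \<in> ?S" "(x, y) \<noteq> (x', y')"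
    note xy = S[OF a(1)] S[OF a(2)]
    have "x \<noteq> p x'" using D(2)[of x'] xy by auto
    moreover have "x' \<noteq> p x" using D(2)[of x] xy by auto
    moreover have "x \<noteq> x'" using a(3) xy by auto
    moreover have "p x \<noteq> p x'" using D(2)[of x] D(2)[of x'] xy a(3) by auto
    ultimately show "{x, y} \<inter> {x', y'} = {}" using xy by auto
  next
    fix x y x' y' assume a: "(x, y) \<in> ?S" "(x', y') \<in> ?S" "prec (word_on lab M) x x'" "prec (word_on lab M) x' y"
    show "\<not> prec (word_on lab M) y y'"
      using nc_pairing_nc[OF p, of x x'] S[OF a(1)] S[OF a(2)] a(3,4) by auto
  next
    fix x y k assume a: "(x, y) \<in> ?S" "prec (word_on lab M) x k" "prec (word_on lab M) k y"
    note xy = S[OF a(1)]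
    then have x: "x \<in> ?B" and k: "k \<in> ?B" "x < k" "k < p x" using a(2,3) by auto
    note i = nc_pairing_inside[OF p x k]
    have kk: "p k \<in> ?B" "p (p k) = k" "p k \<noteq> k" using D[OF k(1)] by auto
    show "\<exists>(a, b)\<in>?S. k \<in> {a, b} \<and> prec (word_on lab M) x a \<and> prec (word_on lab M) a y \<and>
        prec (word_on lab M) x b \<and> prec (word_on lab M) b y"
    proof (cases "k < p k")
      case True
      then have "(k, p k) \<in> ?S" using k by blast
      then show ?thesis using i k kk xy by (intro bexI[of _ "(k, p k)"]) auto
    next
      case False
      then have "p k < p (p k)" using kk by auto
      then have "(p k, p (p k)) \<in> ?S" using kk by blast
      then show ?thesis using i k kk xy by (intro bexI[of _ "(p k, p (p k))"]) auto
    qed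
  qed
  then have "?S = {}" using assms(2) unfolding reduced_def by blast
  moreover have "i \<in> ?B" using ij by auto
  moreover have "i < p i" using D(1,4)[OF \<open>i \<in> ?B\<close>] by auto
  ultimately show False by blast
qed

text \<open>Zorn's lemma gives a maximal set of letters whose removal changes no value. Unions of chains
  are admissible because for each \<open>N\<close> only finitely many letters matter. A remaining block of
  trivial values could be removed as well.\<close>

lemma irreducible_on_exists:
  assumes fin: "fin_letters lab M"
  shows "\<exists>M'\<subseteq>M. irreducible_on lab M' \<and> (\<forall>N. word_value N lab M' = word_value N lab M)"
proof -
  define \<A> where "\<A> = {A. A \<subseteq> M \<and> (\<forall>N. word_value N lab (M - A) = word_value N lab M)}"
  have "\<exists>A\<in>\<A>. \<forall>X\<in>\<A>. A \<subseteq> X \<longrightarrow> X = A"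
  proof (rule subset_Zorn')
    fix C assume C: "subset.chain \<A> C"
    show "\<Union>C \<in> \<A>"
    proof (cases "C = {}")
      case False
      have sub: "\<Union>C \<subseteq> M" using C unfolding \<A>_def subset.chain_def by auto
      have "word_value N lab (M - \<Union>C) = word_value N lab M" for N
      proof -
        let ?F = "low_letters N lab (\<Union>C)"
        have "finite ?F" using fin_letters_finite fin_letters_subset[OF fin sub] by blast
        moreover have "?F \<subseteq> \<Union>C" by (auto simp: low_letters_def)
        ultimately obtain A where A: "A \<in> C" "?F \<subseteq> A"
          using finite_subset_Union_chain[of ?F C \<A>] False C by blast
        have "low_letters N lab (M - \<Union>C) = low_letters N lab (M - A)" using A by (auto simp: low_letters_def)
        then have "word_value N lab (M - \<Union>C) = word_value N lab (M - A)" by (simp add: word_value_def)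
        also have "\<dots> = word_value N lab M" using A(1) C unfolding \<A>_def subset.chain_def by auto
        finally show ?thesis .
      qed
      then show ?thesis using sub unfolding \<A>_def by auto
    qed (simp add: \<A>_def)
  qed
  then obtain A where A: "A \<subseteq> M" "\<And>N. word_value N lab (M - A) = word_value N lab M"
    and max: "\<And>X. X \<subseteq> M \<Longrightarrow> (\<And>N. word_value N lab (M - X) = word_value N lab M) \<Longrightarrow> A \<subseteq> X \<Longrightarrow> X = A"
    unfolding \<A>_def by auto
  have "irreducible_on lab (M - A)"
    unfolding irreducible_on_def
  proof (intro ballI impI, rule ccontr)
    fix i j assume ij: "i \<in> M - A" "j \<in> M - A" "i \<le> j" and c: "\<nexists>N. word_value N lab ((M - A) \<inter> {i..j}) \<noteq> 0"
    let ?P = "(M - A) \<inter> {..<i}" and ?B = "(M - A) \<inter> {i..j}" and ?Q = "(M - A) \<inter> {j<..}"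
    let ?X = "A \<union> (M \<inter> {i..j})"
    have e1: "M - A = ?P \<union> (?B \<union> ?Q)" by auto
    have e2: "M - ?X = ?P \<union> ?Q" by auto
    have f: "fin_letters lab Y" if "Y \<subseteq> M" for Y using fin_letters_subset[OF fin that] .
    have o1: "x < y" if "x \<in> ?P" "y \<in> ?B \<union> ?Q" for x y
    proof -
      have "x < i" "i \<le> y" using that ij(3) by auto
      then show ?thesis by (rule less_le_trans)
    qed
    have v: "word_value N lab (M - ?X) = word_value N lab M" for N
    proof -
      have "word_value N lab (M - A) = word_value N lab ?P + (word_value N lab ?B + word_value N lab ?Q)"
      proof -
        have "word_value N lab (M - A) = word_value N lab ?P + word_value N lab (?B \<union> ?Q)"
          by (subst e1, rule word_value_Un[OF f o1]) auto
        moreover have "word_value N lab (?B \<union> ?Q) = word_value N lab ?B + word_value N lab ?Q"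
          by (rule word_value_Un[OF f]) auto
        ultimately show ?thesis by simp
      qed
      moreover have "word_value N lab (M - ?X) = word_value N lab ?P + word_value N lab ?Q"
        by (subst e2, rule word_value_Un[OF f o1]) auto
      ultimately show ?thesis using c A(2)[of N] by simp
    qed
    have "?X = A" 
    proof (rule max)
      show "?X \<subseteq> M" using A(1) by blast
      show "A \<subseteq> ?X" by blast
    qed (rule v)
    moreover have "i \<in> ?X" using ij by simp
    ultimately show False using ij(1) by blast
  qed
  then show ?thesis using A by (intro exI[of _ "M - A"]) auto
qed

section \<open>Trajectories between two pairings\<close>

text \<open>A long word \<open>L\<close> is divided into \<open>m\<close> slots and carries a noncrossing pairing \<open>P\<close> without pairs
  inside a slot. The slots not in \<open>T\<close> are moreover mirrored onto each other by \<open>Q\<close>, slot \<open>k\<close> onto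
  slot \<open>q k\<close>. The aim is to pair the letters of the slots in \<open>T\<close> with each other.\<close>

locale interval_exchange =
  fixes lab :: "'b::linorder \<Rightarrow> nat letter" and L :: "'b set" and P Q :: "'b \<Rightarrow> 'b"
    and slot :: "'b \<Rightarrow> nat" and q :: "nat \<Rightarrow> nat" and T :: "nat set" and m :: nat
  assumes fin: "fin_letters lab L"
    and P: "nc_pairing lab L P"
    and slot_mono: "x \<le> y \<Longrightarrow> slot x \<le> slot y"
    and slot_bound: "x \<in> L \<Longrightarrow> slot x < m"
    and P_slot: "x \<in> L \<Longrightarrow> slot (P x) \<noteq> slot x"
    and Q: "x \<in> L \<Longrightarrow> slot x \<notin> T \<Longrightarrow> Q x \<in> L" "x \<in> L \<Longrightarrow> slot x \<notin> T \<Longrightarrow> slot (Q x) = q (slot x)"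
      "x \<in> L \<Longrightarrow> slot x \<notin> T \<Longrightarrow> q (slot x) \<notin> T" "x \<in> L \<Longrightarrow> slot x \<notin> T \<Longrightarrow> Q (Q x) = x"
      "x \<in> L \<Longrightarrow> slot x \<notin> T \<Longrightarrow> lab (Q x) = inv_letter (lab x)"
    and Q_anti: "x \<in> L \<Longrightarrow> y \<in> L \<Longrightarrow> slot x \<notin> T \<Longrightarrow> slot x = slot y \<Longrightarrow> x < y \<Longrightarrow> Q y < Q x"
begin

lemma PD: "x \<in> L \<Longrightarrow> P x \<in> L" "x \<in> L \<Longrightarrow> P (P x) = x" "x \<in> L \<Longrightarrow> lab (P x) = inv_letter (lab x)"
  using nc_pairingD[OF P] by auto

lemma slot_less: "slot x < slot y \<Longrightarrow> x < y"
  by (meson leD leI slot_mono)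

lemma slot_between: "x \<le> y \<Longrightarrow> y \<le> z \<Longrightarrow> slot x = slot z \<Longrightarrow> slot y = slot x"
  using slot_mono[of x y] slot_mono[of y z] by simp

text \<open>Noncrossing pairs between the same two slots are nested.\<close>

lemma P_anti:
  assumes "x \<in> L" "y \<in> L" "slot x = slot y" "slot (P x) = slot (P y)" "x < y"
  shows "P y < P x"
proof (rule ccontr)
  assume "\<not> P y < P x"
  moreover have "P x \<noteq> P y" using PD(2)[OF assms(1)] PD(2)[OF assms(2)] assms(5) by (metis less_irrefl)
  ultimately have c: "P x < P y" by auto
  consider "slot x < slot (P x)" | "slot (P x) < slot x" using P_slot[OF assms(1)] by linarith
  then show False
  proof cases
    case 1
    then have "y < P x" using assms(3) slot_less by auto
    then show ?thesis using nc_pairing_nc[OF P assms(1,2,5) _ c] by auto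
  next
    case 2
    then have "P y < x" using assms(4) slot_less by auto
    then show ?thesis
      using nc_pairing_nc[OF P PD(1)[OF assms(1)] PD(1)[OF assms(2)] c] PD(2)[OF assms(1)] PD(2)[OF assms(2)] assms(5) by auto
  qed
qed

text \<open>A letter between two parallel pairs is confined to the two strips between them; a partner in
  its own slot is excluded.\<close>

lemma P_convex:
  assumes "x \<in> L" "y \<in> L" "z \<in> L" "slot x = slot z" "slot (P x) = slot (P z)" "x \<le> y" "y \<le> z"
  shows "slot (P y) = slot (P x)"
proof (cases "x = y \<or> y = z")
  case False
  then have xyz: "x < y" "y < z" using assms(6,7) by auto
  have sy: "slot y = slot x" using slot_between assms by metis
  have a: "P z < P x" using P_anti assms xyz by auto
  consider "slot x < slot (P x)" | "slot (P x) < slot x" using P_slot[OF assms(1)] by linarith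
  then show ?thesis
  proof cases
    case 1
    then have "y < P x" "x < P x" "z < P z" "z < P x" using assms(4,5) sy slot_less by auto
    then have i: "x < P y" "P y < P x" using nc_pairing_inside[OF P assms(1,2) xyz(1)] by auto
    have "P y < z \<or> P z < P y" using nc_pairing_outside[OF P assms(3,2)] \<open>z < P z\<close> xyz by auto
    moreover have "\<not> P y < z"
      using slot_between[of x "P y" z] i P_slot[OF assms(2)] sy assms(4) less_imp_le by metis
    ultimately show ?thesis using slot_between[of "P z" "P y" "P x"] i assms(5) by auto
  next
    case 2
    then have c: "P x < y" "P x < x" "P z < z" "P z < x" using assms(4,5) sy slot_less by auto
    have "P z < P y" "P y < z" using nc_pairing_inside[OF P PD(1)[OF assms(3)] assms(2)] PD(2)[OF assms(3)] c xyz by auto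
    moreover have "P y < P x \<or> x < P y"
      using nc_pairing_outside[OF P PD(1)[OF assms(1)] assms(2)] PD(2)[OF assms(1)] c xyz by auto
    moreover have "\<not> x < P y"
      using slot_between[of x "P y" z] calculation(2) P_slot[OF assms(2)] sy assms(4) less_imp_le by metis
    ultimately show ?thesis using slot_between[of "P z" "P y" "P x"] assms(5) by auto
  qed
qed (use assms in auto)

text \<open>One step of a trajectory. Both factors reverse the order, so \<open>R\<close> preserves it on each bundle of
  parallel pairs, and trajectories in the same bundles never pass each other.\<close>

definition R where "R x = Q (P x)"

text \<open>The first \<open>k\<close> steps of the trajectory of \<open>x\<close> can be performed: none of them is stopped by
  arriving in a slot of \<open>T\<close>.\<close>

definition ok where "ok x k \<longleftrightarrow> (\<forall>i<k. slot (P ((R ^^ i) x)) \<notin> T)"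

lemma ok_mono: "ok x k \<Longrightarrow> i \<le> k \<Longrightarrow> ok x i"
  unfolding ok_def by auto

lemma ok_Suc: "ok x (Suc k) \<longleftrightarrow> ok x k \<and> slot (P ((R ^^ k) x)) \<notin> T"
  unfolding ok_def by (auto simp: less_Suc_eq)

lemma R_step:
  assumes "x \<in> L" "slot (P x) \<notin> T"
  shows "R x \<in> L" "slot (R x) \<notin> T" "slot (R x) = q (slot (P x))" "lab (R x) = lab x" "P (Q (R x)) = x" "Q (R x) = P x"
  using Q[OF PD(1)[OF assms(1)] assms(2)] PD[OF assms(1)] unfolding R_def by auto

lemma traj:
  assumes "x \<in> L" "ok x k"
  shows "(R ^^ k) x \<in> L \<and> lab ((R ^^ k) x) = lab x \<and> (k > 0 \<longrightarrow> slot ((R ^^ k) x) \<notin> T)"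
  using assms
proof (induction k)
  case (Suc k)
  then have "(R ^^ k) x \<in> L" "slot (P ((R ^^ k) x)) \<notin> T" "lab ((R ^^ k) x) = lab x" by (auto simp: ok_Suc)
  from R_step[OF this(1,2)] this(3) show ?case by auto
qed simp

text \<open>Steps are invertible and no step leads into a slot of \<open>T\<close>, so a point lies on the trajectory of
  at most one starting point, and at one time only.\<close>

lemma traj_inj:
  assumes "x \<in> L" "y \<in> L" "slot x \<in> T" "slot y \<in> T" "ok x j" "ok y k" "(R ^^ j) x = (R ^^ k) y"
  shows "j = k \<and> x = y"
  using assms(5-7)
proof (induction j arbitrary: k)
  case 0
  then show ?case using traj[OF assms(2), of k] assms(3) by (cases k) auto
next
  case (Suc j)
  show ?case
  proof (cases k)
    case 0
    then show ?thesis using Suc.prems traj[OF assms(1), of "Suc j"] assms(4) by auto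
  next
    case (Suc k')
    have 1: "ok x j" "slot (P ((R ^^ j) x)) \<notin> T" using Suc.prems(1) by (auto simp: ok_Suc)
    have 2: "ok y k'" "slot (P ((R ^^ k') y)) \<notin> T" using Suc.prems(2) Suc by (auto simp: ok_Suc)
    have "(R ^^ j) x = P (Q ((R ^^ Suc j) x))"
      using R_step(5)[OF _ 1(2)] traj[OF assms(1) 1(1)] by simp
    also have "\<dots> = P (Q ((R ^^ Suc k') y))" using Suc.prems(3) Suc by simp
    also have "\<dots> = (R ^^ k') y"
      using R_step(5)[OF _ 2(2)] traj[OF assms(2) 2(1)] by simp
    finally have "j = k' \<and> x = y" using Suc.IH[OF 1(1) 2(1)] by blast
    then show ?thesis using Suc by simp
  qed
qed

text \<open>Otherwise an injective sequence would run through the finitely many occurrences of one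
  generator.\<close>

lemma traj_stops:
  assumes "x \<in> L" "slot x \<in> T" shows "\<exists>k. slot (P ((R ^^ k) x)) \<in> T"
proof (rule ccontr)
  assume "\<nexists>k. slot (P ((R ^^ k) x)) \<in> T"
  then have ok: "ok x k" for k unfolding ok_def by auto
  have "inj (\<lambda>k. (R ^^ k) x)"
    using traj_inj[OF assms(1,1,2,2) ok ok] by (auto intro: injI)
  moreover have "range (\<lambda>k. (R ^^ k) x) \<subseteq> {y \<in> L. gen_of (lab y) = gen_of (lab x)}"
    using traj[OF assms(1) ok] by auto
  moreover have "finite {y \<in> L. gen_of (lab y) = gen_of (lab x)}" using fin unfolding fin_letters_def by blast
  ultimately show False using finite_imageD finite_subset infinite_UNIV_nat by blast
qed

definition K where "K x = (LEAST k. slot (P ((R ^^ k) x)) \<in> T)"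

definition \<tau> where "\<tau> x = P ((R ^^ K x) x)"

definition itin where "itin x = (slot x, map (\<lambda>k. slot (P ((R ^^ k) x))) [0..<Suc (K x)])"

lemma K:
  assumes "x \<in> L" "slot x \<in> T" shows "slot (P ((R ^^ K x) x)) \<in> T" "ok x (K x)"
proof -
  show "slot (P ((R ^^ K x) x)) \<in> T"
    unfolding K_def using traj_stops[OF assms] by (rule LeastI_ex)
  show "ok x (K x)" unfolding ok_def K_def by (auto dest: not_less_Least)
qed

lemma K_unique: "ok x k \<Longrightarrow> slot (P ((R ^^ k) x)) \<in> T \<Longrightarrow> K x = k"
  unfolding K_def by (rule Least_equality) (auto simp: ok_def not_less[symmetric])

lemma \<tau>:
  assumes "x \<in> L" "slot x \<in> T"
  shows "\<tau> x \<in> L" "slot (\<tau> x) \<in> T" "lab (\<tau> x) = inv_letter (lab x)"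
  using K[OF assms] traj[OF assms(1) K(2)[OF assms]] PD unfolding \<tau>_def by auto

text \<open>Running a trajectory backwards shows that \<open>\<tau>\<close> is an involution, and that the itinerary of a letter
  determines that of its partner.\<close>

lemma traj_rev:
  assumes "x \<in> L" "slot x \<in> T" "k \<le> K x"
  shows "(R ^^ k) (\<tau> x) = P ((R ^^ (K x - k)) x)"
  using assms(3)
proof (induction k)
  case 0 show ?case by (simp add: \<tau>_def)
next
  case (Suc k)
  let ?j = "K x - Suc k"
  have j: "K x - k = Suc ?j" using Suc.prems by simp
  have ok: "ok x (Suc ?j)" using ok_mono[OF K(2)[OF assms(1,2)]] Suc.prems by auto
  then have o: "ok x ?j" "slot (P ((R ^^ ?j) x)) \<notin> T" by (auto simp: ok_Suc)
  have IH: "(R ^^ k) (\<tau> x) = P ((R ^^ Suc ?j) x)" using Suc j by simp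
  have "(R ^^ Suc k) (\<tau> x) = R ((R ^^ k) (\<tau> x))" by simp
  also have "\<dots> = Q (P (P ((R ^^ Suc ?j) x)))" unfolding IH by (rule R_def)
  also have "\<dots> = Q ((R ^^ Suc ?j) x)" using traj[OF assms(1) ok] PD(2) by simp
  also have "\<dots> = P ((R ^^ ?j) x)" using R_step(6)[OF _ o(2)] traj[OF assms(1) o(1)] by simp
  finally show ?case .
qed

lemma P_traj_rev:
  assumes "x \<in> L" "slot x \<in> T" "k \<le> K x"
  shows "P ((R ^^ k) (\<tau> x)) = (R ^^ (K x - k)) x"
  using traj_rev[OF assms] PD(2) traj[OF assms(1) ok_mono[OF K(2)[OF assms(1,2)]], of "K x - k"] by simp

lemma \<tau>_inv:
  assumes "x \<in> L" "slot x \<in> T"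
  shows "K (\<tau> x) = K x" "\<tau> (\<tau> x) = x"
proof -
  have "slot ((R ^^ (K x - k)) x) \<notin> T" if "k < K x" for k
    using traj[OF assms(1) ok_mono[OF K(2)[OF assms]], of "K x - k"] that by auto
  then have "ok (\<tau> x) (K x)" unfolding ok_def using P_traj_rev[OF assms] by simp
  then show *: "K (\<tau> x) = K x" using P_traj_rev[OF assms, of "K x"] assms(2) by (intro K_unique) auto
  show "\<tau> (\<tau> x) = x" using P_traj_rev[OF assms, of "K x"] unfolding \<tau>_def[of "\<tau> x"] * by simp
qed

lemma itinD:
  assumes "itin x = itin y"
  shows "slot x = slot y" "K x = K y" "k \<le> K x \<Longrightarrow> slot (P ((R ^^ k) x)) = slot (P ((R ^^ k) y))"
proof -
  have m: "map (\<lambda>k. slot (P ((R ^^ k) x))) [0..<Suc (K x)] = map (\<lambda>k. slot (P ((R ^^ k) y))) [0..<Suc (K y)]"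
    and s: "slot x = slot y"
    using assms unfolding itin_def by (simp_all only: prod.inject)
  show "slot x = slot y" by (rule s)
  show K: "K x = K y" using arg_cong[OF m, of length] by simp
  assume k: "k \<le> K x"
  have "map (\<lambda>k. slot (P ((R ^^ k) x))) [0..<Suc (K x)] ! k = map (\<lambda>k. slot (P ((R ^^ k) y))) [0..<Suc (K y)] ! k"
    using m by simp
  then show "slot (P ((R ^^ k) x)) = slot (P ((R ^^ k) y))"
    using k K by (simp del: upt_Suc)
qed

lemma itinI:
  assumes "slot x = slot y" "K x = K y" "\<And>k. k \<le> K x \<Longrightarrow> slot (P ((R ^^ k) x)) = slot (P ((R ^^ k) y))"
  shows "itin x = itin y"
  unfolding itin_def using assms by (auto simp del: upt_Suc)

lemma traj_slot:
  assumes "x \<in> L" "y \<in> L" "slot x = slot y" "ok x k"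
    and "\<And>i. i < k \<Longrightarrow> slot (P ((R ^^ i) x)) = slot (P ((R ^^ i) y))"
  shows "slot ((R ^^ k) x) = slot ((R ^^ k) y)" "ok y k"
proof -
  show o: "ok y k" using assms(4,5) unfolding ok_def by auto
  show "slot ((R ^^ k) x) = slot ((R ^^ k) y)"
  proof (cases k)
    case (Suc i)
    have "ok x i" "slot (P ((R ^^ i) x)) \<notin> T" "ok y i" "slot (P ((R ^^ i) y)) \<notin> T"
      using assms(4) o unfolding Suc by (auto simp: ok_Suc)
    then show ?thesis
      using R_step(3)[of "(R ^^ i) x"] R_step(3)[of "(R ^^ i) y"] traj assms(1,2,5) Suc by auto
  qed (use assms in simp)
qed

lemma traj_mono:
  assumes "x \<in> L" "y \<in> L" "slot x = slot y" "ok x k" "x < y"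
    and "\<And>i. i < k \<Longrightarrow> slot (P ((R ^^ i) x)) = slot (P ((R ^^ i) y))"
  shows "(R ^^ k) x < (R ^^ k) y"
  using assms(4,6)
proof (induction k)
  case (Suc k)
  have ok: "ok x k" "slot (P ((R ^^ k) x)) \<notin> T" using Suc.prems(1) by (auto simp: ok_Suc)
  note s = traj_slot[OF assms(1-3) ok(1) Suc.prems(2)]
  have eq: "slot (P ((R ^^ k) x)) = slot (P ((R ^^ k) y))" using Suc.prems(2) by simp
  have m: "(R ^^ k) x \<in> L" "(R ^^ k) y \<in> L" using traj assms(1,2) ok(1) s(2) by auto
  have "(R ^^ k) x < (R ^^ k) y" using Suc by (auto simp: ok_Suc)
  then have "P ((R ^^ k) y) < P ((R ^^ k) x)" using P_anti[OF m] s(1) eq by auto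
  then have "Q (P ((R ^^ k) x)) < Q (P ((R ^^ k) y))"
    using eq ok(2) by (intro Q_anti PD(1) m) auto
  then show ?case by (simp add: R_def[of "(R ^^ k) x"] R_def[of "(R ^^ k) y"])
qed (use assms in simp)

lemma itin_\<tau>:
  assumes "x \<in> L" "y \<in> L" "slot x \<in> T" "itin x = itin y"
  shows "itin (\<tau> x) = itin (\<tau> y)"
proof -
  note i = itinD[OF assms(4)]
  have y: "slot y \<in> T" using i(1) assms(3) by simp
  have eq: "slot (P ((R ^^ j) x)) = slot (P ((R ^^ j) y))" if "j \<le> K x" for j using i(3)[OF that] .
  have ok: "ok x (K x)" by (rule K(2)[OF assms(1,3)])
  show ?thesis
  proof (rule itinI)
    show "slot (\<tau> x) = slot (\<tau> y)" unfolding \<tau>_def using i(3)[of "K x"] i(2) by simp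
    show "K (\<tau> x) = K (\<tau> y)" using \<tau>_inv(1)[OF assms(1,3)] \<tau>_inv(1)[OF assms(2) y] i(2) by simp
    fix k assume "k \<le> K (\<tau> x)"
    then have k: "k \<le> K x" using \<tau>_inv(1)[OF assms(1,3)] by simp
    have "slot ((R ^^ (K x - k)) x) = slot ((R ^^ (K x - k)) y)"
      by (rule traj_slot(1)[OF assms(1,2) i(1) ok_mono[OF ok]]) (use eq in auto)
    then show "slot (P ((R ^^ k) (\<tau> x))) = slot (P ((R ^^ k) (\<tau> y)))"
      using P_traj_rev[OF assms(1,3) k] P_traj_rev[OF assms(2) y, of k] k i(2) by simp
  qed
qed

lemma \<tau>_anti:
  assumes "x \<in> L" "y \<in> L" "slot x \<in> T" "itin x = itin y" "x < y"
  shows "\<tau> y < \<tau> x"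
proof -
  note i = itinD[OF assms(4)]
  have ok: "ok x (K x)" by (rule K(2)[OF assms(1,3)])
  have eq: "slot (P ((R ^^ j) x)) = slot (P ((R ^^ j) y))" if "j \<le> K x" for j using i(3)[OF that] .
  note s = traj_slot[OF assms(1,2) i(1) ok]
  have "(R ^^ K x) x < (R ^^ K x) y"
    by (rule traj_mono[OF assms(1,2) i(1) ok assms(5)]) (use eq in auto)
  then have "P ((R ^^ K x) y) < P ((R ^^ K x) x)"
    using s eq traj[OF assms(1) ok] traj[OF assms(2), of "K x"] by (intro P_anti) auto
  then show ?thesis unfolding \<tau>_def using i(2) by simp
qed

text \<open>Trajectories that start between two parallel ones remain between them and hence are in
  the same bundles.\<close>

lemma itin_convex:
  assumes "x \<in> L" "y \<in> L" "z \<in> L" "slot x \<in> T" "itin x = itin z" "x < y" "y < z"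
  shows "itin y = itin x"
proof -
  note i = itinD[OF assms(5)]
  have sy: "slot y = slot x" using slot_between[of x y z] assms i(1) by auto
  have eqz: "slot (P ((R ^^ j) x)) = slot (P ((R ^^ j) z))" if "j \<le> K x" for j using i(3)[OF that] .
  have ok: "ok x (K x)" by (rule K(2)[OF assms(1,4)])
  have eq: "slot (P ((R ^^ k) x)) = slot (P ((R ^^ k) y))" if "k \<le> K x" for k
    using that
  proof (induction k rule: less_induct)
    case (less k)
    have o: "ok x k" using ok_mono[OF ok less.prems] .
    have e: "slot (P ((R ^^ j) x)) = slot (P ((R ^^ j) y))" if "j < k" for j using less that by auto
    have ez: "slot (P ((R ^^ j) x)) = slot (P ((R ^^ j) z))" if "j < k" for j using eqz less.prems that by auto
    have ezy: "slot (P ((R ^^ j) y)) = slot (P ((R ^^ j) z))" if "j < k" for j using e[OF that] ez[OF that] by simp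
    note s = traj_slot[OF assms(1,2) sy[symmetric] o e]
    note sz = traj_slot[OF assms(1,3) i(1) o ez]
    have "(R ^^ k) x < (R ^^ k) y" by (rule traj_mono[OF assms(1,2) sy[symmetric] o assms(6) e])
    moreover have "(R ^^ k) y < (R ^^ k) z"
      by (rule traj_mono[OF assms(2,3) _ s(2) assms(7) ezy]) (use sy i(1) in auto)
    ultimately show ?case
      using P_convex[of "(R ^^ k) x" "(R ^^ k) y" "(R ^^ k) z"] traj[OF assms(1) o] traj[OF assms(2) s(2)]
        traj[OF assms(3) sz(2)] sz(1) eqz[OF less.prems] by auto
  qed
  have "K y = K x"
    using K(1)[OF assms(1,4)] ok eq by (intro K_unique) (auto simp: ok_def)
  then show ?thesis using sy eq by (intro itinI) auto
qed

text \<open>What lies between two parallel trajectories at time \<open>k\<close> has come from between their starting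
  points.\<close>

lemma pullback:
  assumes "x \<in> L" "y \<in> L" "slot x \<in> T" "slot x = slot y" "x \<le> y" "ok x k"
    and "\<And>i. i < k \<Longrightarrow> slot (P ((R ^^ i) x)) = slot (P ((R ^^ i) y))"
    and "z \<in> L" "(R ^^ k) x \<le> z" "z \<le> (R ^^ k) y"
  shows "\<exists>w\<in>L. x \<le> w \<and> w \<le> y \<and> (R ^^ k) w = z \<and> ok w k"
  using assms(6-)
proof (induction k arbitrary: z)
  case 0
  then show ?case by (auto simp: ok_def)
next
  case (Suc k)
  have ok: "ok x k" "slot (P ((R ^^ k) x)) \<notin> T" using Suc.prems(1) by (auto simp: ok_Suc)
  have eq: "slot (P ((R ^^ k) x)) = slot (P ((R ^^ k) y))" using Suc.prems(2) by simp
  have eqs: "\<And>i. i < k \<Longrightarrow> slot (P ((R ^^ i) x)) = slot (P ((R ^^ i) y))" using Suc.prems(2) by simp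
  note s = traj_slot[OF assms(1,2,4) ok(1) eqs]
  let ?x = "(R ^^ k) x" and ?y = "(R ^^ k) y"
  have m: "?x \<in> L" "?y \<in> L" using traj assms(1,2) ok(1) s(2) by auto
  note rx = R_step[OF m(1) ok(2)]
  have py: "slot (P ?y) \<notin> T" using ok(2) eq by simp
  note ry = R_step[OF m(2) py]
  have zz: "R ?x \<le> z" "z \<le> R ?y" using Suc.prems(4,5) by auto
  have "slot z = slot (R ?x)" using slot_between[OF zz] rx(3) ry(3) eq by simp
  then have zT: "slot z \<notin> T" using rx(2) by simp
  note qz = Q[OF Suc.prems(3) zT]
  have sz: "slot z = slot (R ?x)" "slot z = slot (R ?y)"
    using \<open>slot z = slot (R ?x)\<close> rx(3) ry(3) eq by auto
  have "P ?y \<le> Q z"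
  proof (cases "z = R ?y")
    case False
    then have "z < R ?y" using zz(2) by simp
    then have "Q (R ?y) < Q z" using Q_anti[OF Suc.prems(3) ry(1) zT sz(2)] by simp
    then show ?thesis using ry(6) by simp
  qed (use ry(6) in simp)
  moreover have "Q z \<le> P ?x"
  proof (cases "z = R ?x")
    case False
    then have "R ?x < z" using zz(1) by simp
    then have "Q z < Q (R ?x)" using Q_anti[OF rx(1) Suc.prems(3) rx(2) sz(1)[symmetric]] by simp
    then show ?thesis using rx(6) by simp
  qed (use rx(6) in simp)
  ultimately have qle: "P ?y \<le> Q z" "Q z \<le> P ?x" .
  have "slot (Q z) = slot (P ?y)" using slot_between[OF qle] eq by simp
  have "slot (P (Q z)) = slot (P (P ?y))"
    by (rule P_convex[OF PD(1)[OF m(2)] qz(1) PD(1)[OF m(1)] _ _ qle]) (use eq s(1) m PD(2) in auto)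
  then have sp: "slot (P (Q z)) = slot ?y" using PD(2)[OF m(2)] by simp
  have le1: "?x \<le> P (Q z)"
  proof (cases "Q z = P ?x")
    case False
    then have "Q z < P ?x" using qle by simp
    then have "P (P ?x) < P (Q z)"
      by (rule P_anti[OF qz(1) PD(1)[OF m(1)], rotated 2])
         (use \<open>slot (Q z) = slot (P ?y)\<close> eq sp s(1) PD(2)[OF m(1)] in auto)
    then show ?thesis using PD(2)[OF m(1)] by simp
  qed (use PD(2)[OF m(1)] in simp)
  have le2: "P (Q z) \<le> ?y"
  proof (cases "Q z = P ?y")
    case False
    then have "P ?y < Q z" using qle by simp
    then have "P (Q z) < P (P ?y)"
      by (rule P_anti[OF PD(1)[OF m(2)] qz(1), rotated 2])
         (use \<open>slot (Q z) = slot (P ?y)\<close> eq sp s(1) PD(2)[OF m(2)] in auto)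
    then show ?thesis using PD(2)[OF m(2)] by simp
  qed (use PD(2)[OF m(2)] in simp)
  obtain w where w: "w \<in> L" "x \<le> w" "w \<le> y" "(R ^^ k) w = P (Q z)" "ok w k"
    using Suc.IH[OF ok(1) eqs PD(1)[OF qz(1)] le1 le2] by blast
  have "P ((R ^^ k) w) = Q z" using w(4) PD(2)[OF qz(1)] by simp
  then have "(R ^^ Suc k) w = z" "slot (P ((R ^^ k) w)) \<notin> T"
    using qz(2-4) by (auto simp: R_def)
  then show ?case using w by (auto simp: ok_Suc)
qed

text \<open>Different itineraries from the same slot run in parallel up to some time \<open>t\<close>, when the two
  trajectories are in the same slot but in different bundles.\<close>

lemma first_difference:
  assumes "x \<in> L" "y \<in> L" "slot x \<in> T" "slot x = slot y" "x < y" "itin x \<noteq> itin y"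
  shows "\<exists>t. ok x t \<and> (\<forall>i<t. slot (P ((R ^^ i) x)) = slot (P ((R ^^ i) y))) \<and>
           slot (P ((R ^^ t) x)) \<noteq> slot (P ((R ^^ t) y))"
proof -
  let ?d = "\<lambda>t. slot (P ((R ^^ t) x)) \<noteq> slot (P ((R ^^ t) y))"
  have "\<exists>t. ?d t \<and> ok x t"
  proof (rule ccontr)
    assume c: "\<nexists>t. ?d t \<and> ok x t"
    have ok: "ok x (K x)" by (rule K(2)[OF assms(1,3)])
    have eq: "slot (P ((R ^^ k) x)) = slot (P ((R ^^ k) y))" if "k \<le> K x" for k
      using c ok_mono[OF ok that] by blast
    have "K y = K x"
      using K(1)[OF assms(1,3)] ok eq by (intro K_unique) (auto simp: ok_def)
    then have "itin x = itin y" using assms(4) eq by (intro itinI) auto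
    then show False using assms(6) by simp
  qed
  then obtain t where t: "?d t" "ok x t" by blast
  define t0 where "t0 = (LEAST t. ?d t)"
  have "?d t0" unfolding t0_def using t(1) by (rule LeastI)
  moreover have "t0 \<le> t" unfolding t0_def using t(1) by (rule Least_le)
  ultimately show ?thesis using ok_mono[OF t(2)] not_less_Least[of _ ?d] unfolding t0_def[symmetric]
    by (intro exI[of _ t0]) auto
qed

text \<open>Suppose the trajectory of \<open>x\<close> leaves that of \<open>y\<close> at the right end of some bundle, and that of
  \<open>x'\<close> is in the same bundle, to the right of \<open>x\<close>, at its own time. Then it is between the other two and
  by \<open>pullback\<close> has started between \<open>x\<close> and \<open>y\<close>.\<close>

lemma same_cut:
  assumes x: "x \<in> L" "y \<in> L" "slot x \<in> T" "slot x = slot y" "x < y" "ok x t"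
      "\<And>i. i < t \<Longrightarrow> slot (P ((R ^^ i) x)) = slot (P ((R ^^ i) y))"
      "slot (P ((R ^^ t) x)) \<noteq> slot (P ((R ^^ t) y))"
    and x': "x' \<in> L" "slot x' \<in> T" "ok x' t'"
    and same: "slot ((R ^^ t) x) = slot ((R ^^ t') x')" "slot (P ((R ^^ t) x)) = slot (P ((R ^^ t') x'))"
    and le: "(R ^^ t) x \<le> (R ^^ t') x'"
  shows "x \<le> x' \<and> x' < y"
proof -
  note s = traj_slot[OF x(1,2,4,6,7)]
  let ?a = "(R ^^ t) x" and ?b = "(R ^^ t) y" and ?z = "(R ^^ t') x'"
  have m: "?a \<in> L" "?b \<in> L" "?z \<in> L" using traj x(1,2,6) s(2) x' by auto
  have ab: "?a < ?b" by (rule traj_mono[OF x(1,2,4,6,5,7)])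
  have zb: "?z < ?b"
  proof (rule ccontr)
    assume "\<not> ?z < ?b"
    then have "slot (P ?b) = slot (P ?a)"
      using P_convex[OF m(1,2,3)] same ab by auto
    then show False using x(8) by simp
  qed
  obtain w where w: "w \<in> L" "x \<le> w" "w \<le> y" "(R ^^ t) w = ?z" "ok w t"
    using pullback[OF x(1-4) less_imp_le[OF x(5)] x(6,7) m(3) le less_imp_le[OF zb]] by blast
  have "slot w = slot x" using slot_between[OF w(2,3)] x(4) by simp
  then have "t = t' \<and> w = x'" using traj_inj[OF w(1) x'(1) _ x'(2) w(5) x'(3) w(4)] x(3) by simp
  then show ?thesis using w zb by (cases "x' = y") auto
qed

text \<open>Take starting points of pairwise different itineraries. Each, except the last, is separated
  from its successor at the right end of a bundle, and by \<open>same_cut\<close> different points use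
  different ends. There are at most \<open>m * m\<close> bundles, as a bundle is given by its two slots.\<close>

lemma finite_itin_slot:
  assumes "s \<in> T" shows "finite (itin ` {x \<in> L. slot x = s})"
proof (rule ccontr)
  let ?X = "{x \<in> L. slot x = s}"
  assume "infinite (itin ` ?X)"
  then obtain F where F: "F \<subseteq> itin ` ?X" "finite F" "card F = m * m + 2"
    using infinite_arbitrarily_large by blast
  then obtain C where C: "C \<subseteq> ?X" "inj_on itin C" "F = itin ` C" by (meson subset_image_inj)
  have finC: "finite C" "card C = m * m + 2"
    using C(2,3) F(2,3) by (auto simp: card_image finite_image_iff)
  have CD: "x \<in> L" "slot x = s" "slot x \<in> T" if "x \<in> C" for x using C(1) that assms by auto
  define nx where "nx x = Min {y \<in> C. x < y}" for x
  define D where "D = C - {Max C}"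
  have "C \<noteq> {}" using finC by auto
  have cD: "card D = m * m + 1" unfolding D_def using finC Max_in[OF finC(1) \<open>C \<noteq> {}\<close>] by simp
  have nx: "nx x \<in> C" "x < nx x" "\<And>y. y \<in> C \<Longrightarrow> x < y \<Longrightarrow> nx x \<le> y" if "x \<in> D" for x
  proof -
    have "x \<in> C" "x \<noteq> Max C" using that by (auto simp: D_def)
    then have "x < Max C" using finC(1) by (metis Max_ge le_neq_trans)
    then have ne: "{y \<in> C. x < y} \<noteq> {}" using Max_in[OF finC(1) \<open>C \<noteq> {}\<close>] by blast
    have "nx x \<in> {y \<in> C. x < y}" unfolding nx_def using finC(1) ne by (intro Min_in) auto
    then show "nx x \<in> C" "x < nx x" by auto
    show "nx x \<le> y" if "y \<in> C" "x < y" for y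
      unfolding nx_def using finC(1) that by (intro Min_le) auto
  qed
  have "\<exists>t. ok x t \<and> (\<forall>i<t. slot (P ((R ^^ i) x)) = slot (P ((R ^^ i) (nx x)))) \<and>
           slot (P ((R ^^ t) x)) \<noteq> slot (P ((R ^^ t) (nx x)))" if "x \<in> D" for x
  proof (rule first_difference)
    have x: "x \<in> C" using that by (auto simp: D_def)
    show "x \<in> L" "slot x \<in> T" using CD[OF x] by auto
    show "nx x \<in> L" "slot x = slot (nx x)" using CD[OF x] CD[OF nx(1)[OF that]] by auto
    show "x < nx x" by (rule nx(2)[OF that])
    show "itin x \<noteq> itin (nx x)" using inj_onD[OF C(2) _ x nx(1)[OF that]] nx(2)[OF that] by auto
  qed
  then obtain t where t: "\<And>x. x \<in> D \<Longrightarrow> ok x (t x)"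
    "\<And>x i. x \<in> D \<Longrightarrow> i < t x \<Longrightarrow> slot (P ((R ^^ i) x)) = slot (P ((R ^^ i) (nx x)))"
    "\<And>x. x \<in> D \<Longrightarrow> slot (P ((R ^^ t x) x)) \<noteq> slot (P ((R ^^ t x) (nx x)))"
    by metis
  define c where "c x = (slot ((R ^^ t x) x), slot (P ((R ^^ t x) x)))" for x
  have "c ` D \<subseteq> {..<m} \<times> {..<m}"
  proof
    fix p assume "p \<in> c ` D"
    then obtain x where x: "x \<in> D" "p = c x" by blast
    then have "(R ^^ t x) x \<in> L" using traj[OF _ t(1)] CD(1)[of x] by (auto simp: D_def)
    then show "p \<in> {..<m} \<times> {..<m}" using slot_bound PD(1) x(2) by (auto simp: c_def)
  qed
  then have "card (c ` D) \<le> m * m" using card_mono[of "{..<m} \<times> {..<m}" "c ` D"] by simp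
  then have "\<not> inj_on c D" using cD card_image[of c D] by auto
  then obtain x x' where xx: "x \<in> D" "x' \<in> D" "x \<noteq> x'" "c x = c x'" by (auto simp: inj_on_def)
  have main: False if "x \<in> D" "x' \<in> D" "x \<noteq> x'" "c x = c x'" "(R ^^ t x) x \<le> (R ^^ t x') x'" for x x'
  proof -
    have xC: "x \<in> C" "x' \<in> C" using that by (auto simp: D_def)
    have "x \<le> x' \<and> x' < nx x"
    proof (rule same_cut)
      show "x \<in> L" "nx x \<in> L" "slot x \<in> T" "slot x = slot (nx x)" "x' \<in> L" "slot x' \<in> T"
        using CD[OF xC(1)] CD[OF xC(2)] CD[OF nx(1)[OF that(1)]] by auto
    qed (use that t nx(2)[OF that(1)] in \<open>auto simp: c_def\<close>)
    then show False using nx(3)[OF that(1) xC(2)] that(3) by (meson le_neq_trans leD)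
  qed
  show False using main[OF xx] main[OF xx(2,1) xx(3)[symmetric] xx(4)[symmetric]] by (metis linear)
qed

lemma finite_itin: "finite (itin ` {x \<in> L. slot x \<in> T})"
proof -
  have "itin ` {x \<in> L. slot x \<in> T} \<subseteq> (\<Union>s\<in>T \<inter> {..<m}. itin ` {x \<in> L. slot x = s})"
    using slot_bound by auto
  moreover have "finite (\<Union>s\<in>T \<inter> {..<m}. itin ` {x \<in> L. slot x = s})"
    using finite_itin_slot by auto
  ultimately show ?thesis by (rule finite_subset)
qed

lemma itin_\<tau>_inj:
  assumes "x \<in> L" "y \<in> L" "slot x \<in> T" "slot y \<in> T" "itin (\<tau> x) = itin (\<tau> y)"
  shows "itin x = itin y"
  using itin_\<tau>[OF \<tau>(1)[OF assms(1,3)] \<tau>(1)[OF assms(2,4)] \<tau>(2)[OF assms(1,3)] assms(5)]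
    \<tau>_inv(2)[OF assms(1,3)] \<tau>_inv(2)[OF assms(2,4)] by simp

text \<open>The name of the piece of a letter, chosen such that partners have inverse names. Comparing \<open>x\<close>
  with \<open>\<tau> x\<close> serves two purposes: it selects one of two inverse pieces, and it
  splits a piece that is its own inverse, whose two halves are exchanged by \<open>\<tau>\<close>.\<close>

definition \<nu> where "\<nu> x = (if x < \<tau> x then Gen (itin x) else GenInv (itin (\<tau> x)))"

lemma \<tau>_neq: "x \<in> L \<Longrightarrow> slot x \<in> T \<Longrightarrow> \<tau> x \<noteq> x"
  using \<tau>(3) inv_letter_neq by metis

lemma \<nu>_\<tau>: "x \<in> L \<Longrightarrow> slot x \<in> T \<Longrightarrow> \<nu> (\<tau> x) = inv_letter (\<nu> x)"
  using \<tau>_inv(2)[of x] \<tau>_neq[of x] by (auto simp: \<nu>_def dest: less_asym)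

lemma \<nu>_itin:
  assumes "x \<in> L" "y \<in> L" "slot x \<in> T" "slot y \<in> T" "\<nu> x = \<nu> y" 
  shows "itin x = itin y" "itin (\<tau> x) = itin (\<tau> y)" "x < \<tau> x \<longleftrightarrow> y < \<tau> y"
proof -
  show "x < \<tau> x \<longleftrightarrow> y < \<tau> y" using assms(5) by (auto simp: \<nu>_def split: if_splits)
  show *: "itin x = itin y"
    using assms(5) itin_\<tau>_inj[OF assms(1-4)] by (auto simp: \<nu>_def split: if_splits)
  show "itin (\<tau> x) = itin (\<tau> y)" by (rule itin_\<tau>[OF assms(1-3) *])
qed

lemma finite_\<nu>: "finite (\<nu> ` {x \<in> L. slot x \<in> T})"
proof -
  let ?I = "itin ` {x \<in> L. slot x \<in> T}"
  have "\<nu> ` {x \<in> L. slot x \<in> T} \<subseteq> Gen ` ?I \<union> GenInv ` ?I"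
    using \<tau> by (auto simp: \<nu>_def)
  then show ?thesis using finite_itin by (meson finite_Un finite_imageI finite_subset)
qed

lemma \<nu>_convex:
  assumes "x \<in> L" "y \<in> L" "z \<in> L" "slot x \<in> T" "slot z \<in> T" "\<nu> x = \<nu> z" "x < y" "y < z"
  shows "\<nu> y = \<nu> x"
proof -
  note n = \<nu>_itin[OF assms(1,3,4,5,6)]
  have iy: "itin y = itin x" by (rule itin_convex[OF assms(1-4) n(1) assms(7,8)])
  then have sy: "slot y \<in> T" using itinD(1)[OF iy] assms(4) by simp
  have ity: "itin (\<tau> y) = itin (\<tau> x)" by (rule itin_\<tau>[OF assms(2,1) sy iy])
  have "\<tau> y < \<tau> x" by (rule \<tau>_anti[OF assms(1,2,4) iy[symmetric] assms(7)])
  moreover have "\<tau> z < \<tau> y" by (rule \<tau>_anti[OF assms(2,3) sy _ assms(8)]) (use iy n(1) in simp)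
  moreover have "\<tau> x \<noteq> x" "\<tau> z \<noteq> z" using \<tau>_neq assms by auto
  ultimately have "y < \<tau> y \<longleftrightarrow> x < \<tau> x"
    using n(3) assms(7,8) by (metis less_trans not_less_iff_gr_or_eq)
  then show ?thesis using iy ity by (simp add: \<nu>_def)
qed

lemma \<nu>_slot: "x \<in> L \<Longrightarrow> y \<in> L \<Longrightarrow> slot x \<in> T \<Longrightarrow> slot y \<in> T \<Longrightarrow> \<nu> x = \<nu> y \<Longrightarrow> slot x = slot y"
  using \<nu>_itin(1) itinD(1) by blast

lemma \<nu>_anti:
  assumes "x \<in> L" "y \<in> L" "slot x \<in> T" "slot y \<in> T" "\<nu> x = \<nu> y" "x < y" shows "\<tau> y < \<tau> x"
  using \<tau>_anti[OF assms(1-3) \<nu>_itin(1)[OF assms(1-5)] assms(6)] .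

end

section \<open>Loops of words\<close>

abbreviation "HE \<equiv> hawaiian_earring"

lemma circle_loop_0 [simp]: "circle_loop n 0 = 0" and circle_loop_1 [simp]: "circle_loop n 1 = 0"
  using exp_two_pi_i by (simp_all add: circle_loop_def)

lemma letter_loop_0 [simp]: "letter_loop x 0 = 0" and letter_loop_1 [simp]: "letter_loop x 1 = 0"
  by (cases x; simp add: reversepath_def)+

lemma letter_loop_inv: "letter_loop (inv_letter x) t = letter_loop x (1 - t)"
  by (cases x) (auto simp: reversepath_def)

lemma circle_loop_sphere: "circle_loop n t \<in> sphere (of_real (1 / real (Suc n))) (1 / real (Suc n))"
proof -
  have "of_real (1 / real (Suc n)) - circle_loop n t = of_real (1 / real (Suc n)) * exp (\<i> * of_real (2 * pi * t))"
    by (simp add: circle_loop_def algebra_simps)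
  also have "exp (\<i> * of_real (2 * pi * t)) = cis (2 * pi * t)" by (simp only: cis_conv_exp)
  finally have "norm (of_real (1 / real (Suc n)) - circle_loop n t) = 1 / real (Suc n)"
    by (simp only: norm_mult norm_cis norm_of_real) simp
  then show ?thesis by (simp add: dist_norm)
qed

lemma circle_loop_in: "circle_loop n t \<in> HE"
  using circle_loop_sphere unfolding hawaiian_earring_def by blast

lemma letter_loop_in: "letter_loop x t \<in> HE"
  by (cases x) (auto simp: reversepath_def circle_loop_in)

lemma zero_in_HE: "0 \<in> HE"
  using circle_loop_in[of 0 0] by simp

lemma norm_circle_loop: "norm (circle_loop n t) \<le> 2 / real (Suc n)"
proof -
  have "norm (circle_loop n t) \<le> norm (of_real (1 / real (Suc n)) :: complex) + norm (of_real (1 / real (Suc n)) - circle_loop n t)"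
    by (metis norm_minus_commute norm_triangle_sub)
  also have "\<dots> = 2 / real (Suc n)"
    using circle_loop_sphere[of n t] by (simp add: dist_norm norm_divide del: of_nat_Suc)
  finally show ?thesis .
qed

lemma norm_letter_loop: "norm (letter_loop x t) \<le> 2 / real (Suc (gen_of x))"
  by (cases x) (auto simp: reversepath_def norm_circle_loop simp del: of_nat_Suc)

lemma continuous_circle_loop: "continuous_on UNIV (circle_loop n)"
  unfolding circle_loop_def by (intro continuous_intros)

lemma continuous_letter_loop: "continuous_on UNIV (letter_loop x)"
proof (cases x)
  case (GenInv n)
  have "continuous_on UNIV (\<lambda>t. circle_loop n (1 - t))"
    by (rule continuous_on_compose2[OF continuous_circle_loop]) (auto intro!: continuous_intros)
  then show ?thesis using GenInv by (simp add: reversepath_def)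
qed (simp add: continuous_circle_loop)

text \<open>At each point at most one letter is active, so the contribution of the letters from \<open>N\<close> on is
  bounded by the diameter of the largest of their circles, and \<open>F\<close> is the uniform limit of finite
  sums of continuous functions. The parameter space is arbitrary in order to cover homotopies.\<close>

lemma continuous_letter_family:
  fixes u :: "'i \<Rightarrow> 'x::topological_space \<Rightarrow> real" and F :: "'x \<Rightarrow> complex"
  assumes fin: "\<And>N. finite {i \<in> I. gen_of (lab i) < N}"
    and cont: "\<And>i. i \<in> I \<Longrightarrow> continuous_on D (u i)"
    and rng: "\<And>i p. i \<in> I \<Longrightarrow> p \<in> D \<Longrightarrow> 0 \<le> u i p \<and> u i p \<le> 1"
    and disj: "\<And>i j p. i \<in> I \<Longrightarrow> j \<in> I \<Longrightarrow> p \<in> D \<Longrightarrow> 0 < u i p \<Longrightarrow> u i p < 1 \<Longrightarrow> 0 < u j p \<Longrightarrow> u j p < 1 \<Longrightarrow> i = j"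
    and F1: "\<And>i p. i \<in> I \<Longrightarrow> p \<in> D \<Longrightarrow> 0 < u i p \<Longrightarrow> u i p < 1 \<Longrightarrow> F p = letter_loop (lab i) (u i p)"
    and F0: "\<And>p. p \<in> D \<Longrightarrow> (\<And>i. i \<in> I \<Longrightarrow> \<not> (0 < u i p \<and> u i p < 1)) \<Longrightarrow> F p = 0"
  shows "continuous_on D F"
proof -
  define G where "G N p = (\<Sum>i\<in>{i \<in> I. gen_of (lab i) < N}. letter_loop (lab i) (u i p))" for N p
  have contG: "continuous_on D (G N)" for N
    unfolding G_def
    by (intro continuous_on_sum continuous_on_compose2[OF continuous_letter_loop]) (auto intro: cont)
  have zero: "letter_loop (lab i) (u i p) = 0" if "i \<in> I" "p \<in> D" "\<not> (0 < u i p \<and> u i p < 1)" for i p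
  proof -
    have "u i p = 0 \<or> u i p = 1" using rng[OF that(1,2)] that(3) by auto
    then show ?thesis by auto
  qed
  have bound: "dist (G N p) (F p) \<le> 2 / real (Suc N)" if p: "p \<in> D" for N p
  proof (cases "\<exists>i\<in>I. 0 < u i p \<and> u i p < 1")
    case False
    then have "G N p = 0" "F p = 0" unfolding G_def using zero p F0[OF p] by (auto intro: sum.neutral)
    then show ?thesis by simp
  next
    case True
    then obtain i where i: "i \<in> I" "0 < u i p" "u i p < 1" by blast
    have z: "letter_loop (lab j) (u j p) = 0" if "j \<in> I" "j \<noteq> i" for j
      using disj[OF that(1) i(1) p] i that zero[OF that(1) p] by blast
    show ?thesis
    proof (cases "gen_of (lab i) < N")
      case True
      have "G N p = (\<Sum>j\<in>{i}. letter_loop (lab j) (u j p))"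
        unfolding G_def using True i fin z by (intro sum.mono_neutral_right) auto
      then show ?thesis using F1[OF i(1) p i(2,3)] by simp
    next
      case False
      then have "G N p = 0" unfolding G_def using z by (intro sum.neutral) auto
      then have "dist (G N p) (F p) = norm (letter_loop (lab i) (u i p))"
        using F1[OF i(1) p i(2,3)] by simp
      also have "\<dots> \<le> 2 / real (Suc (gen_of (lab i)))" by (rule norm_letter_loop)
      also have "\<dots> \<le> 2 / real (Suc N)" using False by (intro divide_left_mono) auto
      finally show ?thesis .
    qed
  qed
  have "uniform_limit D G F sequentially"
  unfolding uniform_limit_iff
  proof (intro allI impI)
    fix e :: real assume e: "e > 0"
    have "eventually (\<lambda>N. 2 / real (Suc N) < e) sequentially"
      using e by (intro order_tendstoD(2)[OF LIMSEQ_Suc[OF lim_const_over_n]])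
    then show "\<forall>\<^sub>F N in sequentially. \<forall>p\<in>D. dist (G N p) (F p) < e"
    proof eventually_elim
      case (elim N)
      then show ?case using bound[of _ N] le_less_trans by blast
    qed
  qed
  then show ?thesis using contG by (intro uniform_limit_theorem) auto
qed

lemma restricted_finite_low:
  fixes W :: "('i, nat) word"
  assumes "restricted W" shows "finite {i \<in> idx W. gen_of (letter_at W i) < N}"
proof -
  have "{i \<in> idx W. gen_of (letter_at W i) < N} \<subseteq>
      (\<Union>n<N. {i \<in> idx W. letter_at W i = Gen n} \<union> {i \<in> idx W. letter_at W i = GenInv n})"
  proof
    fix i assume "i \<in> {i \<in> idx W. gen_of (letter_at W i) < N}"
    then show "i \<in> (\<Union>n<N. {i \<in> idx W. letter_at W i = Gen n} \<union> {i \<in> idx W. letter_at W i = GenInv n})"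
      by (cases "letter_at W i") auto
  qed
  moreover have "finite \<dots>"
    by (intro finite_UN_I finite_UnI) (use assms in \<open>simp_all add: restricted_def\<close>)
  ultimately show ?thesis by (rule finite_subset)
qed

text \<open>The parameter of a letter at a time outside its interval is the nearer end of the
  unit interval, where the letter is at the base point.\<close>

definition clamp01 :: "real \<Rightarrow> real" where "clamp01 x = max 0 (min 1 x)"

lemma clamp01: "0 \<le> clamp01 x" "clamp01 x \<le> 1" "0 < clamp01 x \<and> clamp01 x < 1 \<longleftrightarrow> 0 < x \<and> x < 1"
  "0 < x \<Longrightarrow> x < 1 \<Longrightarrow> clamp01 x = x"
  unfolding clamp01_def by auto

definition word_intervals :: "('i, 'a) word \<Rightarrow> ('i \<Rightarrow> real) \<Rightarrow> ('i \<Rightarrow> real) \<Rightarrow> bool" where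
  "word_intervals U l r \<longleftrightarrow> (\<forall>i\<in>idx U. 0 \<le> l i \<and> l i < r i \<and> r i \<le> 1) \<and> (\<forall>i j. prec U i j \<longrightarrow> r i \<le> l j)"

definition loop_on :: "('i, nat) word \<Rightarrow> ('i \<Rightarrow> real) \<Rightarrow> ('i \<Rightarrow> real) \<Rightarrow> (real \<Rightarrow> complex) \<Rightarrow> bool" where
  "loop_on U l r f \<longleftrightarrow>
     (\<forall>i\<in>idx U. \<forall>t\<in>{l i<..<r i}. f t = letter_loop (letter_at U i) ((t - l i) / (r i - l i))) \<and>
     (\<forall>t\<in>{0..1}. (\<forall>i\<in>idx U. t \<notin> {l i<..<r i}) \<longrightarrow> f t = 0)"

lemma word_loop_iff: "word_loop U f \<longleftrightarrow> (\<exists>l r. word_intervals U l r \<and> loop_on U l r f)"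
  unfolding word_loop_def word_intervals_def loop_on_def by blast

lemma word_intervals_disjoint:
  assumes "countable_word U" "word_intervals U l r" "i \<in> idx U" "j \<in> idx U"
    "l i < t" "t < r i" "l j < t" "t < r j"
  shows "i = j"
proof (rule ccontr)
  assume "i \<noteq> j"
  then have "prec U i j \<or> prec U j i"
    using countable_word_total[OF assms(1,3,4)] by (auto simp: prec_def)
  then have "r i \<le> l j \<or> r j \<le> l i" using assms(2) by (auto simp: word_intervals_def)
  then show False using assms by auto
qed

lemma frac_01:
  fixes l r t :: real
  assumes "l < r" shows "0 < (t - l) / (r - l) \<and> (t - l) / (r - l) < 1 \<longleftrightarrow> l < t \<and> t < r"
  using assms by (auto simp: field_simps)

text \<open>With constant intervals this is the continuity of a single loop; with intervals moving along a
  parameter it provides homotopies.\<close>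

lemma loop_family:
  assumes c: "countable_word U" "restricted U"
    and li: "\<And>p. p \<in> D \<Longrightarrow> word_intervals U (l p) (r p)"
    and cont: "\<And>i. i \<in> idx U \<Longrightarrow> continuous_on D (\<lambda>p. l p i)" "\<And>i. i \<in> idx U \<Longrightarrow> continuous_on D (\<lambda>p. r p i)"
      "continuous_on D h"
    and h: "\<And>p. p \<in> D \<Longrightarrow> h p \<in> {0..1}"
    and H: "\<And>p. p \<in> D \<Longrightarrow> loop_on U (l p) (r p) (g p)"
  shows "continuous_on D (\<lambda>p. g p (h p))"
proof (rule continuous_letter_family[where I = "idx U" and lab = "letter_at U"
      and u = "\<lambda>i p. clamp01 ((h p - l p i) / (r p i - l p i))"])
  show "finite {i \<in> idx U. gen_of (letter_at U i) < N}" for N by (rule restricted_finite_low[OF c(2)])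
  have lr: "l p i < r p i" if "i \<in> idx U" "p \<in> D" for i p using li[OF that(2)] that(1) by (auto simp: word_intervals_def)
  show "continuous_on D (\<lambda>p. clamp01 ((h p - l p i) / (r p i - l p i)))" if "i \<in> idx U" for i
  proof -
    have "\<forall>p\<in>D. r p i - l p i \<noteq> 0"
    proof
      fix p assume "p \<in> D" from lr[OF that this] show "r p i - l p i \<noteq> 0" by simp
    qed
    then show ?thesis unfolding clamp01_def using cont that by (intro continuous_intros) auto
  qed
  show "0 \<le> clamp01 ((h p - l p i) / (r p i - l p i)) \<and> clamp01 ((h p - l p i) / (r p i - l p i)) \<le> 1" for i p
    by (simp add: clamp01)
  have act: "0 < clamp01 ((h p - l p i) / (r p i - l p i)) \<and> clamp01 ((h p - l p i) / (r p i - l p i)) < 1 \<longleftrightarrow>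
      l p i < h p \<and> h p < r p i" if "i \<in> idx U" "p \<in> D" for i p
    unfolding clamp01(3) frac_01[OF lr[OF that]] ..
  show "i = j" if "i \<in> idx U" "j \<in> idx U" "p \<in> D"
     "0 < clamp01 ((h p - l p i) / (r p i - l p i))" "clamp01 ((h p - l p i) / (r p i - l p i)) < 1"
     "0 < clamp01 ((h p - l p j) / (r p j - l p j))" "clamp01 ((h p - l p j) / (r p j - l p j)) < 1" for i j p
    using word_intervals_disjoint[OF c(1) li[OF that(3)] that(1,2)] act[OF that(1,3)] act[OF that(2,3)] that by blast
  show "g p (h p) = letter_loop (letter_at U i) (clamp01 ((h p - l p i) / (r p i - l p i)))"
    if a: "i \<in> idx U" "p \<in> D" "0 < clamp01 ((h p - l p i) / (r p i - l p i))" "clamp01 ((h p - l p i) / (r p i - l p i)) < 1" for i p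
  proof -
    have "l p i < h p" "h p < r p i" using act[OF a(1,2)] a by blast+
    moreover then have "clamp01 ((h p - l p i) / (r p i - l p i)) = (h p - l p i) / (r p i - l p i)"
      using frac_01[OF lr[OF a(1,2)]] clamp01(4) by blast
    ultimately show ?thesis using H[OF a(2)] a(1) by (simp add: loop_on_def)
  qed
  show "g p (h p) = 0" if a: "p \<in> D" "\<And>i. i \<in> idx U \<Longrightarrow> \<not> (0 < clamp01 ((h p - l p i) / (r p i - l p i)) \<and> clamp01 ((h p - l p i) / (r p i - l p i)) < 1)" for p
  proof -
    have "\<forall>i\<in>idx U. h p \<notin> {l p i<..<r p i}" using a act[OF _ a(1)] by auto
    then show ?thesis using H[OF a(1)] h[OF a(1)] by (auto simp: loop_on_def)
  qed
qed

lemma loop_on_in: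
  assumes "loop_on U l r f" "t \<in> {0..1}" shows "f t \<in> HE"
  
proof (cases "\<exists>i\<in>idx U. t \<in> {l i<..<r i}")
  case True
  then obtain i where "i \<in> idx U" "t \<in> {l i<..<r i}" by blast
  then have "f t = letter_loop (letter_at U i) ((t - l i) / (r i - l i))" using assms(1) unfolding loop_on_def by blast
  then show ?thesis using letter_loop_in by simp
next
  case False
  then have "f t = 0" using assms unfolding loop_on_def by blast
  then show ?thesis using zero_in_HE by simp
qed

lemma loop_on_ends:
  assumes "word_intervals U l r" "loop_on U l r f" shows "f 0 = 0" "f 1 = 0"
proof -
  have "0 \<notin> {l i<..<r i}" "1 \<notin> {l i<..<r i}" if "i \<in> idx U" for i
    using assms(1) that by (auto simp: word_intervals_def not_less)
  then show "f 0 = 0" "f 1 = 0" using assms(2) unfolding loop_on_def by auto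
qed

lemma word_loop_path:
  assumes "countable_word U" "restricted U" "word_loop U f"
  shows "continuous_on {0..1} f" "f ` {0..1} \<subseteq> HE" "f 0 = 0" "f 1 = 0"
proof -
  obtain l r where lr: "word_intervals U l r" "loop_on U l r f" using assms(3) word_loop_iff by blast
  show "continuous_on {0..1} f"
    using loop_family[OF assms(1,2), where D = "{0..1}" and l = "\<lambda>_. l" and r = "\<lambda>_. r" and h = "\<lambda>t. t" and g = "\<lambda>_. f"] lr
    by simp
  show "f ` {0..1} \<subseteq> HE" using loop_on_in[OF lr(2)] by auto
  show "f 0 = 0" "f 1 = 0" using loop_on_ends[OF lr] by auto
qed

lemma loop_on_exists:
  assumes "countable_word U" "word_intervals U l r" shows "\<exists>f. loop_on U l r f"
proof -
  define A where "A t i \<longleftrightarrow> i \<in> idx U \<and> l i < t \<and> t < r i" for t i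
  define f where "f t = (if \<exists>i. A t i then let i = (SOME i. A t i) in letter_loop (letter_at U i) ((t - l i) / (r i - l i)) else 0)" for t
  have "(SOME i. A t i) = i" if "A t i" for t i
    using that word_intervals_disjoint[OF assms] unfolding A_def by (intro some_equality) blast+
  then have "f t = letter_loop (letter_at U i) ((t - l i) / (r i - l i))" if "A t i" for t i
    using that unfolding f_def by (auto simp: Let_def)
  then have "loop_on U l r f" unfolding loop_on_def by (auto simp: A_def f_def)
  then show ?thesis by blast
qed

text \<open>The interval of the index with number \<open>n\<close> has length \<open>1 / 2 ^ (n + 1)\<close> and begins at the sum of
  the lengths of the intervals of all smaller indices.\<close>

lemma word_intervals_exist:
  assumes "countable_word U" shows "\<exists>l r. word_intervals U l r"
proof -
  define w where "w A = suminf (\<lambda>n. if n \<in> A then (1/2::real) ^ Suc n else 0)" for A :: "nat set"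
  have sm: "summable (\<lambda>n. if n \<in> A then (1/2::real) ^ Suc n else 0)" for A :: "nat set"
    by (rule summable_comparison_test[OF _ sums_summable[OF power_half_series]]) auto
  have mono: "w A \<le> w B" if "A \<subseteq> B" for A B
    unfolding w_def using that by (intro suminf_le sm) auto
  have w0: "0 \<le> w A" for A unfolding w_def by (intro suminf_nonneg sm) auto
  have w1: "w UNIV = 1" unfolding w_def using power_half_series by (simp add: sums_iff)
  have ins: "w (insert n A) = w A + (1/2) ^ Suc n" if "n \<notin> A" for n A
  proof -
    have "(\<lambda>k. (if k \<in> A then (1/2::real) ^ Suc k else 0) + (if k = n then (1/2) ^ Suc k else 0)) sums (w A + (1/2) ^ Suc n)"
      unfolding w_def by (intro sums_add summable_sums[OF sm] sums_single)
    moreover have "(\<lambda>k. (if k \<in> A then (1/2::real) ^ Suc k else 0) + (if k = n then (1/2) ^ Suc k else 0)) =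
        (\<lambda>k. if k \<in> insert n A then (1/2::real) ^ Suc k else 0)"
      using that by auto
    ultimately show ?thesis unfolding w_def by (simp add: sums_iff)
  qed
  define c where "c = to_nat_on (idx U)"
  have inj: "inj_on c (idx U)" using assms unfolding c_def countable_word_def by (intro inj_on_to_nat_on) auto
  define l where "l i = w (c ` {j. prec U j i})" for i
  define r where "r i = l i + (1/2) ^ Suc (c i)" for i
  have r: "r i = w (insert (c i) (c ` {j. prec U j i}))" if "i \<in> idx U" for i
  proof -
    have "c i \<notin> c ` {j. prec U j i}"
    proof
      assume "c i \<in> c ` {j. prec U j i}"
      then obtain j where "c i = c j" "prec U j i" by blast
      then show False using inj prec_idx[of U j i] that by (auto simp: inj_on_def prec_def)
    qed
    from ins[OF this] show ?thesis unfolding r_def l_def by simp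
  qed
  have "word_intervals U l r"
    unfolding word_intervals_def
  proof (intro conjI ballI allI impI)
    fix i assume i: "i \<in> idx U"
    show "0 \<le> l i" unfolding l_def by (rule w0)
    show "l i < r i" unfolding r_def by simp
    show "r i \<le> 1" unfolding r[OF i] w1[symmetric] by (rule mono) simp
  next
    fix i j assume ij: "prec U i j"
    then have "insert (c i) (c ` {k. prec U k i}) \<subseteq> c ` {k. prec U k j}"
      using countable_word_trans[OF assms] countable_word_antisym[OF assms] unfolding prec_def by blast
    then show "r i \<le> l j" unfolding r[OF prec_idx[OF ij, THEN conjunct1]] l_def by (rule mono)
  qed
  then show ?thesis by blast
qed

lemma word_loop_exists: "countable_word U \<Longrightarrow> \<exists>f. word_loop U f"
  using word_intervals_exist loop_on_exists word_loop_iff by metis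

section \<open>Singular homology of loops\<close>

definition loop_simplex :: "(real \<Rightarrow> complex) \<Rightarrow> (nat \<Rightarrow> real) \<Rightarrow> complex" where
  "loop_simplex f = restrict (\<lambda>x. f (x (Suc 0))) (standard_simplex (Suc 0))"

abbreviation homologous :: "complex chain \<Rightarrow> complex chain \<Rightarrow> bool" where
  "homologous \<equiv> homologous_rel (Suc 0) (top_of_set HE) {}"

lemma singular_simplex_euclidean:
  "singular_simplex p (top_of_set S) f \<longleftrightarrow>
     continuous_on (standard_simplex p) f \<and> f ` standard_simplex p \<subseteq> S \<and> f \<in> extensional (standard_simplex p)"
  unfolding singular_simplex_def euclidean_product_topology continuous_map_in_subtopology
  by (auto simp: continuous_map_iff_continuous image_subset_iff)

lemma standard_simplex_1: "x \<in> standard_simplex (Suc 0) \<Longrightarrow> 0 \<le> x (Suc 0) \<and> x (Suc 0) \<le> 1 \<and> x 0 = 1 - x (Suc 0)"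
  by (auto simp: standard_simplex_def)

lemma standard_simplex_2: "x \<in> standard_simplex 2 \<Longrightarrow> 0 \<le> x (Suc 0) \<and> 0 \<le> x 2 \<and> x (Suc 0) + x 2 \<le> 1 \<and> x 0 = 1 - x (Suc 0) - x 2"
proof -
  assume x: "x \<in> standard_simplex 2"
  then have s: "(\<Sum>i\<le>2. x i) = 1" and p: "\<And>i. 0 \<le> x i" by (simp_all add: standard_simplex_def)
  have "(\<Sum>i\<le>2. x i) = x 0 + x (Suc 0) + x 2" by (simp add: numeral_2_eq_2)
  then show ?thesis using s p[of 0] p[of "Suc 0"] p[of 2] by simp
qed

lemma sim_simplex:
  assumes "continuous_on {0..1} f" "f ` {0..1} \<subseteq> HE"
  shows "singular_simplex (Suc 0) (top_of_set HE) (loop_simplex f)"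
proof -
  have "continuous_on (standard_simplex (Suc 0)) (\<lambda>x. f (x (Suc 0)))"
    by (rule continuous_on_compose2[OF assms(1)])
       (auto intro!: continuous_on_subset[OF continuous_on_product_coordinates] dest: standard_simplex_1)
  then show ?thesis
    unfolding singular_simplex_euclidean loop_simplex_def
    using assms(2) by (auto simp: image_subset_iff dest: standard_simplex_1 cong: continuous_on_cong)
qed

text \<open>Singular triangles are described by their last two barycentric coordinates.\<close>

definition triangle :: "(real \<Rightarrow> real \<Rightarrow> complex) \<Rightarrow> (nat \<Rightarrow> real) \<Rightarrow> complex" where
  "triangle G = restrict (\<lambda>x. G (x (Suc 0)) (x 2)) (standard_simplex 2)"

lemma triangle_simplex:
  assumes "continuous_on {(a, b). 0 \<le> a \<and> 0 \<le> b \<and> a + b \<le> 1} (\<lambda>(a, b). G a b)"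
    and "\<And>a b. 0 \<le> a \<Longrightarrow> 0 \<le> b \<Longrightarrow> a + b \<le> 1 \<Longrightarrow> G a b \<in> HE"
  shows "singular_simplex 2 (top_of_set HE) (triangle G)"
proof -
  have c: "continuous_on A (\<lambda>x::nat\<Rightarrow>real. x i)" for i A
    by (rule continuous_on_subset[OF continuous_on_product_coordinates]) simp
  have "continuous_on (standard_simplex 2) (\<lambda>x. (\<lambda>(a, b). G a b) (x (Suc 0), x 2))"
    by (rule continuous_on_compose2[OF assms(1)]) (auto intro!: c continuous_on_Pair dest: standard_simplex_2)
  then show ?thesis
    unfolding singular_simplex_euclidean triangle_def
    using assms(2) by (auto simp: image_subset_iff dest: standard_simplex_2 cong: continuous_on_cong)
qed

lemma triangle_faces:
  "singular_face 2 0 (triangle G) = loop_simplex (\<lambda>t. G (1 - t) t)"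
  "singular_face 2 (Suc 0) (triangle G) = loop_simplex (\<lambda>t. G 0 t)"
  "singular_face 2 2 (triangle G) = loop_simplex (\<lambda>t. G t 0)"
proof -
  have f: "simplical_face k x \<in> standard_simplex 2" if "x \<in> standard_simplex (Suc 0)" "k \<le> 2" for k and x :: "nat \<Rightarrow> real"
    using simplical_face_in_standard_simplex[of 2 k x] that by simp
  have e: "restrict (\<lambda>x. G (x (Suc 0)) (x 2)) (standard_simplex 2) (simplical_face k x) =
      G (simplical_face k x (Suc 0)) (simplical_face k x 2)"
    if "x \<in> standard_simplex (Suc 0)" "k \<le> 2" for k x
    using f[OF that] by simp
  have s: "2 - Suc 0 = Suc 0" by simp
  show "singular_face 2 0 (triangle G) = loop_simplex (\<lambda>t. G (1 - t) t)"
    "singular_face 2 (Suc 0) (triangle G) = loop_simplex (\<lambda>t. G 0 t)"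
    "singular_face 2 2 (triangle G) = loop_simplex (\<lambda>t. G t 0)"
    unfolding singular_face_def triangle_def loop_simplex_def s
    by (rule restrict_ext; simp only: comp_apply e; drule standard_simplex_1; simp add: simplical_face_def)+
qed

lemma chain_boundary_2:
  "chain_boundary 2 (frag_of s) = frag_of (singular_face 2 0 s) - frag_of (singular_face 2 (Suc 0) s) + frag_of (singular_face 2 2 s)"
  by (simp add: chain_boundary_of numeral_2_eq_2)

lemma triangle_hom:
  assumes "continuous_on {(a, b). 0 \<le> a \<and> 0 \<le> b \<and> a + b \<le> 1} (\<lambda>(a, b). G a b)"
    and "\<And>a b. 0 \<le> a \<Longrightarrow> 0 \<le> b \<Longrightarrow> a + b \<le> 1 \<Longrightarrow> G a b \<in> HE"
  shows "homologous (frag_of (loop_simplex (\<lambda>t. G t 0)) + frag_of (loop_simplex (\<lambda>t. G (1 - t) t))) (frag_of (loop_simplex (\<lambda>t. G 0 t)))"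
proof -
  have "singular_chain (Suc (Suc 0)) (top_of_set HE) (frag_of (triangle G))"
    using triangle_simplex[OF assms] by (simp add: singular_chain_of numeral_2_eq_2)
  moreover have "chain_boundary (Suc (Suc 0)) (frag_of (triangle G)) =
      frag_of (loop_simplex (\<lambda>t. G t 0)) + frag_of (loop_simplex (\<lambda>t. G (1 - t) t)) - frag_of (loop_simplex (\<lambda>t. G 0 t))"
    using chain_boundary_2[of "triangle G"] unfolding triangle_faces by (simp add: numeral_2_eq_2)
  ultimately show ?thesis unfolding homologous_rel_def singular_boundary by blast
qed

lemma sim_cong: "(\<And>t. 0 \<le> t \<Longrightarrow> t \<le> 1 \<Longrightarrow> f t = g t) \<Longrightarrow> loop_simplex f = loop_simplex g"
  unfolding loop_simplex_def using standard_simplex_1 by (auto simp: fun_eq_iff restrict_def)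

lemma homologous_trans [trans]: "homologous a b \<Longrightarrow> homologous b c \<Longrightarrow> homologous a c"
  using homologous_rel_trans by blast

lemma homologous_sym: "homologous a b \<Longrightarrow> homologous b a"
  by (simp add: homologous_rel_sym)

lemma homologous_add: "homologous a b \<Longrightarrow> homologous c d \<Longrightarrow> homologous (a + c) (b + d)"
  unfolding homologous_rel_def using singular_relboundary_add[of "Suc 0" _ _ "a - b" "c - d"] by (simp add: algebra_simps)

lemma homologous_diff: "homologous a b \<Longrightarrow> homologous c d \<Longrightarrow> homologous (a - c) (b - d)"
  unfolding homologous_rel_def using singular_relboundary_diff[of "Suc 0" _ _ "a - b" "c - d"] by (simp add: algebra_simps)

text \<open>All three sides of the constant triangle are the constant path \<open>c\<close>, and \<open>c - c + c = c\<close>.\<close>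

lemma homologous_const: "homologous (frag_of (loop_simplex (\<lambda>t. 0))) 0"
proof -
  have "homologous (frag_of (loop_simplex (\<lambda>t. 0)) + frag_of (loop_simplex (\<lambda>t. 0))) (frag_of (loop_simplex (\<lambda>t. 0)))"
    using triangle_hom[of "\<lambda>a b. 0"] zero_in_HE by simp
  from homologous_diff[OF this homologous_rel_refl[of _ _ _ "frag_of (loop_simplex (\<lambda>t. 0))"]] show ?thesis
    by simp
qed

text \<open>The square is cut along its diagonal into two triangles. Apart from the two loops, their sides
  are the diagonal, which cancels, and constant paths.\<close>

lemma homologous_homotopy:
  fixes H :: "real \<Rightarrow> real \<Rightarrow> complex"
  assumes c: "continuous_on ({0..1} \<times> {0..1}) (\<lambda>(s, t). H s t)"
    and i: "\<And>s t. s \<in> {0..1} \<Longrightarrow> t \<in> {0..1} \<Longrightarrow> H s t \<in> HE"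
    and e: "\<And>s. s \<in> {0..1} \<Longrightarrow> H s 0 = 0 \<and> H s 1 = (0::complex)"
  shows "homologous (frag_of (loop_simplex (H 0))) (frag_of (loop_simplex (H 1)))"
proof -
  let ?T = "{(a, b). 0 \<le> a \<and> 0 \<le> b \<and> a + b \<le> (1::real)}"
  have "continuous_on ?T (\<lambda>p. (\<lambda>(s, t). H s t) (snd p, fst p + snd p))"
    by (rule continuous_on_compose2[OF c]) (auto intro!: continuous_intros)
  then have "continuous_on ?T (\<lambda>(a, b). H b (a + b))" by (simp add: case_prod_unfold)
  then have A: "homologous (frag_of (loop_simplex (\<lambda>t. H 0 (t + 0))) + frag_of (loop_simplex (\<lambda>t. H t (1 - t + t)))) (frag_of (loop_simplex (\<lambda>t. H t (0 + t))))"
    by (rule triangle_hom) (auto intro: i)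
  have "continuous_on ?T (\<lambda>p. (\<lambda>(s, t). H s t) (fst p + snd p, snd p))"
    by (rule continuous_on_compose2[OF c]) (auto intro!: continuous_intros)
  then have "continuous_on ?T (\<lambda>(a, b). H (a + b) b)" by (simp add: case_prod_unfold)
  then have B: "homologous (frag_of (loop_simplex (\<lambda>t. H (t + 0) 0)) + frag_of (loop_simplex (\<lambda>t. H (1 - t + t) t))) (frag_of (loop_simplex (\<lambda>t. H (0 + t) t)))"
    by (rule triangle_hom) (auto intro: i)
  have z: "loop_simplex (\<lambda>t. H t 1) = loop_simplex (\<lambda>t. 0)" "loop_simplex (\<lambda>t. H t 0) = loop_simplex (\<lambda>t. 0)"
    by (rule sim_cong; use e in auto)+
  have "homologous (frag_of (loop_simplex (H 0)) + frag_of (loop_simplex (\<lambda>t. 0))) (frag_of (loop_simplex (\<lambda>t. 0)) + frag_of (loop_simplex (H 1)))"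
    using A B z homologous_trans[OF _ homologous_sym, of _ "frag_of (loop_simplex (\<lambda>t. H t t))"] by simp
  from homologous_diff[OF this homologous_rel_refl[of _ _ _ "frag_of (loop_simplex (\<lambda>t. 0))"]] show ?thesis by simp
qed

text \<open>The triangle that collapses onto its side from the first to the last vertex, with the middle
  vertex going to the midpoint.\<close>

lemma homologous_join:
  assumes "continuous_on {0..1} f" "f ` {0..1} \<subseteq> HE" "continuous_on {0..1} g" "g ` {0..1} \<subseteq> HE" "f 1 = g 0"
  shows "homologous (frag_of (loop_simplex (f +++ g))) (frag_of (loop_simplex f) + frag_of (loop_simplex g))"
proof -
  let ?T = "{(a, b). 0 \<le> a \<and> 0 \<le> b \<and> a + b \<le> (1::real)}"
  let ?h = "f +++ g"
  have c: "continuous_on {0..1} ?h"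
    using assms path_join_imp[of f g] by (simp add: path_def pathstart_def pathfinish_def)
  have im: "?h t \<in> HE" if "t \<in> {0..1}" for t
    using that assms(2,4) by (auto simp: joinpaths_def image_subset_iff)
  have "continuous_on ?T (\<lambda>p. ?h (fst p / 2 + snd p))"
    by (rule continuous_on_compose2[OF c]) (auto intro!: continuous_intros)
  then have "continuous_on ?T (\<lambda>(a, b). ?h (a / 2 + b))" by (simp add: case_prod_unfold)
  then have A: "homologous (frag_of (loop_simplex (\<lambda>t. ?h (t / 2 + 0))) + frag_of (loop_simplex (\<lambda>t. ?h ((1 - t) / 2 + t)))) (frag_of (loop_simplex (\<lambda>t. ?h (0 / 2 + t))))"
    by (rule triangle_hom) (auto intro!: im)
  have "loop_simplex (\<lambda>t. ?h (t / 2 + 0)) = loop_simplex f"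
    by (rule sim_cong) (auto simp: joinpaths_def)
  moreover have "loop_simplex (\<lambda>t. ?h ((1 - t) / 2 + t)) = loop_simplex g"
  proof (rule sim_cong)
    fix t :: real assume t: "0 \<le> t" "t \<le> 1"
    have "2 * ((1 - t) / 2 + t) - 1 = t" by (simp add: field_simps)
    moreover have "(1 - t) / 2 + t \<le> 1 / 2 \<longleftrightarrow> t = 0" using t by (auto simp: field_simps)
    ultimately show "?h ((1 - t) / 2 + t) = g t" using assms(5) unfolding joinpaths_def by (cases "t = 0") (simp_all only: if_True if_False, simp)
  qed
  ultimately show ?thesis using homologous_sym[OF A] by simp
qed

text \<open>The triangle that runs along the path and back; its remaining side is constant.\<close>

lemma homologous_reverse:
  assumes "continuous_on {0..1} f" "f ` {0..1} \<subseteq> HE" "f 0 = 0"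
  shows "homologous (frag_of (loop_simplex (reversepath f))) (- frag_of (loop_simplex f))"
proof -
  let ?T = "{(a, b). 0 \<le> a \<and> 0 \<le> b \<and> a + b \<le> (1::real)}"
  have "continuous_on ?T (\<lambda>p. f (fst p))"
    by (rule continuous_on_compose2[OF assms(1)]) (auto intro!: continuous_intros)
  then have "continuous_on ?T (\<lambda>(a, b). f a)" by (simp add: case_prod_unfold)
  then have A: "homologous (frag_of (loop_simplex (\<lambda>t. f t)) + frag_of (loop_simplex (\<lambda>t. f (1 - t)))) (frag_of (loop_simplex (\<lambda>t. f 0)))"
    by (rule triangle_hom) (use assms(2) in auto)
  have "homologous (frag_of (loop_simplex f) + frag_of (loop_simplex (reversepath f))) 0"
    using homologous_trans[OF A] homologous_const assms(3) by (simp add: reversepath_def)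
  from homologous_diff[OF this homologous_rel_refl[of _ _ _ "frag_of (loop_simplex f)"]] show ?thesis by simp
qed

section \<open>Homology classes of words\<close>

text \<open>A 1-cycle chosen for the word; statements about it are made up to homology.\<close>

definition word_chain :: "('i, nat) word \<Rightarrow> complex chain" where
  "word_chain W = frag_of (loop_simplex (SOME f. word_loop W f))"

text \<open>Interpolating linearly between two choices of the intervals is a homotopy of the loops.\<close>

lemma word_chain_loop:
  assumes "countable_word W" "restricted W" "word_loop W f"
  shows "homologous (frag_of (loop_simplex f)) (word_chain W)"
proof -
  define g where "g = (SOME f. word_loop W f)"
  have g: "word_loop W g" unfolding g_def by (rule someI[of "word_loop W", OF assms(3)])
  obtain l r where f: "word_intervals W l r" "loop_on W l r f" using assms(3) word_loop_iff by blast
  obtain l' r' where g': "word_intervals W l' r'" "loop_on W l' r' g" using g word_loop_iff by blast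
  define L where "L s i = (1 - s) * l i + s * l' i" for s :: real and i
  define R where "R s i = (1 - s) * r i + s * r' i" for s :: real and i
  have LR: "word_intervals W (L s) (R s)" if s: "s \<in> {0..1}" for s
    unfolding word_intervals_def
  proof (intro conjI ballI allI impI)
    fix i assume "i \<in> idx W"
    then have 1: "0 \<le> l i" "l i < r i" "r i \<le> 1" "0 \<le> l' i" "l' i < r' i" "r' i \<le> 1"
      using f(1) g'(1) by (auto simp: word_intervals_def)
    show "0 \<le> L s i" unfolding L_def using 1 s by (intro add_nonneg_nonneg mult_nonneg_nonneg) auto
    have "(1 - s) * r i + s * r' i \<le> (1 - s) * 1 + s * 1" using 1 s by (intro add_mono mult_left_mono) auto
    then show "R s i \<le> 1" unfolding R_def by simp
    show "L s i < R s i"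
    proof (cases "s = 0")
      case False
      then have "(1 - s) * l i \<le> (1 - s) * r i" "s * l' i < s * r' i" using 1 s by (auto intro: mult_left_mono)
      then show ?thesis unfolding L_def R_def by simp
    qed (use 1 in \<open>simp add: L_def R_def\<close>)
  next
    fix i j assume "prec W i j"
    then have "r i \<le> l j" "r' i \<le> l' j" using f(1) g'(1) by (auto simp: word_intervals_def)
    then show "R s i \<le> L s j" unfolding L_def R_def using s by (intro add_mono mult_left_mono) auto
  qed
  have "\<exists>h. loop_on W (L s) (R s) h" if "s \<in> {0..1}" for s
    using loop_on_exists[OF assms(1) LR[OF that]] .
  then obtain H where H: "\<And>s. s \<in> {0..1} \<Longrightarrow> loop_on W (L s) (R s) (H s)" by metis
  have "continuous_on ({0..1} \<times> {0..1}) (\<lambda>p. H (fst p) (snd p))"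
    by (rule loop_family[OF assms(1,2), where l = "\<lambda>p. L (fst p)" and r = "\<lambda>p. R (fst p)"])
       (use LR H in \<open>auto simp: L_def R_def case_prod_unfold intro!: continuous_intros\<close>)
  then have c: "continuous_on ({0..1} \<times> {0..1}) (\<lambda>(s, t). H s t)" by (simp add: case_prod_unfold)
  have hom: "homologous (frag_of (loop_simplex (H 0))) (frag_of (loop_simplex (H 1)))"
    by (rule homologous_homotopy[OF c]) (use loop_on_in[OF H] loop_on_ends[OF LR H] in auto)
  have eq: "a t = b t" if "loop_on W l r a" "loop_on W l r b" "t \<in> {0..1}" for l r a b t
    using that unfolding loop_on_def by metis
  have e: "L 0 = l" "R 0 = r" "L 1 = l'" "R 1 = r'" by (auto simp: L_def R_def)
  have "loop_simplex (H 0) = loop_simplex f" by (rule sim_cong) (use eq[OF _ f(2)] H[of 0] e in auto)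
  moreover have "loop_simplex (H 1) = loop_simplex g" by (rule sim_cong) (use eq[OF _ g'(2)] H[of 1] e in auto)
  ultimately show ?thesis using hom unfolding word_chain_def g_def[symmetric] by simp
qed

lemma word_loop_cong:
  assumes "word_eq V W" "word_loop W f" shows "word_loop V f"
proof -
  obtain \<phi> where \<phi>: "bij_betw \<phi> (idx V) (idx W)"
    "\<forall>i\<in>idx V. \<forall>j\<in>idx V. (i, j) \<in> le V \<longleftrightarrow> (\<phi> i, \<phi> j) \<in> le W"
    "\<forall>i\<in>idx V. letter_at W (\<phi> i) = letter_at V i"
    using assms unfolding word_eq_def by blast
  obtain l r where f: "word_intervals W l r" "loop_on W l r f" using assms(2) word_loop_iff by blast
  have m: "\<phi> i \<in> idx W" if "i \<in> idx V" for i using \<phi>(1) that by (auto simp: bij_betw_def)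
  have s: "\<exists>j\<in>idx V. i = \<phi> j" if "i \<in> idx W" for i using \<phi>(1) that by (auto simp: bij_betw_def)
  have "inj_on \<phi> (idx V)" using \<phi>(1) by (auto simp: bij_betw_def)
  note p = word_eq_prec[OF \<phi>(2) this]
  have "word_intervals V (l \<circ> \<phi>) (r \<circ> \<phi>)"
    unfolding word_intervals_def comp_def
  proof (intro conjI ballI allI impI)
    fix i j assume "prec V i j"
    then have "prec W (\<phi> i) (\<phi> j)" using p prec_idx by metis
    then show "r (\<phi> i) \<le> l (\<phi> j)" using f(1) by (simp add: word_intervals_def)
  qed (use f(1) m in \<open>auto simp: word_intervals_def\<close>)
  moreover have "loop_on V (l \<circ> \<phi>) (r \<circ> \<phi>) f"
    using f(2) m \<phi>(3) unfolding loop_on_def comp_def by (metis s)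
  ultimately show ?thesis using word_loop_iff by blast
qed

lemma word_chain_cong:
  assumes "countable_word V" "restricted V" "word_eq V W"
  shows "homologous (word_chain V) (word_chain W)"
proof -
  have W: "countable_word W" "restricted W"
    using word_eq_countable_word[OF assms(3,1)] word_eq_restricted[OF assms(3,2)] by auto
  obtain f where f: "word_loop W f" using word_loop_exists[OF W(1)] by blast
  from homologous_trans[OF homologous_sym[OF word_chain_loop[OF assms(1,2) word_loop_cong[OF assms(3) f]]] word_chain_loop[OF W f]]
  show ?thesis .
qed

lemma word_chain_cat2:
  assumes A: "countable_word A" "restricted A" and B: "countable_word B" "restricted B"
  shows "homologous (word_chain (cat2 A B)) (word_chain A + word_chain B)"
proof -
  obtain f where f: "word_loop A f" using word_loop_exists[OF A(1)] by blast
  obtain g where g: "word_loop B g" using word_loop_exists[OF B(1)] by blast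
  obtain l r where lr: "word_intervals A l r" "loop_on A l r f" using f word_loop_iff by blast
  obtain l' r' where lr': "word_intervals B l' r'" "loop_on B l' r' g" using g word_loop_iff by blast
  note fp = word_loop_path[OF A f] and gp = word_loop_path[OF B g]
  define L where "L = case_sum (\<lambda>i. l i / 2) (\<lambda>j. (1 + l' j) / 2)"
  define R where "R = case_sum (\<lambda>i. r i / 2) (\<lambda>j. (1 + r' j) / 2)"
  have bA: "0 \<le> l i" "l i < r i" "r i \<le> 1" if "i \<in> idx A" for i using lr(1) that by (auto simp: word_intervals_def)
  have bB: "0 \<le> l' i" "l' i < r' i" "r' i \<le> 1" if "i \<in> idx B" for i using lr'(1) that by (auto simp: word_intervals_def)
  have "word_intervals (cat2 A B) L R"
    unfolding word_intervals_def
  proof (intro conjI ballI allI impI)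
    fix i assume "i \<in> idx (cat2 A B)"
    then show "0 \<le> L i" "L i < R i" "R i \<le> 1"
      unfolding idx_cat2 L_def R_def using bA bB by (fastforce simp: field_simps)+
  next
    fix i j assume ij: "prec (cat2 A B) i j"
    show "R i \<le> L j"
    proof (cases i; cases j)
      fix a b assume "i = Inl a" "j = Inl b"
      then show ?thesis using ij lr(1) by (auto simp: prec_def word_intervals_def L_def R_def)
    next
      fix a b assume e: "i = Inl a" "j = Inr b"
      then have "a \<in> idx A" "b \<in> idx B" using ij by (auto simp: prec_def)
      then show ?thesis using e bA[of a] bB[of b] by (auto simp: L_def R_def)
    next
      fix a b assume "i = Inr a" "j = Inl b"
      then show ?thesis using ij by (auto simp: prec_def)
    next
      fix a b assume "i = Inr a" "j = Inr b"
      then show ?thesis using ij lr'(1) by (auto simp: prec_def word_intervals_def L_def R_def)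
    qed
  qed
  moreover have "loop_on (cat2 A B) L R (f +++ g)"
    unfolding loop_on_def
  proof (intro conjI ballI impI)
    fix k t assume k: "k \<in> idx (cat2 A B)" and t: "t \<in> {L k<..<R k}"
    show "(f +++ g) t = letter_loop (letter_at (cat2 A B) k) ((t - L k) / (R k - L k))"
    proof (cases k)
      case (Inl i)
      then have i: "i \<in> idx A" "l i < 2 * t" "2 * t < r i" using k t by (auto simp: idx_cat2 L_def R_def)
      have "(f +++ g) t = f (2 * t)" using i bA[OF i(1)] by (simp add: joinpaths_def)
      also have "\<dots> = letter_loop (letter_at A i) ((2 * t - l i) / (r i - l i))"
        using lr(2) i by (auto simp: loop_on_def)
      also have "(2 * t - l i) / (r i - l i) = (t - l i / 2) / (r i / 2 - l i / 2)"
        using bA[OF i(1)] by (simp add: field_simps)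
      finally show ?thesis using Inl by (simp add: L_def R_def)
    next
      case (Inr i)
      then have i: "i \<in> idx B" "l' i < 2 * t - 1" "2 * t - 1 < r' i" using k t by (auto simp: idx_cat2 L_def R_def)
      have "(f +++ g) t = g (2 * t - 1)" using i bB[OF i(1)] by (simp add: joinpaths_def)
      also have "\<dots> = letter_loop (letter_at B i) ((2 * t - 1 - l' i) / (r' i - l' i))"
        using lr'(2) i by (auto simp: loop_on_def)
      also have "(2 * t - 1 - l' i) / (r' i - l' i) = (t - (1 + l' i) / 2) / ((1 + r' i) / 2 - (1 + l' i) / 2)"
        using bB[OF i(1)] by (simp add: field_simps)
      finally show ?thesis using Inr by (simp add: L_def R_def)
    qed
  next
    fix t :: real assume t: "t \<in> {0..1}" and n: "\<forall>k\<in>idx (cat2 A B). t \<notin> {L k<..<R k}"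
    show "(f +++ g) t = 0"
    proof (cases "t \<le> 1 / 2")
      case True
      have "2 * t \<notin> {l i<..<r i}" if "i \<in> idx A" for i
      proof -
        have "t \<notin> {L (Inl i)<..<R (Inl i)}" using n that by (auto simp: idx_cat2)
        then show ?thesis by (auto simp: L_def R_def field_simps)
      qed
      then show ?thesis using True t lr(2) by (auto simp: joinpaths_def loop_on_def)
    next
      case False
      have "2 * t - 1 \<notin> {l' i<..<r' i}" if i: "i \<in> idx B" for i
      proof -
        have "t \<notin> {L (Inr i)<..<R (Inr i)}" using n i by (auto simp: idx_cat2)
        then show ?thesis by (auto simp: L_def R_def field_simps)
      qed
      then show ?thesis using False t lr'(2) by (auto simp: joinpaths_def loop_on_def)
    qed
  qed
  ultimately have wl: "word_loop (cat2 A B) (f +++ g)" using word_loop_iff by blast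
  have "homologous (word_chain (cat2 A B)) (frag_of (loop_simplex (f +++ g)))"
    using word_chain_loop[OF cat2_countable_word[OF A(1) B(1)] _ wl] restricted_cat2[of A B] A B homologous_sym by blast
  also have "homologous \<dots> (frag_of (loop_simplex f) + frag_of (loop_simplex g))"
    by (rule homologous_join) (use fp gp in auto)
  also have "homologous \<dots> (word_chain A + word_chain B)" by (intro homologous_add word_chain_loop A B f g)
  finally show ?thesis .
qed

lemma restricted_inv_word [simp]: "restricted (inv_word W) \<longleftrightarrow> restricted W"
proof -
  have *: "restricted (inv_word W)" if "restricted W" for W :: "('i, 'b) word"
    unfolding restricted_def
  proof
    fix x
    have "{i \<in> idx (inv_word W). letter_at (inv_word W) i = x} = {i \<in> idx W. letter_at W i = inv_letter x}"
      by auto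
    then show "finite {i \<in> idx (inv_word W). letter_at (inv_word W) i = x}"
      using that unfolding restricted_def by simp
  qed
  from *[of W] *[of "inv_word W"] show ?thesis by auto
qed

lemma word_chain_inv:
  assumes A: "countable_word A" "restricted A"
  shows "homologous (word_chain (inv_word A)) (- word_chain A)"
proof -
  obtain f where f: "word_loop A f" using word_loop_exists[OF A(1)] by blast
  obtain l r where lr: "word_intervals A l r" "loop_on A l r f" using f word_loop_iff by blast
  have bA: "0 \<le> l i" "l i < r i" "r i \<le> 1" if "i \<in> idx A" for i using lr(1) that by (auto simp: word_intervals_def)
  have "word_intervals (inv_word A) (\<lambda>i. 1 - r i) (\<lambda>i. 1 - l i)"
    using lr(1) unfolding word_intervals_def by (auto simp: prec_def)
  moreover have "loop_on (inv_word A) (\<lambda>i. 1 - r i) (\<lambda>i. 1 - l i) (reversepath f)"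
    unfolding loop_on_def
  proof (intro conjI ballI impI)
    fix i t assume i: "i \<in> idx (inv_word A)" and t: "t \<in> {1 - r i<..<1 - l i}"
    then have "f (1 - t) = letter_loop (letter_at A i) ((1 - t - l i) / (r i - l i))"
      using lr(2) by (auto simp: loop_on_def)
    moreover have "(1 - t - l i) / (r i - l i) = 1 - (t - (1 - r i)) / (1 - l i - (1 - r i))"
      using bA[of i] i by (simp add: field_simps)
    ultimately show "reversepath f t = letter_loop (letter_at (inv_word A) i) ((t - (1 - r i)) / (1 - l i - (1 - r i)))"
      by (simp add: reversepath_def letter_loop_inv)
  next
    fix t :: real assume t: "t \<in> {0..1}" and n: "\<forall>i\<in>idx (inv_word A). t \<notin> {1 - r i<..<1 - l i}"
    then have "1 - t \<in> {0..1}" "\<forall>i\<in>idx A. 1 - t \<notin> {l i<..<r i}" by auto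
    then show "reversepath f t = 0" using lr(2) by (simp add: reversepath_def loop_on_def)
  qed
  ultimately have wl: "word_loop (inv_word A) (reversepath f)" using word_loop_iff by blast
  have "homologous (word_chain (inv_word A)) (frag_of (loop_simplex (reversepath f)))"
    using word_chain_loop[OF _ _ wl] A homologous_sym by auto
  also have "homologous \<dots> (- frag_of (loop_simplex f))"
    by (rule homologous_reverse) (use word_loop_path[OF A f] in auto)
  also have "homologous \<dots> (- word_chain A)"
    using homologous_diff[OF homologous_rel_refl[of _ _ _ 0] word_chain_loop[OF A f]] by simp
  finally show ?thesis .
qed

lemma restricted_concat_words:
  assumes "\<forall>V\<in>set Ws. countable_word V"
  shows "restricted (concat_words Ws) \<longleftrightarrow> (\<forall>V\<in>set Ws. restricted V)"
  using assms
proof (induction Ws)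
  case Nil
  show ?case by (simp add: restricted_def concat_words_Nil)
next
  case (Cons A Ws)
  have "word_eq (concat_words (A # Ws)) (cat2 A (concat_words Ws))"
    using Cons.prems by (intro concat_words_Cons) auto
  then have "restricted (concat_words (A # Ws)) \<longleftrightarrow> restricted (cat2 A (concat_words Ws))"
    using word_eq_restricted word_eq_sym by metis
  then show ?case using Cons by (simp add: restricted_cat2)
qed

lemma word_chain_concat:
  assumes "\<forall>V\<in>set Ws. countable_word V" "\<forall>V\<in>set Ws. restricted V"
  shows "homologous (word_chain (concat_words Ws)) (sum_list (map word_chain Ws))"
  using assms
proof (induction Ws)
  case Nil
  have "word_loop (concat_words []) (\<lambda>t. 0)"
    unfolding word_loop_def using concat_words_Nil by (auto simp: prec_def dest: idx_le)
  moreover have "restricted (concat_words [])" by (simp add: restricted_def concat_words_Nil)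
  ultimately have "homologous (word_chain (concat_words [])) (frag_of (loop_simplex (\<lambda>t. 0)))"
    by (intro homologous_sym[OF word_chain_loop] concat_words_countable) auto
  then show ?case using homologous_trans[OF _ homologous_const] by simp
next
  case (Cons A Ws)
  have c: "countable_word (concat_words Ws)" "countable_word (concat_words (A # Ws))"
    using Cons.prems by (auto intro!: concat_words_countable)
  have r: "restricted (concat_words Ws)" "restricted (concat_words (A # Ws))"
    using Cons.prems restricted_concat_words[of Ws] restricted_concat_words[of "A # Ws"] by auto
  have "homologous (word_chain (concat_words (A # Ws))) (word_chain (cat2 A (concat_words Ws)))"
    using Cons.prems by (intro word_chain_cong c r concat_words_Cons) auto
  also have "homologous \<dots> (word_chain A + word_chain (concat_words Ws))"
    using Cons.prems by (intro word_chain_cat2 c r) auto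
  also have "homologous \<dots> (word_chain A + sum_list (map word_chain Ws))"
    using Cons by (intro homologous_add homologous_rel_refl) auto
  finally show ?case by simp
qed

lemma word_chain_word_eq_concat:
  assumes "word_eq V (concat_words Ws)" "\<forall>V\<in>set Ws. countable_word V" "\<forall>V\<in>set Ws. restricted V"
  shows "homologous (word_chain V) (sum_list (map word_chain Ws))" "restricted V" "countable_word V"
proof -
  have c: "countable_word (concat_words Ws)" using concat_words_countable[OF assms(2)] .
  have r: "restricted (concat_words Ws)" using restricted_concat_words[OF assms(2)] assms(3) by simp
  show "restricted V" "countable_word V"
    using word_eq_restricted[OF word_eq_sym[OF assms(1)] r] word_eq_countable_word[OF word_eq_sym[OF assms(1)] c] by auto
  from homologous_trans[OF word_chain_cong[OF this(2,1) assms(1)] word_chain_concat[OF assms(2,3)]]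
  show "homologous (word_chain V) (sum_list (map word_chain Ws))" .
qed

lemma delete_step_word_chain:
  assumes "delete_step V W" "restricted V"
  shows "restricted W \<and> countable_word W \<and> homologous (word_chain V) (word_chain W)"
  using assms(1)
proof cases
  case (1 A X B C)
  have cw: "\<forall>V\<in>set [A, X, B, inv_word X, C]. countable_word V" using 1 by simp
  have "restricted (concat_words [A, X, B, inv_word X, C])" using word_eq_restricted[OF 1(5) assms(2)] .
  then have rs: "\<forall>V\<in>set [A, X, B, inv_word X, C]. restricted V" using restricted_concat_words[OF cw] by blast
  note V = word_chain_word_eq_concat[OF 1(5) cw rs]
  have W: "homologous (word_chain W) (sum_list (map word_chain [A, B, C]))" "restricted W" "countable_word W"
    using word_chain_word_eq_concat[OF 1(6)] cw rs by auto
  have X: "homologous (word_chain (inv_word X)) (- word_chain X)" by (rule word_chain_inv) (use cw rs in auto)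
  have "homologous (sum_list (map word_chain [A, X, B, inv_word X, C])) (word_chain A + word_chain X + word_chain B + (- word_chain X) + word_chain C)"
    using homologous_add[OF homologous_add[OF homologous_rel_refl[of _ _ _ "word_chain A + word_chain X + word_chain B"] X] homologous_rel_refl[of _ _ _ "word_chain C"]]
    by (simp add: algebra_simps)
  then have "homologous (word_chain V) (sum_list (map word_chain [A, B, C]))"
    using homologous_trans[OF V(1)] by (simp add: algebra_simps)
  then show ?thesis using homologous_trans[OF _ homologous_sym[OF W(1)]] W by blast
qed

lemma permute_step_word_chain:
  assumes "permute_step V W" "restricted V"
  shows "restricted W \<and> countable_word W \<and> homologous (word_chain V) (word_chain W)"
  using assms(1)
proof cases
  case (1 A X Y B)
  have cw: "\<forall>V\<in>set [A, X, Y, B]. countable_word V" using 1 by simp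
  have "restricted (concat_words [A, X, Y, B])" using word_eq_restricted[OF 1(5) assms(2)] .
  then have rs: "\<forall>V\<in>set [A, X, Y, B]. restricted V" using restricted_concat_words[OF cw] by blast
  note V = word_chain_word_eq_concat[OF 1(5) cw rs]
  have W: "homologous (word_chain W) (sum_list (map word_chain [A, Y, X, B]))" "restricted W" "countable_word W"
    using word_chain_word_eq_concat[OF 1(6)] cw rs by auto
  have "sum_list (map word_chain [A, X, Y, B]) = sum_list (map word_chain [A, Y, X, B])" by (simp add: algebra_simps)
  then show ?thesis using homologous_trans[OF V(1) homologous_sym[OF W(1), folded \<open>_ = _\<close>]] W by metis
qed

lemma transforms_to_word_chain:
  assumes "transforms_to U T" "countable_word U" "restricted U"
  shows "homologous (word_chain U) (word_chain T)"
proof -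
  obtain U0 U1 U2 where u: "word_eq U U0" "delete_step\<^sup>*\<^sup>* U0 U1" "permute_step\<^sup>*\<^sup>* U1 U2" "word_eq U2 T"
    using assms(1) unfolding transforms_to_def by blast
  have 0: "countable_word U0" "restricted U0" "homologous (word_chain U) (word_chain U0)"
    using word_eq_countable_word[OF u(1)] word_eq_restricted[OF u(1)] word_chain_cong[OF _ _ u(1)] assms by auto
  have 1: "restricted U1 \<and> countable_word U1 \<and> homologous (word_chain U0) (word_chain U1)"
    using u(2)
  proof (induction rule: rtranclp_induct)
    case base then show ?case using 0 by simp
  next
    case (step y z) then show ?case using delete_step_word_chain[OF step(2)] homologous_trans by blast
  qed
  have 2: "restricted U2 \<and> countable_word U2 \<and> homologous (word_chain U1) (word_chain U2)"
    using u(3)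
  proof (induction rule: rtranclp_induct)
    case base then show ?case using 1 by simp
  next
    case (step y z) then show ?case using permute_step_word_chain[OF step(2)] homologous_trans by blast
  qed
  have "homologous (word_chain U2) (word_chain T)" using word_chain_cong[OF _ _ u(4)] 2 by blast
  then show ?thesis using homologous_trans 0 1 2 by blast
qed

lemma loop_class_in_carrier:
  assumes "countable_word W" "restricted W" "word_loop W f"
  shows "loop_homology_class HE f \<in> carrier (homology_group 1 (top_of_set HE))"
proof -
  note p = word_loop_path[OF assms]
  have s: "singular_simplex (Suc 0) (top_of_set HE) (loop_simplex f)" by (rule sim_simplex[OF p(1,2)])
  have f0: "x 0 = 1 \<and> simplical_face 0 x \<in> standard_simplex (Suc 0) \<and> simplical_face (Suc 0) x \<in> standard_simplex (Suc 0)"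
    if "x \<in> standard_simplex 0" for x :: "nat \<Rightarrow> real"
    using simplical_face_in_standard_simplex[of "Suc 0" 0 x] simplical_face_in_standard_simplex[of "Suc 0" "Suc 0" x] that
    by (auto simp: standard_simplex_def)
  have e: "loop_simplex f (simplical_face k x) = f (simplical_face k x (Suc 0))"
    if "x \<in> standard_simplex 0" "k = 0 \<or> k = Suc 0" for k x
    using f0[OF that(1)] that(2) by (auto simp: loop_simplex_def)
  have "singular_face (Suc 0) 0 (loop_simplex f) = singular_face (Suc 0) (Suc 0) (loop_simplex f)"
    unfolding singular_face_def
  proof (rule restrict_ext)
    fix x :: "nat \<Rightarrow> real" assume "x \<in> standard_simplex (Suc 0 - Suc 0)"
    then have x: "x \<in> standard_simplex 0" by simp
    show "(loop_simplex f \<circ> simplical_face 0) x = (loop_simplex f \<circ> simplical_face (Suc 0)) x"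
      using e[OF x, of 0] e[OF x, of "Suc 0"] f0[OF x] p(3,4) by (simp add: simplical_face_def)
  qed
  then have "chain_boundary (Suc 0) (frag_of (loop_simplex f)) = 0" by (simp add: chain_boundary_of)
  then have "singular_relcycle (Suc 0) (top_of_set HE) {} (frag_of (loop_simplex f))"
    using s by (simp add: singular_cycle singular_chain_of)
  then show ?thesis
    using carrier_relative_homology_group[of "Suc 0" "top_of_set HE" "{}"]
    unfolding loop_homology_class_def loop_simplex_def by auto
qed

lemma loop_homology_class_eq:
  "loop_homology_class HE f = loop_homology_class HE g \<longleftrightarrow> homologous (frag_of (loop_simplex f)) (frag_of (loop_simplex g))"
  using homologous_rel_set_eq[of "Suc 0" "top_of_set HE" "{}" "frag_of (loop_simplex f)" "frag_of (loop_simplex g)"]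
  by (simp add: loop_homology_class_def loop_simplex_def)

lemma common_class_of_transforms:
  assumes "reduced_tame U" "reduced_tame V" "transforms_to U T" "transforms_to V T"
  shows "\<exists>c \<in> carrier (homology_group 1 (top_of_set HE)). represents U c \<and> represents V c"
proof -
  have U: "countable_word U" "restricted U" and V: "countable_word V" "restricted V"
    using assms(1,2) by (auto simp: reduced_tame_def)
  obtain f where f: "word_loop U f" using word_loop_exists[OF U(1)] by blast
  obtain g where g: "word_loop V g" using word_loop_exists[OF V(1)] by blast
  have "homologous (frag_of (loop_simplex f)) (word_chain U)" by (rule word_chain_loop[OF U f])
  also have "homologous \<dots> (word_chain T)" by (rule transforms_to_word_chain[OF assms(3) U])
  also have "homologous \<dots> (word_chain V)" by (rule homologous_sym[OF transforms_to_word_chain[OF assms(4) V]])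
  also have "homologous \<dots> (frag_of (loop_simplex g))" by (rule homologous_sym[OF word_chain_loop[OF V g]])
  finally have "loop_homology_class HE f = loop_homology_class HE g" using loop_homology_class_eq by blast
  then show ?thesis using f g loop_class_in_carrier[OF U f] unfolding represents_def by blast
qed

section \<open>Crossings of the far points of the circles\<close>

text \<open>The point opposite to the base point on the circle of \<open>n\<close>. Its distance to the other circles is
  at least \<open>4 * arc_radius n\<close>, so the ball of radius
  \<open>arc_radius n\<close> around it meets the earring in an arc of a single circle.\<close>

definition antipode :: "nat \<Rightarrow> complex" where "antipode n = of_real (2 / (real n + 1))"
definition arc_radius :: "nat \<Rightarrow> real" where "arc_radius n = 1 / (2 * (real n + 1) * (real n + 2))"
definition far_arc :: "nat \<Rightarrow> complex set" where "far_arc n = {z \<in> HE. dist z (antipode n) < arc_radius n}"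

text \<open>Circles are traversed counterclockwise, so the far point of a circle is passed from the lower
  to the upper half plane in the positive direction.\<close>

definition crossing :: "nat \<Rightarrow> complex \<Rightarrow> complex \<Rightarrow> int" where
  "crossing n z w = (if z \<in> far_arc n \<and> w \<in> far_arc n then of_bool (0 \<le> Im w) - of_bool (0 \<le> Im z) else 0)"

lemma arc_radius_pos [simp]: "arc_radius n > 0" by (simp add: arc_radius_def)

lemma arc_radius_mono: "n \<le> m \<Longrightarrow> arc_radius m \<le> arc_radius n"
  unfolding arc_radius_def by (intro divide_left_mono mult_mono mult_left_mono mult_pos_pos) auto

lemma arc_radius_gap: "2 / (real n + 1) - 2 / (real n + 2) = 4 * arc_radius n"
proof -
  have "2 / (real n + 1) - 2 / (real n + 2) = 2 / ((real n + 1) * (real n + 2))"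
    by (subst diff_frac_eq) (auto simp: algebra_simps)
  moreover have "4 * (1 / (2 * (real n + 1) * (real n + 2))) = 2 / ((real n + 1) * (real n + 2))"
    by (simp only: mult.assoc) simp
  ultimately show ?thesis by (simp only: arc_radius_def)
qed

lemma arc_radius_less: "4 * arc_radius n < 2 / (real n + 1)"
proof -
  have "0 < 2 / (real n + 2)" by simp
  then show ?thesis using arc_radius_gap[of n] by linarith
qed

lemma norm_anti: "norm (antipode n) = 2 / (real n + 1)"
  by (simp only: antipode_def norm_of_real) simp

lemma far_arc_only:
  assumes "z \<in> sphere (of_real (1 / real (Suc m))) (1 / real (Suc m))" "dist z (antipode n) < arc_radius n"
  shows "m = n"
proof (rule ccontr)
  assume "m \<noteq> n"
  let ?R = "1 / (real m + 1)" and ?a = "2 / (real n + 1)"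
  have dR: "dist (of_real ?R) z = ?R" using assms(1) by (simp add: add.commute)
  consider "n < m" | "m < n" using \<open>m \<noteq> n\<close> by linarith
  then show False
  proof cases
    case 1
    have "norm z \<le> norm (of_real ?R :: complex) + dist (of_real ?R) z"
      by (metis dist_norm norm_minus_commute norm_triangle_sub)
    also have "norm (of_real ?R :: complex) = ?R" by (simp only: norm_of_real) simp
    also have "?R + dist (of_real ?R) z = 2 / (real m + 1)" using dR by simp
    also have "\<dots> \<le> 2 / (real n + 2)" using 1 by (intro divide_left_mono) auto
    finally have "norm z \<le> 2 / (real n + 2)" .
    moreover have "?a \<le> norm z + dist z (antipode n)"
    proof -
      show ?thesis by (metis norm_anti dist_norm norm_minus_commute norm_triangle_sub)
    qed
    ultimately have "4 * arc_radius n \<le> dist z (antipode n)" using arc_radius_gap[of n] by linarith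
    then show False using assms(2) arc_radius_pos[of n] by linarith
  next
    case 2
    have "dist (of_real ?R) z \<le> dist (of_real ?R) (antipode n) + dist z (antipode n)" by (rule dist_triangle2)
    also have "dist (of_real ?R) (antipode n) = \<bar>?R - ?a\<bar>"
      unfolding antipode_def dist_norm by (metis norm_of_real of_real_diff real_norm_def)
    finally have *: "?R \<le> \<bar>?R - ?a\<bar> + dist z (antipode n)" using dR by linarith
    have n0: "real m + 1 \<le> real n" "real n > 0" using 2 by auto
    have r: "arc_radius n < 2 / (real n + 1)" using arc_radius_less[of n] arc_radius_pos[of n] by linarith
    have "2 / real n \<le> 2 * ?R" using n0 by (simp add: field_simps)
    moreover have "arc_radius n < 2 / real n - ?a"
    proof -
      have e: "real (n - 1) + 1 = real n" "real (n - 1) + 2 = real n + 1" using 2 by auto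
      show ?thesis
        using arc_radius_gap[of "n - 1", unfolded e] arc_radius_mono[of "n - 1" n] arc_radius_pos[of n] by linarith
    qed
    ultimately have r2: "arc_radius n < 2 * ?R - ?a" by linarith
    show False using * r r2 assms(2) by (auto simp: abs_if split: if_splits)
  qed
qed

lemma far_arc_circle: "z \<in> far_arc n \<Longrightarrow> z \<in> sphere (of_real (1 / real (Suc n))) (1 / real (Suc n))"
  using far_arc_only[of z _ n] unfolding far_arc_def hawaiian_earring_def by auto

lemma far_arc_nonzero: "0 \<notin> far_arc n"
proof
  assume "0 \<in> far_arc n"
  then have "2 / (real n + 1) < arc_radius n" by (simp add: far_arc_def norm_anti)
  then show False using arc_radius_less[of n] arc_radius_pos[of n] by linarith
qed

lemma far_arc_apart:
  assumes "z \<in> far_arc n" "w \<in> far_arc m" "n < N" "m < N" "dist z w < arc_radius N" shows "n = m"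
proof -
  have *: False if "z \<in> far_arc n" "w \<in> far_arc m" "n < m" "m < N" "dist z w < arc_radius N" for z w n m
  proof -
    have "2 / (real m + 1) \<le> 2 / (real n + 2)" using that(3) by (intro divide_left_mono) auto
    then have "4 * arc_radius n \<le> 2 / (real n + 1) - 2 / (real m + 1)" using arc_radius_gap[of n] by linarith
    also have "\<dots> \<le> dist (antipode n) (antipode m)"
      unfolding antipode_def dist_norm by (metis abs_ge_self norm_of_real of_real_diff)
    also have "\<dots> \<le> dist z (antipode n) + dist z w + dist w (antipode m)"
      using dist_triangle[of "antipode n" "antipode m" z] dist_triangle[of z "antipode m" w] by (simp add: dist_commute)
    also have "\<dots> < arc_radius n + arc_radius N + arc_radius m" using that by (auto simp: far_arc_def)
    also have "\<dots> \<le> 3 * arc_radius n" using arc_radius_mono[of n m] arc_radius_mono[of n N] that by simp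
    finally show False using arc_radius_pos[of n] by simp
  qed
  show ?thesis
  proof (rule ccontr)
    assume "n \<noteq> m"
    then consider "n < m" | "m < n" by linarith
    then show False using *[OF assms(1,2)] *[OF assms(2,1)] assms by cases (auto simp: dist_commute)
  qed
qed

lemma far_arc_disjoint: "z \<in> far_arc n \<Longrightarrow> z \<in> far_arc m \<Longrightarrow> n = m"
  using far_arc_apart[of z n z m "Suc (max n m)"] by auto

text \<open>On a circle of radius \<open>R\<close> the squared distance of \<open>z\<close> to the far point is \<open>2 * R * (2 * R - Re z)\<close>,
  and the squared imaginary part is \<open>Re z * (2 * R - Re z)\<close>, which is at least half of it.\<close>

lemma far_arc_Im:
  assumes "z \<in> far_arc n" "arc_radius n / 2 \<le> dist z (antipode n)" shows "arc_radius n / 4 < \<bar>Im z\<bar>"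
proof -
  let ?R = "1 / (real n + 1)" and ?x = "Re z" and ?y = "Im z"
  have "dist (of_real ?R) z = ?R" using far_arc_circle[OF assms(1)] by (simp add: add.commute)
  then have "(?R - ?x)\<^sup>2 + ?y\<^sup>2 = ?R\<^sup>2"
    by (metis (no_types, lifting) cmod_power2 dist_norm minus_complex.sel Re_complex_of_real Im_complex_of_real
        diff_0 power2_minus)
  then have c: "?y\<^sup>2 = ?x * (2 * ?R - ?x)" by (simp add: power2_eq_square algebra_simps)
  have d: "(dist z (antipode n))\<^sup>2 = (?x - 2 * ?R)\<^sup>2 + ?y\<^sup>2"
    by (simp add: dist_norm cmod_power2 antipode_def)
  have "\<bar>?x - 2 * ?R\<bar> \<le> dist z (antipode n)"
    using abs_Re_le_cmod[of "z - antipode n"] by (simp add: dist_norm antipode_def)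
  also have "\<dots> < arc_radius n" using assms(1) by (simp add: far_arc_def)
  also have "arc_radius n \<le> ?R" using arc_radius_less[of n] arc_radius_pos[of n] by (simp add: field_simps)
  finally have x: "?R < ?x" by linarith
  have "(dist z (antipode n))\<^sup>2 = 2 * ?R * (2 * ?R - ?x)" unfolding d c by (simp add: power2_eq_square algebra_simps)
  moreover have "0 \<le> 2 * ?R - ?x"
  proof (rule ccontr)
    assume "\<not> 0 \<le> 2 * ?R - ?x"
    moreover have "0 < ?x" using x by (rule less_trans[rotated]) simp
    ultimately have "?x * (2 * ?R - ?x) < 0" by (intro mult_pos_neg) auto
    then show False using c by (metis not_less zero_le_power2)
  qed
  ultimately have "(dist z (antipode n))\<^sup>2 \<le> 2 * ?y\<^sup>2"
    unfolding c using x mult_right_mono[of "2 * ?R" "2 * ?x" "2 * ?R - ?x"] by (simp add: mult.assoc)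
  moreover have "(arc_radius n / 2)\<^sup>2 \<le> (dist z (antipode n))\<^sup>2" using assms(2) less_imp_le[OF arc_radius_pos[of n]] by (intro power_mono) simp_all
  ultimately have "(arc_radius n / 2)\<^sup>2 \<le> 2 * ?y\<^sup>2" by linarith
  then have "(arc_radius n / 4)\<^sup>2 < ?y\<^sup>2" using arc_radius_pos[of n] by (simp add: power_divide)
      (smt (verit) zero_less_power arc_radius_pos)
  then have "(arc_radius n / 4)\<^sup>2 < \<bar>?y\<bar>\<^sup>2" by simp
  then show ?thesis by (rule power_less_imp_less_base) simp
qed

text \<open>Points of the arc that are close to a point outside it are close to the ends of the arc, and the
  two ends are far apart.\<close>

lemma far_arc_same_side:
  assumes "z \<in> far_arc n" "w \<in> far_arc n" "u \<in> HE" "u \<notin> far_arc n"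
    "dist u z < arc_radius n / 2" "dist u w < arc_radius n / 2" "dist z w < arc_radius n / 2"
  shows "0 \<le> Im z \<longleftrightarrow> 0 \<le> Im w"
proof -
  have far: "arc_radius n \<le> dist u (antipode n)" using assms(3,4) by (auto simp: far_arc_def)
  have "arc_radius n / 2 \<le> dist z (antipode n)" "arc_radius n / 2 \<le> dist w (antipode n)"
    using far dist_triangle[of u "antipode n" z] dist_triangle[of u "antipode n" w] assms(5,6) by auto
  then have "arc_radius n / 4 < \<bar>Im z\<bar>" "arc_radius n / 4 < \<bar>Im w\<bar>" using far_arc_Im assms(1,2) by auto
  moreover have "\<bar>Im z - Im w\<bar> < arc_radius n / 2"
    using abs_Im_le_cmod[of "z - w"] assms(7) by (simp add: dist_norm)
  ultimately show ?thesis by (auto simp: abs_if split: if_splits)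
qed

lemma crossing_cocycle:
  assumes "u \<in> HE" "v \<in> HE" "w \<in> HE" "dist u v < arc_radius n / 2" "dist v w < arc_radius n / 2" "dist u w < arc_radius n / 2"
  shows "crossing n u v + crossing n v w = crossing n u w"
  using far_arc_same_side[of u n v w] far_arc_same_side[of v n w u] far_arc_same_side[of u n w v] assms
  by (auto simp: crossing_def dist_commute)

lemma crossing_arc: "crossing n z w \<noteq> 0 \<Longrightarrow> z \<in> far_arc n \<and> w \<in> far_arc n"
  by (auto simp: crossing_def split: if_splits)

lemma crossing_refl [simp]: "crossing n z z = 0"
  by (simp add: crossing_def)

lemma crossing_cases: "crossing n z w = 0 \<or> crossing n z w = 1 \<or> crossing n z w = -1"
  by (auto simp: crossing_def)

definition gen_power :: "nat \<Rightarrow> int \<Rightarrow> nat fgrp" where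
  "gen_power n k = (if 0 \<le> k then fval (replicate (nat k) (Gen n)) else fval (replicate (nat (- k)) (GenInv n)))"

lemma fgen_GenInv [simp]: "fgen (GenInv n) = - fgen (Gen n)"
  using fgen_inv[of "Gen n"] by simp

lemma gen_power_0 [simp]: "gen_power n 0 = 0" by (simp add: gen_power_def)

lemma fval_replicate_Suc: "fval (replicate (Suc k) x) = fval (replicate k x) + fgen x"
proof -
  have "replicate (Suc k) x = replicate k x @ [x]" by (simp only: replicate_append_same replicate_Suc)
  then show ?thesis by (simp only: fval_simps add_0_right)
qed

lemma gen_power_step: "gen_power n (k + 1) = gen_power n k + fgen (Gen n)"
proof (cases "0 \<le> k")
  case True
  then have "nat (k + 1) = Suc (nat k)" by simp
  then show ?thesis using True
    by (simp only: gen_power_def fval_replicate_Suc) simp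
next
  case False
  then have e: "nat (- k) = Suc (nat (- (k + 1)))" by simp
  have "gen_power n k = fval (replicate (nat (- (k + 1))) (GenInv n) @ [GenInv n])"
    using False e by (simp add: gen_power_def replicate_append_same)
  then have "gen_power n k + fgen (Gen n) = fval (replicate (nat (- (k + 1))) (GenInv n))"
    by (simp add: add.assoc)
  then show ?thesis using False by (cases "k = -1") (auto simp: gen_power_def)
qed

lemma gen_power_add: "gen_power n (a + b) = gen_power n a + gen_power n b"
proof (induction b rule: int_induct[where k = 0])
  case base show ?case by simp
next
  case (step1 i)
  have "gen_power n (a + (i + 1)) = gen_power n (a + i) + fgen (Gen n)" using gen_power_step[of n "a + i"] by (simp add: add.assoc)
  then show ?case using step1 gen_power_step[of n i] by (simp add: add.assoc)
next
  case (step2 i)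
  have "gen_power n (a + (i - 1)) + fgen (Gen n) = gen_power n a + gen_power n i"
    using step2 gen_power_step[of n "a + (i - 1)"] by (simp add: algebra_simps)
  also have "\<dots> = gen_power n a + gen_power n (i - 1) + fgen (Gen n)"
    using gen_power_step[of n "i - 1"] by (simp add: add.assoc)
  finally show ?case by (simp only: add_right_cancel)
qed

primrec letter_sign :: "'a letter \<Rightarrow> int" where "letter_sign (Gen a) = 1" | "letter_sign (GenInv a) = -1"

lemma fgen_zpow: "fgen x = gen_power (gen_of x) (letter_sign x)"
  by (cases x) (auto simp: gen_power_def)

lemma fval_zpow:
  "(\<And>x. x \<in> set xs \<Longrightarrow> gen_of (lab x) = n) \<Longrightarrow> fval (map lab xs) = gen_power n (\<Sum>x\<leftarrow>xs. letter_sign (lab x))"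
  by (induction xs) (auto simp: gen_power_add fgen_zpow)

definition gen_power_sum :: "nat \<Rightarrow> (nat \<Rightarrow> int) \<Rightarrow> nat fgrp" where
  "gen_power_sum N f = sum_list (map (\<lambda>n. gen_power n (f n)) [0..<N])"

lemma gen_power_sum_0: "(\<And>n. n < N \<Longrightarrow> f n = 0) \<Longrightarrow> gen_power_sum N f = 0"
  unfolding gen_power_sum_def by (induction N) auto

lemma gen_power_sum_single: "m < N \<Longrightarrow> (\<And>n. n < N \<Longrightarrow> n \<noteq> m \<Longrightarrow> f n = 0) \<Longrightarrow> gen_power_sum N f = gen_power m (f m)"
proof (induction N)
  case (Suc N)
  have s: "gen_power_sum (Suc N) f = gen_power_sum N f + gen_power N (f N)" by (simp add: gen_power_sum_def)
  show ?case
  proof (cases "m = N")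
    case True
    then show ?thesis using s gen_power_sum_0[of N f] Suc.prems by simp
  next
    case False
    then have "gen_power_sum N f = gen_power m (f m)" "f N = 0" using Suc by auto
    then show ?thesis using s by simp
  qed
qed simp

text \<open>The passages between two close points. Close points lie in the arc of at most one \<open>n\<close>, so at most
  one summand is not zero.\<close>

definition transition :: "nat \<Rightarrow> complex \<Rightarrow> complex \<Rightarrow> nat fgrp" where
  "transition N z w = gen_power_sum N (\<lambda>n. crossing n z w)"

text \<open>A cocycle that only close points have to obey.\<close>

definition cocycle_on :: "('c::metric_space \<Rightarrow> 'c \<Rightarrow> 'g::group_add) \<Rightarrow> 'c set \<Rightarrow> real \<Rightarrow> bool" where
  "cocycle_on G S e \<longleftrightarrow> (\<forall>x\<in>S. \<forall>y\<in>S. \<forall>z\<in>S. dist x y < e \<longrightarrow> dist y z < e \<longrightarrow> dist x z < e \<longrightarrow>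
     G x y + G y z = G x z)"

lemma crossing_cocycle_on: "cocycle_on (crossing n) HE (arc_radius n / 2)"
  unfolding cocycle_on_def using crossing_cocycle by blast

lemma transition_cocycle_on: "cocycle_on (transition N) HE (arc_radius N / 2)"
  unfolding cocycle_on_def
proof (intro ballI impI)
  fix x y z assume a: "x \<in> HE" "y \<in> HE" "z \<in> HE" "dist x y < arc_radius N / 2" "dist y z < arc_radius N / 2" "dist x z < arc_radius N / 2"
  show "transition N x y + transition N y z = transition N x z"
  proof (cases "\<exists>m<N. x \<in> far_arc m \<or> y \<in> far_arc m \<or> z \<in> far_arc m")
    case False
    then have "crossing n x y = 0" "crossing n y z = 0" "crossing n x z = 0" if "n < N" for n
      using that by (auto simp: crossing_def)
    then show ?thesis by (simp add: transition_def gen_power_sum_0)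
  next
    case True
    then obtain m where m: "m < N" "x \<in> far_arc m \<or> y \<in> far_arc m \<or> z \<in> far_arc m" by blast
    obtain p where p: "p \<in> {x, y, z}" "p \<in> far_arc m" using m(2) by blast
    have close: "dist p q < arc_radius N" if "q \<in> {x, y, z}" for q
      
    proof -
      have "dist x y < arc_radius N" "dist y z < arc_radius N" "dist x z < arc_radius N"
        using a(4-6) arc_radius_pos[of N] by linarith+
      then show ?thesis using that p(1) by (auto simp: dist_commute)
    qed
    have o: "q \<notin> far_arc n" if "q \<in> {x, y, z}" "n < N" "n \<noteq> m" for q n
      using far_arc_apart[OF p(2) _ m(1) that(2) close[OF that(1)]] that(3) by auto
    have "crossing n x y = 0" "crossing n y z = 0" "crossing n x z = 0" if "n < N" "n \<noteq> m" for n
      using o[of _ n] that by (auto simp: crossing_def)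
    then have "transition N x y = gen_power m (crossing m x y)" "transition N y z = gen_power m (crossing m y z)"
      "transition N x z = gen_power m (crossing m x z)"
      unfolding transition_def using m(1) by (auto intro: gen_power_sum_single)
    moreover have "crossing m x y + crossing m y z = crossing m x z"
      using a arc_radius_mono[of m N] m(1) by (intro crossing_cocycle) auto
    ultimately show ?thesis by (simp flip: gen_power_add)
  qed
qed

section \<open>Lifts of local cocycles\<close>

text \<open>A lift along \<open>f\<close> sums up the local increments \<open>G\<close>. This replaces the lifting of paths to the
  universal covering of a bouquet of circles.\<close>

definition is_lift :: "('c \<Rightarrow> 'c \<Rightarrow> 'g::group_add) \<Rightarrow> 'x::metric_space set \<Rightarrow> ('x \<Rightarrow> 'c) \<Rightarrow> ('x \<Rightarrow> 'g) \<Rightarrow> bool" where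
  "is_lift G X f \<phi> \<longleftrightarrow> (\<exists>d>0. \<forall>x\<in>X. \<forall>y\<in>X. dist x y < d \<longrightarrow> \<phi> y = \<phi> x + G (f x) (f y))"

lemma step_induct:
  fixes t :: real
  assumes "P 0" "d > 0" "\<And>s t. s \<in> {0..1} \<Longrightarrow> t \<in> {0..1} \<Longrightarrow> dist s t < d \<Longrightarrow> P s \<Longrightarrow> P t" "t \<in> {0..1}"
  shows "P t"
proof -
  have "P (min t (real n * (d / 2)))" for n
  proof (induction n)
    case 0 then show ?case using assms(1,4) by (cases "t = 0") (auto simp: min_def)
  next
    case (Suc n)
    have "dist (min t (real n * (d / 2))) (min t (real (Suc n) * (d / 2))) < d"
      using assms(2) by (auto simp: dist_real_def min_def field_simps)
    then show ?case using assms(2,4) Suc by (intro assms(3)[OF _ _ _ Suc]) (auto simp: min_def)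
  qed
  moreover obtain n where "t < real n * (d / 2)" using assms(2) ex_less_of_nat_mult[of "d / 2" t] by auto
  ultimately show ?thesis by (metis less_imp_le min.absorb1)
qed

lemma lift_unique:
  fixes f :: "real \<Rightarrow> 'c"
  assumes "is_lift G {0..1} f \<phi>" "is_lift G {0..1} f \<psi>"
  shows "- \<phi> 0 + \<phi> 1 = - \<psi> 0 + \<psi> 1"
proof -
  obtain d1 where d1: "d1 > 0" "\<And>x y. x \<in> {0..1} \<Longrightarrow> y \<in> {0..1} \<Longrightarrow> dist x y < d1 \<Longrightarrow> \<phi> y = \<phi> x + G (f x) (f y)"
    using assms(1) unfolding is_lift_def by blast
  obtain d2 where d2: "d2 > 0" "\<And>x y. x \<in> {0..1} \<Longrightarrow> y \<in> {0..1} \<Longrightarrow> dist x y < d2 \<Longrightarrow> \<psi> y = \<psi> x + G (f x) (f y)"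
    using assms(2) unfolding is_lift_def by blast
  have "- \<phi> 0 + \<phi> t = - \<psi> 0 + \<psi> t" if "t \<in> {0..1}" for t
  proof (rule step_induct[where P = "\<lambda>t. - \<phi> 0 + \<phi> t = - \<psi> 0 + \<psi> t" and d = "min d1 d2"])
    fix s t :: real assume st: "s \<in> {0..1}" "t \<in> {0..1}" "dist s t < min d1 d2" "- \<phi> 0 + \<phi> s = - \<psi> 0 + \<psi> s"
    have "- \<phi> 0 + \<phi> t = (- \<phi> 0 + \<phi> s) + G (f s) (f t)" using d1(2)[OF st(1,2)] st(3) by (simp add: add.assoc)
    also have "\<dots> = - \<psi> 0 + \<psi> t" using d2(2)[OF st(1,2)] st(3,4) by (simp add: add.assoc)
    finally show "- \<phi> 0 + \<phi> t = - \<psi> 0 + \<psi> t" .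
  qed (use that d1(1) d2(1) in auto)
  then show ?thesis by simp
qed

lemma lift_compose:
  assumes "is_lift G X f \<phi>" "uniformly_continuous_on Y h" "h ` Y \<subseteq> X"
  shows "is_lift G Y (f \<circ> h) (\<phi> \<circ> h)"
proof -
  obtain d where d: "d > 0" "\<And>x y. x \<in> X \<Longrightarrow> y \<in> X \<Longrightarrow> dist x y < d \<Longrightarrow> \<phi> y = \<phi> x + G (f x) (f y)"
    using assms(1) unfolding is_lift_def by blast
  obtain e where e: "e > 0" "\<And>x y. x \<in> Y \<Longrightarrow> y \<in> Y \<Longrightarrow> dist x y < e \<Longrightarrow> dist (h x) (h y) < d"
    using assms(2) d(1) unfolding uniformly_continuous_on_def by (metis dist_commute)
  show ?thesis unfolding is_lift_def comp_def
    using e d(2) assms(3) by (intro exI[of _ e]) blast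
qed

lemma lift_cong: "is_lift G X f \<phi> \<Longrightarrow> (\<And>x. x \<in> X \<Longrightarrow> f x = g x) \<Longrightarrow> is_lift G X g \<phi>"
  unfolding is_lift_def by (metis (no_types, lifting))

text \<open>The path is subdivided into \<open>K\<close> intervals; the last summand accounts for the incomplete one.\<close>

definition subdivision_lift :: "nat \<Rightarrow> ('c \<Rightarrow> 'c \<Rightarrow> 'g::group_add) \<Rightarrow> (real \<Rightarrow> 'c) \<Rightarrow> real \<Rightarrow> 'g" where
  "subdivision_lift K G f t = (\<Sum>i\<leftarrow>[0..<nat \<lfloor>t * real K\<rfloor>]. G (f (real i / real K)) (f (real (Suc i) / real K))) +
     G (f (real (nat \<lfloor>t * real K\<rfloor>) / real K)) (f t)"

text \<open>Points at distance less than \<open>1 / K\<close> lie in the same or in adjacent intervals of the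
  subdivision, and all points involved are within \<open>2 / K\<close> of each other.\<close>

lemma subdivision_lift_step:
  assumes coc: "cocycle_on G S e" and K: "K > 0"
    and f: "\<And>t. t \<in> {0..1} \<Longrightarrow> f t \<in> S" "\<And>s t. s \<in> {0..1} \<Longrightarrow> t \<in> {0..1} \<Longrightarrow> dist s t \<le> 2 / real K \<Longrightarrow> dist (f s) (f t) < e"
    and st: "s \<in> {0..1}" "t \<in> {0..1}" "dist s t < 1 / real K"
  shows "subdivision_lift K G f t = subdivision_lift K G f s + G (f s) (f t)"
proof -
  have C: "G (f a) (f b) + G (f b) (f c) = G (f a) (f c)"
    if "a \<in> {0..1}" "b \<in> {0..1}" "c \<in> {0..1}" "dist a b \<le> 2 / real K" "dist b c \<le> 2 / real K" "dist a c \<le> 2 / real K" for a b c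
    using coc f that unfolding cocycle_on_def by blast
  have G0: "G (f a) (f a) = 0" if "a \<in> {0..1}" for a
    using C[OF that that that] K by (simp, metis add_left_cancel add.right_neutral)
  have main: "subdivision_lift K G f t = subdivision_lift K G f s + G (f s) (f t)"
    if st: "s \<in> {0..1}" "t \<in> {0..1}" "s \<le> t" "t - s < 1 / real K" for s t
  proof -
    define i where "i = nat \<lfloor>s * real K\<rfloor>"
    define j where "j = nat \<lfloor>t * real K\<rfloor>"
    have "t * real K < s * real K + 1" using st(4) K by (simp add: field_simps)
    moreover have "s * real K \<le> t * real K" using st(3) by (simp add: mult_right_mono)
    ultimately have ij: "j = i \<or> j = Suc i" unfolding i_def j_def using st(1) by (simp; linarith)
    have fl: "real (nat \<lfloor>x\<rfloor>) \<le> x \<and> x < real (nat \<lfloor>x\<rfloor>) + 1" if "0 \<le> x" for x :: real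
    proof -
      have "real (nat \<lfloor>x\<rfloor>) = of_int \<lfloor>x\<rfloor>" using that by simp
      then show ?thesis using floor_correct[of x] by simp
    qed
    have si: "real i \<le> s * real K" "s * real K < real i + 1" unfolding i_def using fl[of "s * real K"] st(1) by simp_all
    have tj: "real j \<le> t * real K" "t * real K < real j + 1" unfolding j_def using fl[of "t * real K"] st(2) by simp_all
    have si': "real i / real K \<le> s" "s < real i / real K + 1 / real K" using si K by (auto simp: field_simps)
    have tj': "real j / real K \<le> t" "t < real j / real K + 1 / real K" using tj K by (auto simp: field_simps)
    have K2: "2 / real K = 1 / real K + 1 / real K" by simp
    have i1: "real i / real K \<in> {0..1}" using si' st(1) by auto
    have K0: "0 < 1 / real K" using K by simp
    show ?thesis
    proof (cases "j = i")
      case True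
      have "G (f (real i / real K)) (f s) + G (f s) (f t) = G (f (real i / real K)) (f t)"
      proof -
        have t1: "t < real i / real K + 1 / real K" using tj'(2) unfolding True .
        show ?thesis
          by (intro C i1 st(1,2); unfold dist_real_def K2; use si' t1 st(3) K0 in linarith)
      qed
      then show ?thesis using True unfolding subdivision_lift_def i_def[symmetric] j_def[symmetric] by (simp add: add.assoc)
    next
      case False
      then have j: "j = Suc i" using ij by simp
      have jK: "real j / real K = real i / real K + 1 / real K" unfolding j by (simp add: add_divide_distrib)
      have j1: "real j / real K \<in> {0..1}" using tj' st(2) by auto
      have 1: "G (f (real i / real K)) (f (real j / real K)) + G (f (real j / real K)) (f t) = G (f (real i / real K)) (f t)"
        by (intro C i1 j1 st(1,2); unfold dist_real_def K2; use si' tj' jK st(3,4) K0 in linarith)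
      have 2: "G (f (real i / real K)) (f s) + G (f s) (f t) = G (f (real i / real K)) (f t)"
        by (intro C i1 j1 st(1,2); unfold dist_real_def K2; use si' tj' jK st(3,4) K0 in linarith)
      let ?S = "\<Sum>k\<leftarrow>[0..<i]. G (f (real k / real K)) (f (real (Suc k) / real K))"
      have "subdivision_lift K G f t = ?S + (G (f (real i / real K)) (f (real j / real K)) + G (f (real j / real K)) (f t))"
        unfolding subdivision_lift_def j_def[symmetric] j by (simp add: add.assoc)
      also have "\<dots> = ?S + G (f (real i / real K)) (f s) + G (f s) (f t)" unfolding 1 2[symmetric] by (simp add: add.assoc)
      finally show ?thesis unfolding subdivision_lift_def[of K G f s] i_def[symmetric] .
    qed
  qed
  show ?thesis
  proof (cases "s \<le> t")
    case True then show ?thesis using main[OF st(1,2)] st(3) by (simp add: dist_real_def)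
  next
    case False
    then have m: "subdivision_lift K G f s = subdivision_lift K G f t + G (f t) (f s)"
      using main[OF st(2,1)] st(3) by (simp add: dist_real_def)
    have "1 / real K \<le> 2 / real K" by (simp add: divide_right_mono)
    then have "G (f t) (f s) + G (f s) (f t) = G (f t) (f t)"
      using st K by (intro C) (auto simp: dist_commute)
    then show ?thesis using m G0[OF st(2)] by (simp add: add.assoc)
  qed
qed

lemma subdivision_lift_0:
  assumes "G (f 0) (f 0) = 0" shows "subdivision_lift K G f 0 = 0"
  using assms by (simp add: subdivision_lift_def)

lemma uniform_mesh:
  fixes f :: "'x::metric_space \<Rightarrow> 'c::metric_space"
  assumes "uniformly_continuous_on X f" "e > 0"
  shows "\<exists>K>0. \<forall>x\<in>X. \<forall>y\<in>X. dist x y \<le> c / real K \<longrightarrow> dist (f x) (f y) < e"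
proof -
  obtain d where d: "d > 0" "\<And>x y. x \<in> X \<Longrightarrow> y \<in> X \<Longrightarrow> dist x y < d \<Longrightarrow> dist (f x) (f y) < e"
    using assms unfolding uniformly_continuous_on_def by (metis dist_commute)
  obtain K :: nat where K: "c / d < real K" using reals_Archimedean2 by blast
  have "c / real (Suc K) < d" using K d(1) by (simp add: field_simps)
  then show ?thesis using d(2) by (intro exI[of _ "Suc K"]) (auto dest: le_less_trans)
qed

lemma path_uniform:
  fixes \<gamma> :: "real \<Rightarrow> complex"
  shows "continuous_on {0..1} \<gamma> \<Longrightarrow> uniformly_continuous_on {0..1::real} \<gamma>"
  by (rule compact_uniformly_continuous) auto

text \<open>Lift the bottom side and from there all vertical lines. That neighbouring vertical lines stay
  compatible is shown by moving up in small steps, using the cocycle condition on small squares.\<close>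

lemma square_lift:
  fixes f :: "real \<times> real \<Rightarrow> 'c::metric_space"
  assumes coc: "cocycle_on G S e" "e > 0" and c: "continuous_on ({0..1} \<times> {0..1}) f" and im: "f ` ({0..1} \<times> {0..1}) \<subseteq> S"
  shows "\<exists>\<phi>. is_lift G ({0..1} \<times> {0..1}) f \<phi>"
proof -
  have "uniformly_continuous_on ({0..1} \<times> {0..1}) f"
    by (intro compact_uniformly_continuous c compact_Times) auto
  from uniform_mesh[OF this coc(2), where c = 2]
  obtain K where K1: "K > 0" "\<forall>x\<in>{0..1} \<times> {0..1}. \<forall>y\<in>{0..1} \<times> {0..1}. dist x y \<le> 2 / real K \<longrightarrow> dist (f x) (f y) < e"
    by (elim exE conjE)
  note K = K1(1) K1(2)[rule_format]
  have C: "G (f a) (f b) + G (f b) (f c) = G (f a) (f c)"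
    if "a \<in> {0..1} \<times> {0..1}" "b \<in> {0..1} \<times> {0..1}" "c \<in> {0..1} \<times> {0..1}" "dist a b \<le> 2 / real K" "dist b c \<le> 2 / real K" "dist a c \<le> 2 / real K" for a b c
  proof -
    have 1: "f a \<in> S" "f b \<in> S" "f c \<in> S" using that(1-3) im by auto
    note 2 = K(2)[OF that(1,2,4)] K(2)[OF that(2,3,5)] K(2)[OF that(1,3,6)]
    show ?thesis using coc(1)[unfolded cocycle_on_def, rule_format, OF 1 2] .
  qed
  define \<beta> where "\<beta> = subdivision_lift K G (\<lambda>s. f (s, 0))"
  define \<alpha> where "\<alpha> s = subdivision_lift K G (\<lambda>t. f (s, t))" for s
  define \<phi> where "\<phi> p = \<beta> (fst p) + \<alpha> (fst p) (snd p)" for p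
  have G0: "G (f a) (f a) = 0" if "a \<in> {0..1} \<times> {0..1}" for a using C[OF that that that] K(1) by (simp, metis add_left_cancel add.right_neutral)
  have \<alpha>0: "\<alpha> s 0 = 0" if "s \<in> {0..1}" for s
    unfolding \<alpha>_def by (rule subdivision_lift_0) (use G0 that in auto)
  have \<beta>: "\<beta> s' = \<beta> s + G (f (s, 0)) (f (s', 0))" if "s \<in> {0..1}" "s' \<in> {0..1}" "dist s s' < 1 / real K" for s s'
    unfolding \<beta>_def by (rule subdivision_lift_step[OF coc(1) K(1) _ _ that]) (use im K(2) in \<open>auto simp: dist_Pair_Pair\<close>)
  have \<alpha>: "\<alpha> s t' = \<alpha> s t + G (f (s, t)) (f (s, t'))" if "s \<in> {0..1}" "t \<in> {0..1}" "t' \<in> {0..1}" "dist t t' < 1 / real K" for s t t'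
    unfolding \<alpha>_def by (rule subdivision_lift_step[OF coc(1) K(1) _ _ that(2-4)]) (use im K(2) that(1) in \<open>auto simp: dist_Pair_Pair\<close>)
  have two: "dist (s, t) (s', t') \<le> 2 / real K" if "dist s s' < 1 / real K" "dist t t' < 1 / real K" for s t s' t' :: real
  proof -
    have "dist (s, t) (s', t') \<le> dist s s' + dist t t'"
      unfolding dist_Pair_Pair  by (rule sqrt_sum_squares_le_sum) auto
    then show ?thesis using that by simp
  qed
  have V: "\<phi> (s, t') = \<phi> (s, t) + G (f (s, t)) (f (s, t'))" if "s \<in> {0..1}" "t \<in> {0..1}" "t' \<in> {0..1}" "dist t t' < 1 / real K" for s t t'
    using \<alpha>[OF that] by (simp add: \<phi>_def add.assoc)
  have K0: "0 < 1 / real K" using K(1) by simp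
  have H: "\<phi> (s', t) = \<phi> (s, t) + G (f (s, t)) (f (s', t))" if s: "s \<in> {0..1}" "s' \<in> {0..1}" "dist s s' < 1 / real K" and t: "t \<in> {0..1}" for s s' t
  proof (rule step_induct[where P = "\<lambda>t. \<phi> (s', t) = \<phi> (s, t) + G (f (s, t)) (f (s', t))", OF _ K0 _ t])
    show "\<phi> (s', 0) = \<phi> (s, 0) + G (f (s, 0)) (f (s', 0))" using \<beta>[OF s] \<alpha>0 s by (simp add: \<phi>_def)
    fix u t :: real assume ut: "u \<in> {0..1}" "t \<in> {0..1}" "dist u t < 1 / real K" "\<phi> (s', u) = \<phi> (s, u) + G (f (s, u)) (f (s', u))"
    have "\<phi> (s', t) = \<phi> (s, u) + (G (f (s, u)) (f (s', u)) + G (f (s', u)) (f (s', t)))"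
      using V[OF s(2) ut(1-3)] ut(4) by (simp add: add.assoc)
    also have "G (f (s, u)) (f (s', u)) + G (f (s', u)) (f (s', t)) = G (f (s, u)) (f (s', t))"
      using s ut two K0 by (intro C) auto
    also have "\<dots> = G (f (s, u)) (f (s, t)) + G (f (s, t)) (f (s', t))"
      using s ut two K0 by (intro C[symmetric]) auto
    finally show "\<phi> (s', t) = \<phi> (s, t) + G (f (s, t)) (f (s', t))" using V[OF s(1) ut(1-3)] by (simp add: add.assoc)
  qed
  have "\<phi> q = \<phi> p + G (f p) (f q)" if pq: "p \<in> {0..1} \<times> {0..1}" "q \<in> {0..1} \<times> {0..1}" "dist p q < 1 / real K" for p q
  proof -
    obtain s t s' t' where e: "p = (s, t)" "q = (s', t')" by (cases p, cases q)
    have d: "dist s s' < 1 / real K" "dist t t' < 1 / real K"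
      using pq(3) dist_fst_le[of p q] dist_snd_le[of p q] unfolding e by auto
    have "\<phi> q = \<phi> (s, t) + (G (f (s, t)) (f (s, t')) + G (f (s, t')) (f (s', t')))"
      using H[of s s' t'] V[of s t t'] pq(1,2) d unfolding e by (simp add: add.assoc)
    also have "G (f (s, t)) (f (s, t')) + G (f (s, t')) (f (s', t')) = G (f (s, t)) (f (s', t'))"
      using pq(1,2) d two K0 unfolding e by (intro C) auto
    finally show ?thesis unfolding e .
  qed
  then show ?thesis unfolding is_lift_def using K0 by blast
qed

section \<open>Words of paths\<close>

definition net_count :: "(real \<Rightarrow> nat letter) \<Rightarrow> real set \<Rightarrow> nat \<Rightarrow> real \<Rightarrow> int" where
  "net_count lab M n t = (\<Sum>x\<in>{x \<in> M. x \<le> t \<and> gen_of (lab x) = n}. letter_sign (lab x))"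

lemma crossing_antisym: "crossing n w z = - crossing n z w"
  by (simp add: crossing_def)

text \<open>The condition on \<open>a\<close>, a lift for a single circle, says that the word counts the passages through the
  far point of circle \<open>n\<close> correctly, up to a discrepancy while the path is in the arc around
  it. During a short time only one of the first \<open>N\<close> arcs is visited. So the value
  of the part of the word up to \<open>t\<close>, corrected by the present discrepancies, is a lift.\<close>

lemma word_value_lift:
  fixes \<gamma> :: "real \<Rightarrow> complex"
  assumes \<gamma>: "continuous_on {0..1} \<gamma>" "\<gamma> ` {0..1} \<subseteq> HE"
    and M: "M \<subseteq> {0<..1}" "fin_letters lab M" "\<And>x. x \<in> M \<Longrightarrow> \<gamma> x \<in> far_arc (gen_of (lab x))"
    and a: "\<And>n. is_lift (crossing n) {0..1} \<gamma> (a n)" "\<And>n. a n 0 = 0" "\<And>n. a n 1 = net_count lab M n 1"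
    and off: "\<And>n t. t \<in> {0..1} \<Longrightarrow> a n t \<noteq> net_count lab M n t \<Longrightarrow> \<gamma> t \<in> far_arc n"
  shows "\<exists>\<phi>. is_lift (transition N) {0..1} \<gamma> \<phi> \<and> - \<phi> 0 + \<phi> 1 = word_value N lab M"
proof -
  define \<phi> where "\<phi> t = word_value N lab (M \<inter> {..t}) + gen_power_sum N (\<lambda>n. a n t - net_count lab M n t)" for t
  have fin: "finite {x \<in> M. Q x \<and> gen_of (lab x) = n}" for Q n
    using M(2) unfolding fin_letters_def by (auto intro: finite_subset[of _ "{x \<in> M. gen_of (lab x) = n}"])
  have fl: "fin_letters lab X" if "X \<subseteq> M" for X by (rule fin_letters_subset[OF M(2) that])
  have "\<phi> 0 = 0"
  proof -
    have 1: "M \<inter> {..0} = {}" using M(1) by fastforce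
    have "{x \<in> M. x \<le> 0 \<and> gen_of (lab x) = n} = {}" for n using M(1) by fastforce
    then have "net_count lab M n 0 = 0" for n unfolding net_count_def by (simp only: sum.empty)
    then have "gen_power_sum N (\<lambda>n. a n 0 - net_count lab M n 0) = 0" using a(2) by (intro gen_power_sum_0) simp
    then show ?thesis using 1 by (simp add: \<phi>_def)
  qed
  moreover have "\<phi> 1 = word_value N lab M"
  proof -
    have "M \<inter> {..1} = M" using M(1) by fastforce
    then show ?thesis using a(3) by (simp add: \<phi>_def gen_power_sum_0)
  qed
  moreover have "is_lift (transition N) {0..1} \<gamma> \<phi>"
  proof -
    have "\<forall>n. \<exists>d>0. \<forall>x\<in>{0..1}. \<forall>y\<in>{0..1}. dist x y < d \<longrightarrow> a n y = a n x + crossing n (\<gamma> x) (\<gamma> y)"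
      using a(1) unfolding is_lift_def by blast
    then obtain d where d: "\<And>n. d n > 0" "\<And>n x y. x \<in> {0..1} \<Longrightarrow> y \<in> {0..1} \<Longrightarrow> dist x y < d n \<Longrightarrow> a n y = a n x + crossing n (\<gamma> x) (\<gamma> y)"
      by metis
    obtain d' where d': "d' > 0" "\<And>x y. x \<in> {0..1} \<Longrightarrow> y \<in> {0..1} \<Longrightarrow> dist x y < d' \<Longrightarrow> dist (\<gamma> x) (\<gamma> y) < arc_radius N"
      using path_uniform[OF \<gamma>(1)] arc_radius_pos[of N] unfolding uniformly_continuous_on_def by (metis dist_commute)
    define e where "e = Min (insert d' (d ` {..<N}))"
    have e: "e > 0" "e \<le> d'" "\<And>n. n < N \<Longrightarrow> e \<le> d n"
      using d(1) d'(1) unfolding e_def by auto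
    have main: "\<phi> t = \<phi> s + transition N (\<gamma> s) (\<gamma> t)"
      if st: "s \<in> {0..1}" "t \<in> {0..1}" "s \<le> t" "t - s < e" for s t
    proof -
      have dist: "dist u v < d'" if "u \<in> {s..t}" "v \<in> {s..t}" for u v
        using that st(4) e(2) by (auto simp: dist_real_def)
      have in01: "u \<in> {0..1}" if "u \<in> {s..t}" for u using that st by auto
      have astep: "a n t = a n s + crossing n (\<gamma> s) (\<gamma> t)" if "n < N" for n
        using d(2)[OF st(1,2)] st(3,4) e(3)[OF that] by (simp add: dist_real_def)
      have nstep: "net_count lab M n t = net_count lab M n s + (\<Sum>x\<in>{x \<in> M. s < x \<and> x \<le> t \<and> gen_of (lab x) = n}. letter_sign (lab x))" for n
      proof -
        have A: "{x \<in> M. x \<le> t \<and> gen_of (lab x) = n} =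
           {x \<in> M. x \<le> s \<and> gen_of (lab x) = n} \<union> {x \<in> M. s < x \<and> x \<le> t \<and> gen_of (lab x) = n}"
          using st(3) by auto
        have C: "finite {x \<in> M. s < x \<and> x \<le> t \<and> gen_of (lab x) = n}"
          using fin[of "\<lambda>x. s < x \<and> x \<le> t" n] by (simp only: conj_assoc)
        show ?thesis unfolding net_count_def A
          by (rule sum.union_disjoint[OF fin C]) auto
      qed
      have vs: "word_value N lab (M \<inter> {..t}) = word_value N lab (M \<inter> {..s}) + word_value N lab (M \<inter> {s<..t})"
      proof -
        have "M \<inter> {..t} = M \<inter> {..s} \<union> M \<inter> {s<..t}" using st(3) by auto
        then show ?thesis using word_value_Un[of lab "M \<inter> {..s}" "M \<inter> {s<..t}" N] fl[of "M \<inter> {..s} \<union> M \<inter> {s<..t}"] by auto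
      qed
      \<comment> \<open>Between \<open>s\<close> and \<open>t\<close> nothing happens, or all that happens concerns a single generator.\<close>
      show ?thesis
      proof (cases "\<exists>m<N. \<exists>u\<in>{s..t}. \<gamma> u \<in> far_arc m")
        case False
        have "low_letters N lab (M \<inter> {s<..t}) = {}"
          using M(3) False unfolding low_letters_def by fastforce
        then have "word_value N lab (M \<inter> {s<..t}) = 0" by (simp add: word_value_def)
        moreover have "gen_power_sum N (\<lambda>n. a n u - net_count lab M n u) = 0" if "u \<in> {s..t}" for u
          using off[OF in01[OF that]] False that by (intro gen_power_sum_0) force
        moreover have "transition N (\<gamma> s) (\<gamma> t) = 0"
          unfolding transition_def using False st(3) by (intro gen_power_sum_0) (auto simp: crossing_def)
        ultimately show ?thesis using vs st(3) by (simp add: \<phi>_def)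
      next
        case True
        then obtain m u where m: "m < N" "u \<in> {s..t}" "\<gamma> u \<in> far_arc m" by blast
        have only: "n = m" if "n < N" "v \<in> {s..t}" "\<gamma> v \<in> far_arc n" for n v
          using far_arc_apart[OF m(3) that(3) m(1) that(1) d'(2)[OF in01[OF m(2)] in01[OF that(2)] dist[OF m(2) that(2)]]] by simp
        let ?F = "{x \<in> M. s < x \<and> x \<le> t \<and> gen_of (lab x) = m}"
        have low: "low_letters N lab (M \<inter> {s<..t}) = ?F"
        proof -
          have "gen_of (lab x) < N \<longleftrightarrow> gen_of (lab x) = m" if "x \<in> M" "s < x" "x \<le> t" for x
            using only[of "gen_of (lab x)" x] M(3)[OF that(1)] that m(1) by auto
          then show ?thesis unfolding low_letters_def by auto
        qed
        have "word_value N lab (M \<inter> {s<..t}) = gen_power m (\<Sum>x\<in>?F. letter_sign (lab x))"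
          unfolding word_value_def low using fin[of "\<lambda>x. s < x \<and> x \<le> t" m]
          by (subst fval_zpow) (auto simp: conj_assoc sum_list_distinct_conv_sum_set)
        also have "(\<Sum>x\<in>?F. letter_sign (lab x)) = net_count lab M m t - net_count lab M m s" using nstep[of m] by simp
        finally have v: "word_value N lab (M \<inter> {s<..t}) = gen_power m (net_count lab M m t - net_count lab M m s)" .
        have z: "gen_power_sum N (\<lambda>n. a n v - net_count lab M n v) = gen_power m (a m v - net_count lab M m v)" if "v \<in> {s..t}" for v
          using off[OF in01[OF that]] only[OF _ that] by (intro gen_power_sum_single m(1)) force
        have st': "s \<in> {s..t}" "t \<in> {s..t}" using st(3) by auto
        have g: "transition N (\<gamma> s) (\<gamma> t) = gen_power m (crossing m (\<gamma> s) (\<gamma> t))"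
          unfolding transition_def using only[OF _ st'(1)] by (intro gen_power_sum_single m(1)) (auto simp: crossing_def)
        have "\<phi> t = word_value N lab (M \<inter> {..s}) + gen_power m (net_count lab M m t - net_count lab M m s + (a m t - net_count lab M m t))"
          unfolding \<phi>_def z[OF st'(2)] vs v by (simp only: gen_power_add add.assoc)
        also have "net_count lab M m t - net_count lab M m s + (a m t - net_count lab M m t) = (a m s - net_count lab M m s) + crossing m (\<gamma> s) (\<gamma> t)"
          using astep[OF m(1)] by simp
        finally show ?thesis unfolding \<phi>_def z[OF st'(1)] g by (simp only: gen_power_add add.assoc)
      qed
    qed
    have step_sym: "transition N (\<gamma> t) (\<gamma> s) + transition N (\<gamma> s) (\<gamma> t) = 0" if "s \<in> {0..1}" "t \<in> {0..1}" "dist (\<gamma> s) (\<gamma> t) < arc_radius N / 2" for s t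
    proof -
      have "transition N (\<gamma> t) (\<gamma> s) + transition N (\<gamma> s) (\<gamma> t) = transition N (\<gamma> t) (\<gamma> t)"
        using transition_cocycle_on[of N] \<gamma>(2) that unfolding cocycle_on_def by (simp add: dist_commute image_subset_iff)
      also have "\<dots> = 0" by (simp add: transition_def gen_power_sum_0)
      finally show ?thesis .
    qed
    obtain d'' where d'': "d'' > 0" "\<And>x y. x \<in> {0..1} \<Longrightarrow> y \<in> {0..1} \<Longrightarrow> dist x y < d'' \<Longrightarrow> dist (\<gamma> x) (\<gamma> y) < arc_radius N / 2"
      using path_uniform[OF \<gamma>(1)] arc_radius_pos[of N] unfolding uniformly_continuous_on_def by (metis dist_commute half_gt_zero)
    show ?thesis
      unfolding is_lift_def
    proof (intro exI[of _ "min e d''"] conjI ballI impI)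
      show "0 < min e d''" using e(1) d''(1) by simp
      fix s t :: real assume st: "s \<in> {0..1}" "t \<in> {0..1}" "dist s t < min e d''"
      show "\<phi> t = \<phi> s + transition N (\<gamma> s) (\<gamma> t)"
      proof (cases "s \<le> t")
        case True then show ?thesis using main[OF st(1,2)] st(3) by (simp add: dist_real_def)
      next
        case False
        then have "\<phi> s = \<phi> t + transition N (\<gamma> t) (\<gamma> s)" using main[OF st(2,1)] st(3) by (simp add: dist_real_def)
        then show ?thesis using step_sym[OF st(1,2) d''(2)[OF st(1,2)]] st(3) by (simp add: add.assoc)
      qed
    qed
  qed
  ultimately show ?thesis by (intro exI[of _ \<phi>]) simp
qed

text \<open>For each \<open>n\<close> choose a subdivision that is fine compared to the arc of \<open>n\<close>, and put a letter at the
  right end of each interval whose end points show a passage. There the path is in the arc of \<open>n\<close>,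
  so letters from different subdivisions have different positions.\<close>

lemma path_word_exists:
  fixes \<gamma> :: "real \<Rightarrow> complex"
  assumes \<gamma>: "continuous_on {0..1} \<gamma>" "\<gamma> ` {0..1} \<subseteq> HE"
  shows "\<exists>M lab. M \<subseteq> {0<..1::real} \<and> fin_letters lab M \<and>
    (\<forall>N. \<exists>\<phi>. is_lift (transition N) {0..1} \<gamma> \<phi> \<and> - \<phi> 0 + \<phi> 1 = word_value N lab M)"
proof -
  have "\<forall>n. \<exists>K>0. \<forall>x\<in>{0..1}. \<forall>y\<in>{0..1}. dist x y \<le> 2 / real K \<longrightarrow> dist (\<gamma> x) (\<gamma> y) < arc_radius n / 2"
    using uniform_mesh[OF path_uniform[OF \<gamma>(1)] half_gt_zero[OF arc_radius_pos], where c = 2] by blast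
  then obtain K where K: "\<And>n. K n > 0" "\<And>n x y. x \<in> {0..1} \<Longrightarrow> y \<in> {0..1} \<Longrightarrow> dist x y \<le> 2 / real (K n) \<Longrightarrow> dist (\<gamma> x) (\<gamma> y) < arc_radius n / 2"
    by metis
  define c where "c n i = crossing n (\<gamma> (real i / real (K n))) (\<gamma> (real (Suc i) / real (K n)))" for n i
  define pos where "pos n i = real (Suc i) / real (K n)" for n i
  define V where "V n i \<longleftrightarrow> i < K n \<and> c n i \<noteq> 0" for n i
  define M where "M = {pos n i | n i. V n i}"
  have arcp: "\<gamma> (pos n i) \<in> far_arc n" if "V n i" for n i
    using that crossing_arc unfolding V_def c_def pos_def by blast
  have inj: "n = n' \<and> i = i'" if "V n i" "V n' i'" "pos n i = pos n' i'" for n i n' i'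
  proof -
    have "n = n'" using arcp[OF that(1)] arcp[OF that(2)] that(3) far_arc_disjoint by metis
    then show ?thesis using that(3) K(1)[of n] by (simp add: pos_def)
  qed
  define nn where "nn x = (SOME p. V (fst p) (snd p) \<and> x = pos (fst p) (snd p))" for x
  have nn: "nn (pos n i) = (n, i)" if "V n i" for n i
    unfolding nn_def by (rule some_equality) (use that inj in \<open>auto simp: prod_eq_iff\<close>)
  define lab where "lab x = (if c (fst (nn x)) (snd (nn x)) = 1 then Gen (fst (nn x)) else GenInv (fst (nn x)))" for x
  have lab: "gen_of (lab (pos n i)) = n" "letter_sign (lab (pos n i)) = c n i" if "V n i" for n i
    using crossing_cases[of n "\<gamma> (real i / real (K n))" "\<gamma> (real (Suc i) / real (K n))"] that unfolding lab_def nn[OF that] c_def V_def by auto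
  have Mn: "{x \<in> M. gen_of (lab x) = n} = pos n ` {i. V n i}" for n
    using lab by (auto simp: M_def)
  have finV: "finite {i. V n i}" for n unfolding V_def by simp
  have M01: "M \<subseteq> {0<..1}"
    using K(1) by (auto simp: M_def pos_def V_def divide_le_eq_1_pos simp del: of_nat_Suc)
  have fin: "fin_letters lab M" unfolding fin_letters_def Mn using finV by simp
  define a where "a n = subdivision_lift (K n) (crossing n) \<gamma>" for n
  have net_count: "net_count lab M n t = (\<Sum>i<nat \<lfloor>t * real (K n)\<rfloor>. c n i)" if t: "t \<in> {0..1}" for n t
  proof -
    let ?j = "nat \<lfloor>t * real (K n)\<rfloor>"
    have iff: "pos n i \<le> t \<longleftrightarrow> i < ?j" for i
    proof -
      have "pos n i \<le> t \<longleftrightarrow> real (Suc i) \<le> t * real (K n)" unfolding pos_def using K(1)[of n] by (simp add: field_simps)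
      also have "\<dots> \<longleftrightarrow> int (Suc i) \<le> \<lfloor>t * real (K n)\<rfloor>" by (simp only: le_floor_iff of_int_of_nat_eq)
      also have "\<dots> \<longleftrightarrow> Suc i \<le> ?j" by linarith
      finally show ?thesis by (simp only: Suc_le_eq)
    qed
    have "t * real (K n) \<le> real (K n)" using t by (simp add: mult_left_le_one_le)
    then have jK: "?j \<le> K n" by (simp add: floor_le_iff le_nat_iff nat_le_iff)
    have "{x \<in> M. x \<le> t \<and> gen_of (lab x) = n} = pos n ` {i. V n i \<and> i < ?j}"
      using iff lab by (auto simp: M_def)
    moreover have "inj_on (pos n) {i. V n i \<and> i < ?j}" using inj by (auto simp: inj_on_def)
    ultimately have "net_count lab M n t = (\<Sum>i\<in>{i. V n i \<and> i < ?j}. c n i)"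
      unfolding net_count_def using lab by (simp add: sum.reindex)
    also have "\<dots> = (\<Sum>i<?j. c n i)"
      using jK by (intro sum.mono_neutral_left) (auto simp: V_def)
    finally show ?thesis .
  qed
  have a: "a n t = net_count lab M n t + crossing n (\<gamma> (real (nat \<lfloor>t * real (K n)\<rfloor>) / real (K n))) (\<gamma> t)" if "t \<in> {0..1}" for n t
    unfolding a_def subdivision_lift_def net_count[OF that] c_def by (simp add: interv_sum_list_conv_sum_set_nat atLeast0LessThan)
  have lift: "\<exists>\<phi>. is_lift (transition N) {0..1} \<gamma> \<phi> \<and> - \<phi> 0 + \<phi> 1 = word_value N lab M" for N
  proof (rule word_value_lift[OF \<gamma> M01 fin])
    show "\<gamma> x \<in> far_arc (gen_of (lab x))" if "x \<in> M" for x
      using that arcp lab by (auto simp: M_def)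
    show "is_lift (crossing n) {0..1} \<gamma> (a n)" for n
      unfolding is_lift_def a_def
    proof (intro exI[of _ "1 / real (K n)"] conjI ballI impI)
      show "0 < 1 / real (K n)" using K(1) by simp
      fix x y :: real assume "x \<in> {0..1}" "y \<in> {0..1}" "dist x y < 1 / real (K n)"
      then show "subdivision_lift (K n) (crossing n) \<gamma> y = subdivision_lift (K n) (crossing n) \<gamma> x + crossing n (\<gamma> x) (\<gamma> y)"
        by (rule subdivision_lift_step[OF crossing_cocycle_on K(1) _ K(2), rotated 4]) (use \<gamma>(2) in auto)
    qed
    show "a n 0 = 0" for n unfolding a_def by (rule subdivision_lift_0) simp
    show "a n 1 = net_count lab M n 1" for n using a[of 1 n] K(1)[of n] by simp
    show "\<gamma> t \<in> far_arc n" if "t \<in> {0..1}" "a n t \<noteq> net_count lab M n t" for n t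
      using a[OF that(1), of n] that(2) crossing_arc[of n _ "\<gamma> t"] by auto
  qed
  show ?thesis 
  proof (rule exI[of _ M], rule exI[of _ lab], rule conjI[OF M01 conjI[OF fin]], rule allI)
    fix N show "\<exists>\<phi>. is_lift (transition N) {0..1} \<gamma> \<phi> \<and> - \<phi> 0 + \<phi> 1 = word_value N lab M" by (rule lift)
  qed
qed

section \<open>Values of the loops of words\<close>

lemma circle_loop_half: "circle_loop n (1 / 2) = antipode n"
proof -
  have "exp (2 * of_real pi * \<i> * of_real (1 / 2)) = (-1 :: complex)"
    using exp_pi_i by (simp add: mult.commute)
  then show ?thesis by (simp add: circle_loop_def antipode_def add.commute)
qed

lemma letter_loop_half: "letter_loop x (1 / 2) = antipode (gen_of x)"
  by (cases x) (simp_all add: reversepath_def circle_loop_half)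

lemma Im_circle_loop: "Im (circle_loop n t) = - (sin (2 * pi * t) / real (Suc n))"
proof -
  have "circle_loop n t = of_real (1 / real (Suc n)) * (1 - cis (2 * pi * t))"
    by (simp add: circle_loop_def cis_conv_exp mult_ac)
  also have "Im \<dots> = (1 / real (Suc n)) * Im (1 - cis (2 * pi * t))" by (simp only: times_complex.sel Re_complex_of_real Im_complex_of_real)
  finally show ?thesis by simp
qed

lemma Im_circle_loop_nonneg:
  assumes "0 < t" "t < 1" shows "0 \<le> Im (circle_loop n t) \<longleftrightarrow> 1 / 2 \<le> t"
proof -
  have "0 \<le> Im (circle_loop n t) \<longleftrightarrow> sin (2 * pi * t) \<le> 0"
    unfolding Im_circle_loop by (simp add: divide_le_0_iff)
  also have "\<dots> \<longleftrightarrow> 1 / 2 \<le> t"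
  proof
    assume s: "sin (2 * pi * t) \<le> 0"
    show "1 / 2 \<le> t"
    proof (rule ccontr)
      assume "\<not> 1 / 2 \<le> t"
      then have "2 * pi * t < pi" by (simp add: field_simps)
      then have "0 < sin (2 * pi * t)" using assms by (intro sin_gt_zero) auto
      then show False using s by simp
    qed
  next
    assume "1 / 2 \<le> t"
    then have "pi \<le> 2 * pi * t" "2 * pi * t < 2 * pi" using assms by (simp_all add: field_simps)
    then show "sin (2 * pi * t) \<le> 0" by (rule sin_le_zero)
  qed
  finally show ?thesis .
qed

lemma letter_loop_sphere: "letter_loop x t \<in> sphere (of_real (1 / real (Suc (gen_of x)))) (1 / real (Suc (gen_of x)))"
  by (cases x) (simp_all only: letter_loop.simps gen_of.simps reversepath_def circle_loop_sphere)

text \<open>The loop passes the far point of a circle at the midpoints of its intervals, and these carry a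
  copy of the word.\<close>

lemma word_loop_value:
  assumes U: "countable_word U" "restricted U" and f: "word_loop U f"
  shows "\<exists>M lab. M \<subseteq> {0<..<1::real} \<and> word_eq U (word_on lab M) \<and>
    (\<forall>N. \<exists>\<phi>. is_lift (transition N) {0..1} f \<phi> \<and> - \<phi> 0 + \<phi> 1 = word_value N lab M)"
proof -
  obtain l r where lr: "word_intervals U l r" "loop_on U l r f" using f word_loop_iff by blast
  note fp = word_loop_path[OF U f]
  have b: "0 \<le> l i" "l i < r i" "r i \<le> 1" if "i \<in> idx U" for i
    using lr(1) that by (auto simp: word_intervals_def)
  define m where "m i = (l i + r i) / 2" for i
  have m: "l i < m i" "m i < r i" if "i \<in> idx U" for i using b[OF that] by (auto simp: m_def)
  have ord: "m i < m j" if "prec U i j" for i j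
  proof -
    have "r i \<le> l j" using lr(1) that by (auto simp: word_intervals_def)
    then show ?thesis using m[of i] m[of j] prec_idx[OF that] by auto
  qed
  have iff: "m i \<le> m j \<longleftrightarrow> (i, j) \<in> le U" if "i \<in> idx U" "j \<in> idx U" for i j
    using ord[of i j] ord[of j i] countable_word_total[OF U(1) that] countable_word_refl[OF U(1) that(1)]
    unfolding prec_def by (metis less_imp_le not_less order_refl)
  have inj: "inj_on m (idx U)"
    using iff countable_word_antisym[OF U(1)] by (intro inj_onI) (metis order_refl)
  define M where "M = m ` idx U"
  define lab where "lab x = letter_at U (inv_into (idx U) m x)" for x
  have lab: "lab (m i) = letter_at U i" if "i \<in> idx U" for i
    unfolding lab_def using inj that by simp
  have eq: "word_eq U (word_on lab M)"
    unfolding word_eq_def using inj iff lab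
    by (intro exI[of _ m]) (auto simp: bij_betw_def M_def)
  have M01: "M \<subseteq> {0<..<1}" unfolding M_def using m b by fastforce
  have fin: "fin_letters lab M"
    unfolding fin_letters_restricted by (rule word_eq_restricted[OF eq U(2)])
  let ?g = "\<lambda>i. gen_of (letter_at U i)"
  have finI: "finite {i \<in> idx U. ?g i = n}" for n
    by (rule finite_subset[OF _ restricted_finite_low[OF U(2), of "Suc n"]]) auto
  have fval: "f t = letter_loop (letter_at U i) ((t - l i) / (r i - l i))" if "i \<in> idx U" "l i < t" "t < r i" for i t
    using lr(2) that by (auto simp: loop_on_def)
  have f0: "\<exists>i\<in>idx U. l i < t \<and> t < r i" if "t \<in> {0..1}" "f t \<noteq> 0" for t
    using lr(2) that by (auto simp: loop_on_def)
  have disj: "i = j" if "i \<in> idx U" "j \<in> idx U" "l i < t" "t < r i" "l j < t" "t < r j" for i j t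
    using word_intervals_disjoint[OF U(1) lr(1) that] .
  have fend: "f (l i) = 0" "f (r i) = 0" if i: "i \<in> idx U" for i
  proof -
    have *: "f t = 0" if t: "t = l i \<or> t = r i" for t
    proof (rule ccontr)
      assume "f t \<noteq> 0"
      moreover have "t \<in> {0..1}" using t b[OF i] by auto
      ultimately obtain j where j: "j \<in> idx U" "l j < t" "t < r j" using f0 by blast
      then have "i \<noteq> j" using t by auto
      then have "prec U i j \<or> prec U j i" using countable_word_total[OF U(1) i j(1)] by (auto simp: prec_def)
      then have "r i \<le> l j \<or> r j \<le> l i" using lr(1) by (auto simp: word_intervals_def)
      then show False using t j b[OF i] by auto
    qed
    show "f (l i) = 0" "f (r i) = 0" using * by auto
  qed
  have fm: "f (m i) = antipode (?g i)" if "i \<in> idx U" for i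
  proof -
    have "(m i - l i) / (r i - l i) = 1 / 2" using b[OF that] by (simp add: m_def field_simps)
    then show ?thesis using fval[OF that m[OF that]] letter_loop_half by (simp only:)
  qed
  have Z: "f t \<in> HE" if "t \<in> {0..1}" for t using fp(2) that by auto
  \<comment> \<open>At a midpoint the loop is at a far point, which belongs to the upper half. So a positive
  passage is complete there, but a negative one only afterwards.\<close>
  define pass where "pass i t \<longleftrightarrow> m i < t \<or> m i = t \<and> letter_at U i = Gen (?g i)" for i t
  have side: "0 \<le> Im (f t) \<longleftrightarrow> (if letter_at U i = Gen (?g i) then pass i t else \<not> pass i t)"
    if i: "i \<in> idx U" "l i < t" "t < r i" for i t
  proof -
    let ?x = "(t - l i) / (r i - l i)"
    have x: "0 < ?x" "?x < 1" using frac_01[OF b(2)[OF i(1)]] i by auto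
    have h: "1 / 2 \<le> ?x \<longleftrightarrow> m i \<le> t" "?x \<le> 1 / 2 \<longleftrightarrow> t \<le> m i"
      using b[OF i(1)] by (auto simp: m_def field_simps)
    show ?thesis
    proof (cases "letter_at U i")
      case (Gen n)
      then have "0 \<le> Im (f t) \<longleftrightarrow> m i \<le> t" using fval[OF i] Im_circle_loop_nonneg[OF x] h by simp
      then show ?thesis using Gen by (auto simp: pass_def)
    next
      case (GenInv n)
      have "f t = circle_loop n (1 - ?x)" using fval[OF i] GenInv by (simp add: reversepath_def)
      then have "0 \<le> Im (f t) \<longleftrightarrow> t \<le> m i" using Im_circle_loop_nonneg[of "1 - ?x" n] x h by auto
      then show ?thesis using GenInv by (auto simp: pass_def)
    qed
  qed
  define a where "a n t = (\<Sum>i\<in>{i \<in> idx U. ?g i = n}. if pass i t then letter_sign (letter_at U i) else 0)" for n t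
  have net_count: "net_count lab M n t = (\<Sum>i\<in>{i \<in> idx U. ?g i = n}. if m i \<le> t then letter_sign (letter_at U i) else 0)" for n t
  proof -
    have "{x \<in> M. x \<le> t \<and> gen_of (lab x) = n} = m ` {i \<in> {i \<in> idx U. ?g i = n}. m i \<le> t}"
      using lab by (auto simp: M_def)
    moreover have "inj_on m {i \<in> {i \<in> idx U. ?g i = n}. m i \<le> t}" using inj by (rule inj_on_subset) auto
    ultimately have "net_count lab M n t = (\<Sum>i\<in>{i \<in> {i \<in> idx U. ?g i = n}. m i \<le> t}. letter_sign (letter_at U i))"
      unfolding net_count_def using lab by (simp add: sum.reindex)
    also have "\<dots> = (\<Sum>i\<in>{i \<in> idx U. ?g i = n}. if m i \<le> t then letter_sign (letter_at U i) else 0)"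
      by (rule sum.inter_filter) (rule finI)
    finally show ?thesis .
  qed
  have alift: "is_lift (crossing n) {0..1} f (a n)" for n
  proof -
    obtain d where d: "d > 0" "\<And>x y. x \<in> {0..1} \<Longrightarrow> y \<in> {0..1} \<Longrightarrow> dist x y < d \<Longrightarrow> dist (f x) (f y) < arc_radius n"
      using path_uniform[OF fp(1)] arc_radius_pos[of n] unfolding uniformly_continuous_on_def by (metis dist_commute)
    have far: "f u \<noteq> 0" if "f t \<in> far_arc n" "dist (f u) (f t) < arc_radius n" for u t
    proof
      assume "f u = 0"
      then have "norm (f t) < arc_radius n" using that(2) by simp
      moreover have "norm (antipode n) \<le> norm (f t) + dist (f t) (antipode n)"
        by (metis dist_norm norm_minus_commute norm_triangle_sub)
      ultimately have "2 / (real n + 1) < 2 * arc_radius n" using that(1) by (simp add: far_arc_def norm_anti)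
      moreover have "4 * arc_radius n \<le> 2 / (real n + 1)" using arc_radius_gap[of n] by (smt (verit) divide_nonneg_nonneg of_nat_0_le_iff)
      ultimately show False using arc_radius_pos[of n] by linarith
    qed
    have main: "a n t = a n s + crossing n (f s) (f t)"
      if st: "s \<in> {0..1}" "t \<in> {0..1}" "s \<le> t" "t - s < d" for s t
    proof -
      have dist: "dist (f u) (f v) < arc_radius n" if "u \<in> {s..t}" "v \<in> {s..t}" for u v
        using that st by (intro d(2)) (auto simp: dist_real_def)
      have inside: "l i < s \<and> t < r i" if i: "i \<in> idx U" "u \<in> {s..t}" "l i < u" "u < r i" "\<And>v. v \<in> {s..t} \<Longrightarrow> f v \<noteq> 0" for i u
        using fend[OF i(1)] i(2-4) i(5)[of "l i"] i(5)[of "r i"] by (auto simp: not_less[symmetric])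
      have other: "pass j s \<longleftrightarrow> pass j t" if "i \<in> idx U" "j \<in> idx U" "j \<noteq> i" "l i < s" "t < r i" for i j
      proof -
        have "prec U i j \<or> prec U j i" using countable_word_total[OF U(1) that(1,2)] that(3) by (auto simp: prec_def)
        then have "r i \<le> l j \<or> r j \<le> l i" using lr(1) by (auto simp: word_intervals_def)
        then have "r i < m j \<or> m j < l i" using m[OF that(2)] by auto
        then show ?thesis unfolding pass_def using that(4,5) st(3) by auto
      qed
      show ?thesis
      proof (cases "\<exists>i\<in>idx U. ?g i = n \<and> s \<le> m i \<and> m i \<le> t")
        case True
        then obtain i where i: "i \<in> idx U" "?g i = n" "s \<le> m i" "m i \<le> t" by blast
        have far_arc: "f u \<in> far_arc n" if "u \<in> {s..t}" for u
          using dist[OF that, of "m i"] i fm[OF i(1)] Z that st by (auto simp: far_arc_def)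
        have nz: "f u \<noteq> 0" if "u \<in> {s..t}" for u using far_arc[OF that] far_arc_nonzero by metis
        have ins: "l i < s" "t < r i" using inside[OF i(1), of "m i"] i m[OF i(1)] nz by auto
        have split: "a n u = (if pass i u then letter_sign (letter_at U i) else 0) +
            (\<Sum>j\<in>{j \<in> idx U. ?g j = n} - {i}. if pass j u then letter_sign (letter_at U j) else 0)" for u
          unfolding a_def using i finI by (intro sum.remove) auto
        have rest: "(\<Sum>j\<in>{j \<in> idx U. ?g j = n} - {i}. if pass j s then letter_sign (letter_at U j) else 0) =
            (\<Sum>j\<in>{j \<in> idx U. ?g j = n} - {i}. if pass j t then letter_sign (letter_at U j) else 0)"
          using other[OF i(1) _ _ ins] by (intro sum.cong) auto
        have cr: "crossing n (f s) (f t) = of_bool (0 \<le> Im (f t)) - of_bool (0 \<le> Im (f s))"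
          using far_arc[of s] far_arc[of t] st(3) by (simp add: crossing_def)
        have "(if pass i t then letter_sign (letter_at U i) else 0) = (if pass i s then letter_sign (letter_at U i) else 0) + crossing n (f s) (f t)"
          unfolding cr using side[OF i(1), of s] side[OF i(1), of t] ins st(3)
          by (cases "letter_at U i") auto
        then show ?thesis using split[of s] split[of t] rest by simp
      next
        case False
        then have same: "pass i s \<longleftrightarrow> pass i t" if "i \<in> idx U" "?g i = n" for i
          using that st(3) unfolding pass_def by force
        have "a n t = a n s" unfolding a_def using same by (intro sum.cong) auto
        moreover have "crossing n (f s) (f t) = 0"
        proof (cases "f s \<in> far_arc n \<and> f t \<in> far_arc n")
          case True
          have nz: "f u \<noteq> 0" if "u \<in> {s..t}" for u
            using far[of s u] True dist[OF that, of s] st(3) by auto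
          have "s \<in> {s..t}" using st(3) by simp
          then obtain i where i: "i \<in> idx U" "l i < s" "s < r i" using f0[OF st(1)] nz by blast
          then have ins: "t < r i" using inside[OF i(1), of s] nz st(3) by auto
          have "?g i = n"
            using far_arc_only[of "f s" "?g i" n] letter_loop_sphere[of "letter_at U i"] fval[OF i] True by (simp add: far_arc_def)
          then have "pass i s \<longleftrightarrow> pass i t" using same i(1) by blast
          then have "0 \<le> Im (f s) \<longleftrightarrow> 0 \<le> Im (f t)" using side[OF i(1), of s] side[OF i(1), of t] i ins st(3) by auto
          then show ?thesis by (simp add: crossing_def)
        qed (auto simp: crossing_def)
        ultimately show ?thesis by simp
      qed
    qed
    show ?thesis
      unfolding is_lift_def
    proof (intro exI[of _ d] conjI ballI impI)
      fix s t :: real assume st: "s \<in> {0..1}" "t \<in> {0..1}" "dist s t < d"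
      show "a n t = a n s + crossing n (f s) (f t)"
      proof (cases "s \<le> t")
        case True then show ?thesis using main[OF st(1,2)] st(3) by (simp add: dist_real_def)
      next
        case False then show ?thesis using main[OF st(2,1)] st(3) crossing_antisym[of n "f t" "f s"] by (simp add: dist_real_def)
      qed
    qed (rule d(1))
  qed
  have lift: "\<exists>\<phi>. is_lift (transition N) {0..1} f \<phi> \<and> - \<phi> 0 + \<phi> 1 = word_value N lab M" for N
  proof (rule word_value_lift[OF fp(1,2) _ fin _ alift])
    show "M \<subseteq> {0<..1}" using M01 by auto
    show "f x \<in> far_arc (gen_of (lab x))" if x: "x \<in> M" for x
    proof -
      obtain i where i: "i \<in> idx U" "x = m i" using x by (auto simp: M_def)
      have "f x \<in> HE" using x M01 by (intro Z) auto
      then show ?thesis using fm[OF i(1)] lab[OF i(1)] i(2) by (simp add: far_arc_def)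
    qed
    show "a n 0 = 0" for n
      unfolding a_def using m b by (intro sum.neutral) (force simp: pass_def)
    show "a n 1 = net_count lab M n 1" for n
      unfolding a_def net_count using m b by (intro sum.cong) (force simp: pass_def)+
    show "f t \<in> far_arc n" if "t \<in> {0..1}" "a n t \<noteq> net_count lab M n t" for n t
    proof -
      obtain i where i: "i \<in> idx U" "?g i = n" "pass i t \<noteq> (m i \<le> t)"
      proof (rule ccontr)
        assume "\<not> thesis"
        then have "a n t = net_count lab M n t" unfolding a_def net_count using that by (intro sum.cong) auto
        then show False using \<open>a n t \<noteq> net_count lab M n t\<close> by simp
      qed
      then have "t = m i" by (auto simp: pass_def)
      then show ?thesis using fm[OF i(1)] i(2) Z[OF \<open>t \<in> {0..1}\<close>] by (simp add: far_arc_def)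
    qed
  qed
  show ?thesis 
  proof (rule exI[of _ M], rule exI[of _ lab], rule conjI[OF M01 conjI[OF eq]], rule allI)
    fix N show "\<exists>\<phi>. is_lift (transition N) {0..1} f \<phi> \<and> - \<phi> 0 + \<phi> 1 = word_value N lab M" by (rule lift)
  qed
qed

section \<open>Values of singular simplices\<close>

definition edge_point :: "real \<Rightarrow> nat \<Rightarrow> real" where
  "edge_point t = (\<lambda>i. if i = 0 then 1 - t else if i = 1 then t else 0)"

definition simplex_path :: "((nat \<Rightarrow> real) \<Rightarrow> complex) \<Rightarrow> real \<Rightarrow> complex" where
  "simplex_path e t = e (edge_point t)"

lemma edge_in: "t \<in> {0..1} \<Longrightarrow> edge_point t \<in> standard_simplex (Suc 0)"
  by (auto simp: edge_point_def standard_simplex_def)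

lemma continuous_edge: "continuous_on X edge_point"
proof (rule continuous_on_coordinatewise_then_product)
  show "continuous_on X (\<lambda>t. edge_point t i)" for i
    by (cases "i = 0"; cases "i = 1") (auto simp: edge_point_def intro!: continuous_intros)
qed

lemma simplex_path_path:
  assumes "singular_simplex (Suc 0) (top_of_set HE) e"
  shows "continuous_on {0..1} (simplex_path e)" "simplex_path e ` {0..1} \<subseteq> HE"
proof -
  have e: "continuous_on (standard_simplex (Suc 0)) e" "e ` standard_simplex (Suc 0) \<subseteq> HE"
    using assms unfolding singular_simplex_euclidean by auto
  show "continuous_on {0..1} (simplex_path e)"
    unfolding simplex_path_def by (rule continuous_on_compose2[OF e(1) continuous_edge]) (use edge_in in auto)
  show "simplex_path e ` {0..1} \<subseteq> HE" unfolding simplex_path_def using e(2) edge_in by auto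
qed

lemma simplex_path_sim: "t \<in> {0..1} \<Longrightarrow> simplex_path (loop_simplex f) t = f t"
  unfolding simplex_path_def loop_simplex_def using edge_in[of t] by (simp add: edge_point_def)

text \<open>By \<open>lift_unique\<close> the value does not depend on the lift.\<close>

definition path_value :: "nat \<Rightarrow> (real \<Rightarrow> complex) \<Rightarrow> nat fgrp" where
  "path_value N \<gamma> = (SOME v. \<exists>\<phi>. is_lift (transition N) {0..1} \<gamma> \<phi> \<and> v = - \<phi> 0 + \<phi> 1)"

lemma path_value_eq: "is_lift (transition N) {0..1} \<gamma> \<phi> \<Longrightarrow> path_value N \<gamma> = - \<phi> 0 + \<phi> 1"
  unfolding path_value_def by (rule some_equality) (use lift_unique in blast)+

lemma path_value_cong: "(\<And>t. t \<in> {0..1} \<Longrightarrow> \<gamma> t = \<gamma>' t) \<Longrightarrow> path_value N \<gamma> = path_value N \<gamma>'"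
proof -
  assume a: "\<And>t. t \<in> {0..1} \<Longrightarrow> \<gamma> t = \<gamma>' t"
  have "is_lift (transition N) {0..1} \<gamma> = is_lift (transition N) {0..1} \<gamma>'"
    using lift_cong[of "transition N" "{0..1}" \<gamma> _ \<gamma>'] lift_cong[of "transition N" "{0..1}" \<gamma>' _ \<gamma>] a by fastforce
  then show ?thesis unfolding path_value_def by simp
qed

text \<open>The map \<open>bary\<close> from the square onto the triangle collapses one side to the first vertex and takes the
  other three to the sides of the triangle. A lift on the square restricts to lifts on all of these.\<close>

lemma path_value_triangle:
  assumes "singular_simplex 2 (top_of_set HE) s"
  shows "path_value N (simplex_path (singular_face 2 2 s)) + path_value N (simplex_path (singular_face 2 0 s)) = path_value N (simplex_path (singular_face 2 (Suc 0) s))"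
proof -
  have s: "continuous_on (standard_simplex 2) s" "s ` standard_simplex 2 \<subseteq> HE"
    using assms unfolding singular_simplex_euclidean by auto
  define bary :: "real \<times> real \<Rightarrow> nat \<Rightarrow> real" where
    "bary p = (\<lambda>i. if i = 0 then 1 - fst p else if i = 1 then fst p * (1 - snd p) else if i = 2 then fst p * snd p else 0)" for p
  let ?Q = "{0..1} \<times> {0..1} :: (real \<times> real) set"
  have bin: "bary p \<in> standard_simplex 2" if "p \<in> ?Q" for p
  proof -
    obtain x y where p: "p = (x, y)" "0 \<le> x" "x \<le> 1" "0 \<le> y" "y \<le> 1" using \<open>p \<in> ?Q\<close> by (cases p) auto
    have "x * y \<le> 1" "x * (1 - y) \<le> 1" using p by (auto intro: mult_le_one)
    moreover have "(\<Sum>i\<le>2. bary p i) = 1" by (simp add: numeral_2_eq_2 bary_def p algebra_simps)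
    ultimately show ?thesis using p by (auto simp: standard_simplex_def bary_def)
  qed
  have cb: "continuous_on ?Q bary"
  proof (rule continuous_on_coordinatewise_then_product)
    show "continuous_on ?Q (\<lambda>p. bary p i)" for i
      by (cases "i = 0"; cases "i = 1"; cases "i = 2") (auto simp: bary_def intro!: continuous_intros)
  qed
  define S where "S = s \<circ> bary"
  have cS: "continuous_on ?Q S"
    unfolding S_def by (rule continuous_on_compose[OF cb continuous_on_subset[OF s(1)]]) (use bin in auto)
  have iS: "S ` ?Q \<subseteq> HE" unfolding S_def using bin s(2) by auto
  obtain \<Phi> where \<Phi>: "is_lift (transition N) ?Q S \<Phi>"
    using square_lift[OF transition_cocycle_on _ cS iS] arc_radius_pos[of N] by auto
  have edge_point: "path_value N \<gamma> = - \<Phi> (h 0) + \<Phi> (h 1)"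
    if h: "continuous_on {0..1} h" "h ` {0..1} \<subseteq> ?Q" "\<And>t. t \<in> {0..1} \<Longrightarrow> S (h t) = \<gamma> t" for \<gamma> h
  proof -
    have "is_lift (transition N) {0..1} (S \<circ> h) (\<Phi> \<circ> h)"
      by (rule lift_compose[OF \<Phi> compact_uniformly_continuous[OF h(1)] h(2)]) auto
    then have "is_lift (transition N) {0..1} \<gamma> (\<Phi> \<circ> h)" by (rule lift_cong) (use h(3) in auto)
    from path_value_eq[OF this] show ?thesis by simp
  qed
  have sf: "simplex_path (singular_face 2 k s) t = s (simplical_face k (edge_point t))" if "t \<in> {0..1}" for k t
    unfolding simplex_path_def singular_face_def using edge_in[OF that] by simp
  have f2: "bary (t, 0) = simplical_face 2 (edge_point t)" for t
    by (auto simp: bary_def simplical_face_def edge_point_def fun_eq_iff)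
  have f0: "bary (1, t) = simplical_face 0 (edge_point t)" for t
    by (auto simp: bary_def simplical_face_def edge_point_def fun_eq_iff)
  have f1: "bary (t, 1) = simplical_face (Suc 0) (edge_point t)" for t
    by (auto simp: bary_def simplical_face_def edge_point_def fun_eq_iff)
  have fc: "S (0, t) = S (0, 0)" for t
  proof -
    have "bary (0, t) = bary (0, 0)" unfolding bary_def by (rule ext) simp
    then show ?thesis by (simp only: S_def comp_apply)
  qed
  have 2: "path_value N (simplex_path (singular_face 2 2 s)) = - \<Phi> (0, 0) + \<Phi> (1, 0)"
    by (rule edge_point[of "\<lambda>t. (t, 0)"]) (auto simp: S_def f2 sf intro!: continuous_intros)
  have 0: "path_value N (simplex_path (singular_face 2 0 s)) = - \<Phi> (1, 0) + \<Phi> (1, 1)"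
    by (rule edge_point[of "\<lambda>t. (1, t)"]) (auto simp: S_def f0 sf intro!: continuous_intros)
  have 1: "path_value N (simplex_path (singular_face 2 (Suc 0) s)) = - \<Phi> (0, 1) + \<Phi> (1, 1)"
    by (rule edge_point[of "\<lambda>t. (t, 1)"]) (auto simp: S_def f1 sf intro!: continuous_intros)
  have c: "path_value N (\<lambda>t. S (0, 0)) = - \<Phi> (0, 0) + \<Phi> (0, 1)"
    by (rule edge_point[of "\<lambda>t. (0, t)"]) (use fc in \<open>auto intro!: continuous_intros\<close>)
  have "transition N z z = 0" for z by (simp add: transition_def gen_power_sum_0)
  then have "is_lift (transition N) {0..1} (\<lambda>t. S (0, 0)) (\<lambda>t::real. 0)"
    unfolding is_lift_def by (intro exI[of _ 1]) auto
  from path_value_eq[OF this] c have "\<Phi> (0, 0) = \<Phi> (0, 1)" by (simp add: add_eq_0_iff)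
  then show ?thesis unfolding 2 0 1 by (simp add: add.assoc[symmetric])
qed

text \<open>Positions are halved since the open unit interval is needed when words are placed next to each
  other.\<close>

lemma simplex_word_exists:
  assumes "singular_simplex (Suc 0) (top_of_set HE) e"
  shows "\<exists>M lab. M \<subseteq> {0<..<1::real} \<and> fin_letters lab M \<and> irreducible_on lab M \<and> (\<forall>N. word_value N lab M = path_value N (simplex_path e))"
proof -
  obtain M lab where M: "M \<subseteq> {0<..1::real}" "fin_letters lab M"
    "\<And>N. \<exists>\<phi>. is_lift (transition N) {0..1} (simplex_path e) \<phi> \<and> - \<phi> 0 + \<phi> 1 = word_value N lab M"
    using path_word_exists[OF simplex_path_path[OF assms]] by blast
  have v: "word_value N lab M = path_value N (simplex_path e)" for N using M(3)[of N] path_value_eq by metis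
  let ?f = "\<lambda>x::real. x / 2" and ?lab = "\<lambda>x. lab (2 * x)"
  have i: "word_value N ?lab (?f ` M) = word_value N lab M" "fin_letters ?lab (?f ` M)" for N
    by (rule word_value_image[OF M(2)]; simp)+
  obtain M' where M': "M' \<subseteq> ?f ` M" "irreducible_on ?lab M'" "\<And>N. word_value N ?lab M' = word_value N ?lab (?f ` M)"
    using irreducible_on_exists[OF i(2)] by blast
  have "M' \<subseteq> {0<..<1}" using M'(1) M(1) by fastforce
  then show ?thesis using M' fin_letters_subset[OF i(2) M'(1)] i(1) v by (intro exI[of _ M'] exI[of _ ?lab]) simp
qed

section \<open>Boundaries as signed lists of paths\<close>

type_synonym ssimplex = "(nat \<Rightarrow> real) \<Rightarrow> complex"

definition signed_frag :: "bool \<times> ssimplex \<Rightarrow> complex chain" where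
  "signed_frag p = (if fst p then frag_of (snd p) else - frag_of (snd p))"

definition signed_val :: "nat \<Rightarrow> bool \<times> ssimplex \<Rightarrow> nat fgrp" where
  "signed_val N p = (if fst p then path_value N (simplex_path (snd p)) else - path_value N (simplex_path (snd p)))"

definition flip :: "bool \<times> 's \<Rightarrow> bool \<times> 's" where "flip p = (\<not> fst p, snd p)"

lemma signed_flip: "signed_frag (flip p) = - signed_frag p" "signed_val N (flip p) = - signed_val N p"
  by (auto simp: signed_frag_def signed_val_def flip_def)

lemma sum_list_rev_flip: "sum_list (map (signed_val N) (rev (map flip L))) = - sum_list (map (signed_val N) L)"
  by (induction L) (auto simp: signed_flip minus_add)

lemma sum_list_frag_flip: "sum_list (map signed_frag (rev (map flip L))) = - sum_list (map signed_frag L)"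
  by (induction L) (auto simp: signed_flip)

text \<open>In the homology group the order of the sides of triangles is immaterial. It is kept here because the
  values are in noncommutative groups, where only the product of the sides of a
  triangle in their cyclic order is trivial.\<close>

lemma boundary_list:
  assumes "singular_chain 2 (top_of_set HE) d"
  shows "\<exists>L. (\<forall>p\<in>set L. singular_simplex (Suc 0) (top_of_set HE) (snd p)) \<and>
    sum_list (map signed_frag L) = chain_boundary 2 d \<and> (\<forall>N. sum_list (map (signed_val N) L) = 0)"
  using assms unfolding singular_chain_def
proof (induction d rule: frag_induction)
  case zero
  show ?case by (intro exI[of _ "[]"]) simp
next
  case (one s)
  then have s: "singular_simplex 2 (top_of_set HE) s" by simp
  have f: "singular_simplex (Suc 0) (top_of_set HE) (singular_face 2 k s)" if "k \<le> 2" for k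
    using singular_simplex_singular_face[OF s, of k] that by (simp add: numeral_2_eq_2)
  show ?case
  proof (intro exI[of _ "[(True, singular_face 2 2 s), (True, singular_face 2 0 s), (False, singular_face 2 (Suc 0) s)]"] conjI allI)
    show "\<forall>p\<in>set [(True, singular_face 2 2 s), (True, singular_face 2 0 s), (False, singular_face 2 (Suc 0) s)].
        singular_simplex (Suc 0) (top_of_set HE) (snd p)"
      using f by simp
    show "sum_list (map signed_frag [(True, singular_face 2 2 s), (True, singular_face 2 0 s), (False, singular_face 2 (Suc 0) s)]) =
        chain_boundary 2 (frag_of s)"
      using chain_boundary_2[of s] by (simp add: signed_frag_def)
    show "sum_list (map (signed_val N) [(True, singular_face 2 2 s), (True, singular_face 2 0 s), (False, singular_face 2 (Suc 0) s)]) = 0" for N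
      using path_value_triangle[OF s, of N] by (simp add: signed_val_def add_diff_eq)
  qed
next
  case (diff a b)
  then obtain La Lb where L: "\<forall>p\<in>set La. singular_simplex (Suc 0) (top_of_set HE) (snd p)"
      "sum_list (map signed_frag La) = chain_boundary 2 a" "\<forall>N. sum_list (map (signed_val N) La) = 0"
      "\<forall>p\<in>set Lb. singular_simplex (Suc 0) (top_of_set HE) (snd p)"
      "sum_list (map signed_frag Lb) = chain_boundary 2 b" "\<forall>N. sum_list (map (signed_val N) Lb) = 0"
    by blast
  show ?case
  proof (intro exI[of _ "La @ rev (map flip Lb)"] conjI allI)
    show "\<forall>p\<in>set (La @ rev (map flip Lb)). singular_simplex (Suc 0) (top_of_set HE) (snd p)"
      using L(1,4) by (auto simp: flip_def)
    show "sum_list (map signed_frag (La @ rev (map flip Lb))) = chain_boundary 2 (a - b)"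
      unfolding map_append sum_list_append sum_list_frag_flip using L(2,5) by (simp add: chain_boundary_diff)
    show "sum_list (map (signed_val N) (La @ rev (map flip Lb))) = 0" for N
      unfolding map_append sum_list_append sum_list_rev_flip using L(3,6) by simp
  qed
qed

lemma lookup_signed:
  "Poly_Mapping.lookup (sum_list (map signed_frag L)) e = int (count_list L (True, e)) - int (count_list L (False, e))"
proof (induction L)
  case (Cons p L)
  obtain b e' where p: "p = (b, e')" by (cases p)
  have "Poly_Mapping.lookup (signed_frag p) e = (if p = (True, e) then 1 else if p = (False, e) then -1 else 0)"
    by (auto simp: p signed_frag_def Poly_Mapping.lookup_single lookup_uminus when_def)
  then show ?case using Cons by (simp add: lookup_add)
qed simp

text \<open>If the sum vanishes, every simplex occurs equally often with either sign.\<close>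

lemma signed_matching:
  assumes "sum_list (map signed_frag L) = 0"
  shows "\<exists>q. \<forall>i<length L. q i < length L \<and> q (q i) = i \<and> L ! (q i) = flip (L ! i)"
proof -
  define S where "S b e = {i. i < length L \<and> L ! i = (b, e)}" for b e
  have "card (S True e) = card (S False e)" for e
  proof -
    have "card (S b e) = count_list L (b, e)" for b
      unfolding S_def count_list_eq_length_filter length_filter_conv_card
      by (rule arg_cong[of _ _ card]) auto
    moreover have "int (count_list L (True, e)) - int (count_list L (False, e)) = 0"
      using lookup_signed[of L e] assms by simp
    ultimately show ?thesis by simp
  qed
  moreover have "finite (S b e)" for b e unfolding S_def by simp
  ultimately have "\<forall>e. \<exists>\<beta>. bij_betw \<beta> (S True e) (S False e)" by (simp add: finite_same_card_bij)
  then obtain \<beta> where \<beta>: "\<And>e. bij_betw (\<beta> e) (S True e) (S False e)" by metis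
  define q where "q i = (let e = snd (L ! i) in if fst (L ! i) then \<beta> e i else inv_into (S True e) (\<beta> e) i)" for i
  have "q i < length L \<and> q (q i) = i \<and> L ! (q i) = flip (L ! i)" if i: "i < length L" for i
  proof (cases "fst (L ! i)")
    case True
    define e where "e = snd (L ! i)"
    have iS: "i \<in> S True e" using True i by (auto simp: S_def e_def prod_eq_iff)
    then have q: "q i = \<beta> e i" "\<beta> e i \<in> S False e" using \<beta>[of e] True unfolding q_def e_def by (auto simp: bij_betw_def)
    then have "L ! (q i) = (False, e)" "q i < length L" by (auto simp: S_def)
    moreover from this have "q (q i) = inv_into (S True e) (\<beta> e) (\<beta> e i)" using q(1) unfolding q_def[of "q i"] by simp
    moreover have "\<dots> = i" using \<beta>[of e] iS by (simp add: bij_betw_def)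
    ultimately show ?thesis using True by (simp add: flip_def e_def)
  next
    case False
    define e where "e = snd (L ! i)"
    have iS: "i \<in> S False e" using False i by (auto simp: S_def e_def prod_eq_iff)
    have q: "q i = inv_into (S True e) (\<beta> e) i" using False unfolding q_def e_def by (simp add: Let_def)
    have qS: "q i \<in> S True e" "\<beta> e (q i) = i"
      using \<beta>[of e] iS unfolding q by (auto simp: bij_betw_def inv_into_into f_inv_into_f)
    then have "L ! (q i) = (True, e)" "q i < length L" by (auto simp: S_def)
    moreover from this have "q (q i) = \<beta> e (q i)" unfolding q_def[of "q i"] by simp
    ultimately show ?thesis using False qS(2) by (simp add: flip_def e_def)
  qed
  then show ?thesis by blast
qed

section \<open>Words placed on the real line\<close>

type_synonym rslot = "real set \<times> (real \<Rightarrow> nat letter)"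

definition mirror :: "rslot \<Rightarrow> rslot" where
  "mirror w = ((\<lambda>x. 1 - x) ` fst w, \<lambda>x. inv_letter (snd w (1 - x)))"

definition good_slot :: "rslot \<Rightarrow> bool" where
  "good_slot w \<longleftrightarrow> fst w \<subseteq> {0<..<1} \<and> fin_letters (snd w) (fst w) \<and> irreducible_on (snd w) (fst w)"

definition slot_val :: "nat \<Rightarrow> rslot \<Rightarrow> nat fgrp" where "slot_val N w = word_value N (snd w) (fst w)"

lemma mirror_mirror [simp]: "mirror (mirror w) = w"
  by (cases w) (simp add: mirror_def image_image)

lemma slot_val_mirror:
  assumes "fin_letters (snd w) (fst w)"
  shows "slot_val N (mirror w) = - slot_val N w" "fin_letters (snd (mirror w)) (fst (mirror w))"
  using word_value_image_anti[OF assms, of "\<lambda>x. 1 - x" "\<lambda>x. inv_letter (snd w (1 - x))"]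
  by (auto simp: slot_val_def mirror_def)

lemma good_mirror:
  assumes "good_slot w" shows "good_slot (mirror w)"
proof -
  have w: "fst w \<subseteq> {0<..<1}" "fin_letters (snd w) (fst w)" "irreducible_on (snd w) (fst w)"
    using assms by (auto simp: good_slot_def)
  have "irreducible_on (snd (mirror w)) (fst (mirror w))"
    unfolding irreducible_on_def
  proof (intro ballI impI)
    fix i j assume ij: "i \<in> fst (mirror w)" "j \<in> fst (mirror w)" "i \<le> j"
    then have m: "1 - j \<in> fst w" "1 - i \<in> fst w" by (auto simp: mirror_def)
    have "1 - j \<le> 1 - i" using ij(3) by simp
    with w(3) m obtain N where N: "word_value N (snd w) (fst w \<inter> {1 - j..1 - i}) \<noteq> 0" unfolding irreducible_on_def by blast
    have e: "fst (mirror w) \<inter> {i..j} = (\<lambda>x. 1 - x) ` (fst w \<inter> {1 - j..1 - i})"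
      by (auto simp: mirror_def image_iff) (metis diff_diff_eq2 add_diff_cancel_left' diff_add_cancel)?
    have "word_value N (snd (mirror w)) (fst (mirror w) \<inter> {i..j}) = - word_value N (snd w) (fst w \<inter> {1 - j..1 - i})"
      unfolding e by (rule word_value_image_anti) (auto simp: mirror_def intro: fin_letters_subset[OF w(2)])
    then show "\<exists>N. word_value N (snd (mirror w)) (fst (mirror w) \<inter> {i..j}) \<noteq> 0" using N by (intro exI[of _ N]) simp
  qed
  then show ?thesis using w(1) slot_val_mirror(2)[OF w(2)] unfolding good_slot_def by (auto simp: mirror_def)
qed

definition slot_of :: "real \<Rightarrow> nat" where "slot_of y = nat \<lfloor>y\<rfloor>"

text \<open>Words on the open unit interval are put into consecutive intervals between integers, so the
  slot of a position is its integral part.\<close>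

definition place :: "nat \<Rightarrow> rslot \<Rightarrow> real set" where "place k w = (\<lambda>x. real k + x) ` fst w"

definition line :: "rslot list \<Rightarrow> real set" where "line D = (\<Union>k<length D. place k (D ! k))"

definition line_lab :: "rslot list \<Rightarrow> real \<Rightarrow> nat letter" where
  "line_lab D y = snd (D ! slot_of y) (y - real (slot_of y))"

lemma slot_of_place:
  assumes "good_slot w" "y \<in> place k w" shows "slot_of y = k" "real k < y" "y < real k + 1" "y - real k \<in> fst w"
proof -
  obtain x where x: "x \<in> fst w" "y = real k + x" using assms(2) by (auto simp: place_def)
  then have "0 < x" "x < 1" using assms(1) by (auto simp: good_slot_def)
  then show "real k < y" "y < real k + 1" "y - real k \<in> fst w" using x by auto
  then have "\<lfloor>y\<rfloor> = int k" by (intro floor_unique) auto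
  then show "slot_of y = k" by (simp add: slot_of_def)
qed

lemma slot_of_mono: "x \<le> y \<Longrightarrow> slot_of x \<le> slot_of y"
  unfolding slot_of_def by (intro nat_mono floor_mono)

locale slots =
  fixes D :: "rslot list"
  assumes good: "w \<in> set D \<Longrightarrow> good_slot w"
begin

lemma lineD:
  assumes "y \<in> line D"
  shows "slot_of y < length D" "y \<in> place (slot_of y) (D ! slot_of y)" "y - real (slot_of y) \<in> fst (D ! slot_of y)"
proof -
  obtain k where k: "k < length D" "y \<in> place k (D ! k)" using assms by (auto simp: line_def)
  have g: "good_slot (D ! k)" using good k(1) by simp
  have "slot_of y = k" by (rule slot_of_place(1)[OF g k(2)])
  then show "slot_of y < length D" "y \<in> place (slot_of y) (D ! slot_of y)" "y - real (slot_of y) \<in> fst (D ! slot_of y)"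
    using k slot_of_place(4)[OF g k(2)] by auto
qed

lemma lineI:
  assumes "k < length D" "x \<in> fst (D ! k)"
  shows "real k + x \<in> line D" "slot_of (real k + x) = k" "line_lab D (real k + x) = snd (D ! k) x"
proof -
  have p: "real k + x \<in> place k (D ! k)" using assms by (auto simp: place_def)
  then show "real k + x \<in> line D" using assms by (auto simp: line_def)
  show "slot_of (real k + x) = k" using slot_of_place(1)[OF good p] assms by auto
  then show "line_lab D (real k + x) = snd (D ! k) x" by (simp add: line_lab_def)
qed

lemma place_val:
  assumes "k < length D" "A \<subseteq> fst (D ! k)"
  shows "word_value N (line_lab D) ((\<lambda>x. real k + x) ` A) = word_value N (snd (D ! k)) A"
    "fin_letters (line_lab D) ((\<lambda>x. real k + x) ` A)"
proof -
  have f: "fin_letters (snd (D ! k)) A"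
    using good[of "D ! k"] assms fin_letters_subset by (auto simp: good_slot_def)
  have l: "line_lab D (real k + x) = snd (D ! k) x" if "x \<in> A" for x
    using lineI(3)[OF assms(1)] assms(2) that by blast
  show "word_value N (line_lab D) ((\<lambda>x. real k + x) ` A) = word_value N (snd (D ! k)) A"
    "fin_letters (line_lab D) ((\<lambda>x. real k + x) ` A)"
    using word_value_image[OF f, of "\<lambda>x. real k + x" "line_lab D"] l by auto
qed

lemma line_prefix:
  assumes "n \<le> length D"
  shows "fin_letters (line_lab D) (\<Union>k<n. place k (D ! k)) \<and>
    word_value N (line_lab D) (\<Union>k<n. place k (D ! k)) = sum_list (map (slot_val N) (take n D))"
  using assms
proof (induction n)
  case 0
  show ?case by (simp add: fin_letters_def)
next
  case (Suc n)
  let ?A = "\<Union>k<n. place k (D ! k)" and ?B = "place n (D ! n)"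
  have e: "(\<Union>k<Suc n. place k (D ! k)) = ?A \<union> ?B" by (auto simp: less_Suc_eq)
  have fB: "fin_letters (line_lab D) ?B" "word_value N (line_lab D) ?B = slot_val N (D ! n)"
    using place_val[of n "fst (D ! n)"] Suc.prems by (auto simp: place_def slot_val_def)
  have fA: "fin_letters (line_lab D) ?A" "word_value N (line_lab D) ?A = sum_list (map (slot_val N) (take n D))"
    using Suc by auto
  have f: "fin_letters (line_lab D) (?A \<union> ?B)"
    unfolding fin_letters_def
  proof
    fix m
    have "{x \<in> ?A \<union> ?B. gen_of (line_lab D x) = m} = {x \<in> ?A. gen_of (line_lab D x) = m} \<union> {x \<in> ?B. gen_of (line_lab D x) = m}"
      by auto
    then show "finite {x \<in> ?A \<union> ?B. gen_of (line_lab D x) = m}" using fA(1) fB(1) unfolding fin_letters_def by simp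
  qed
  have "x < y" if x: "x \<in> ?A" and y: "y \<in> ?B" for x y
  proof -
    obtain k where k: "k < n" "x \<in> place k (D ! k)" using x by blast
    have "x < real k + 1" using slot_of_place(3)[OF good k(2)] k(1) Suc.prems by auto
    moreover have "real n < y" using slot_of_place(2)[OF good y] Suc.prems by auto
    ultimately show ?thesis using k(1) by linarith
  qed
  then have "word_value N (line_lab D) (?A \<union> ?B) = word_value N (line_lab D) ?A + word_value N (line_lab D) ?B"
    by (intro word_value_Un f)
  then show ?case unfolding e using f fA(2) fB(2) Suc.prems by (simp add: take_Suc_conv_app_nth)
qed

lemma line_fin: "fin_letters (line_lab D) (line D)"
  and line_val: "word_value N (line_lab D) (line D) = sum_list (map (slot_val N) D)"
  using line_prefix[of "length D" N] by (simp_all add: line_def)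

text \<open>The positions between two partners are paired among themselves and thus form a block of trivial
  values, which an irreducible word does not have.\<close>

lemma no_pair_in_slot:
  assumes P: "nc_pairing (line_lab D) (line D) P" and x: "x \<in> line D"
  shows "slot_of (P x) \<noteq> slot_of x"
proof
  assume eq: "slot_of (P x) = slot_of x"
  have main: False if x: "x \<in> line D" "x < P x" "slot_of (P x) = slot_of x" for x
  proof -
    define k where "k = slot_of x"
    have Px: "P x \<in> line D" using nc_pairingD(1)[OF P x(1)] .
    have k: "k < length D" "x - real k \<in> fst (D ! k)" "P x - real k \<in> fst (D ! k)"
      using lineD[OF x(1)] lineD[OF Px] x(3) by (auto simp: k_def)
    let ?B = "line D \<inter> {x..P x}"
    have B: "?B = (\<lambda>x. real k + x) ` (fst (D ! k) \<inter> {x - real k..P x - real k})"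
    proof
      show "?B \<subseteq> (\<lambda>x. real k + x) ` (fst (D ! k) \<inter> {x - real k..P x - real k})"
      proof
        fix y assume y: "y \<in> ?B"
        then have "slot_of y = k" using slot_of_mono[of x y] slot_of_mono[of y "P x"] x(3) by (simp add: k_def)
        then have "y - real k \<in> fst (D ! k)" using lineD(3)[of y] y by auto
        then show "y \<in> (\<lambda>x. real k + x) ` (fst (D ! k) \<inter> {x - real k..P x - real k})"
          using y by (intro image_eqI[of _ _ "y - real k"]) auto
      qed
    qed (use lineI(1)[OF k(1)] in auto)
    have nB: "nc_pairing (line_lab D) ?B P"
    proof (rule nc_pairing_restrict[OF P])
      fix y assume y: "y \<in> ?B"
      consider "y = x" | "y = P x" | "x < y" "y < P x" using y by force
      then show "P y \<in> ?B"
      proof cases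
        case 3
        then show ?thesis using nc_pairing_inside[OF P x(1) _ 3] nc_pairingD(1)[OF P] y by auto
      qed (use x Px nc_pairingD(2)[OF P x(1)] in auto)
    qed auto
    have "word_value N (line_lab D) ?B = 0" for N by (rule nc_pairing_val[OF fin_letters_subset[OF line_fin] nB]) auto
    then have "word_value N (snd (D ! k)) (fst (D ! k) \<inter> {x - real k..P x - real k}) = 0" for N
      unfolding B using place_val(1)[OF k(1), of "fst (D ! k) \<inter> {x - real k..P x - real k}" N] by simp
    moreover have "irreducible_on (snd (D ! k)) (fst (D ! k))" using good[of "D ! k"] k(1) by (auto simp: good_slot_def)
    ultimately show False using k(2,3) x(2) unfolding irreducible_on_def by fastforce
  qed
  note D = nc_pairingD[OF P x]
  show False
  proof (cases "x < P x")
    case True then show ?thesis using main[OF x True eq] by simp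
  next
    case False then have "P x < P (P x)" using D by auto
    then show ?thesis using main[OF D(1)] D(2) eq by simp
  qed
qed

end

section \<open>Rearranging lists of pieces\<close>

text \<open>Pieces are named by letters of an auxiliary alphabet, with inverse names for inverse pieces.\<close>

locale pieces =
  fixes \<rho> :: "'k letter \<Rightarrow> (nat, 'a) word"
  assumes c: "countable_word (\<rho> y)" and inv: "\<rho> (inv_letter y) = inv_word (\<rho> y)"
begin

definition cat :: "'k letter list \<Rightarrow> (nat, 'a) word" where
  "cat xs = nat_word (concat_words (map \<rho> xs))"

lemma cmap: "\<forall>V\<in>set (map \<rho> xs). countable_word V" using c by auto

lemma cat_eq: "word_eq (concat_words (map \<rho> xs)) (cat xs)"
  unfolding cat_def by (intro nat_word_eq concat_words_countable cmap)

lemma c_cat: "countable_word (cat xs)"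
  using word_eq_countable_word[OF cat_eq] concat_words_countable[OF cmap] by blast

lemma flat:
  assumes "\<forall>V\<in>set Ys. countable_word V"
  shows "word_eq (concat_words (map \<rho> xs @ Ys)) (concat_words (cat xs # Ys))"
  unfolding cat_def by (rule concat_words_flatten[OF cmap assms])

lemma flat_end: "word_eq (concat_words (map \<rho> xs)) (concat_words [cat xs])"
  using flat[of "[]" xs] by simp

lemma under:
  assumes "countable_word A" "\<forall>V\<in>set Ws. countable_word V" "\<forall>V\<in>set Ws'. countable_word V"
    "word_eq (concat_words Ws) (concat_words Ws')"
  shows "word_eq (concat_words (A # Ws)) (concat_words (A # Ws'))"
  by (rule concat_words_cong_Cons[OF assms(1,1,2,3) word_eq_refl assms(4)])

lemma cat_split5:
  "word_eq (cat (p @ x # q @ z # r)) (concat_words [cat p, \<rho> x, cat q, \<rho> z, cat r])"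
proof -
  have "word_eq (cat (p @ x # q @ z # r)) (concat_words (map \<rho> p @ \<rho> x # map \<rho> q @ \<rho> z # map \<rho> r))"
    using word_eq_sym[OF cat_eq[of "p @ x # q @ z # r"]] by simp
  moreover have "word_eq (concat_words (map \<rho> p @ \<rho> x # map \<rho> q @ \<rho> z # map \<rho> r))
      (concat_words (cat p # \<rho> x # map \<rho> q @ \<rho> z # map \<rho> r))"
    using c by (intro flat) auto
  moreover have "word_eq (concat_words (cat p # \<rho> x # map \<rho> q @ \<rho> z # map \<rho> r))
      (concat_words (cat p # \<rho> x # cat q # \<rho> z # map \<rho> r))"
    using c c_cat by (intro under flat) auto
  moreover have "word_eq (concat_words (cat p # \<rho> x # cat q # \<rho> z # map \<rho> r))
      (concat_words [cat p, \<rho> x, cat q, \<rho> z, cat r])"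
    using c c_cat by (intro under flat_end) auto
  ultimately show ?thesis by (meson word_eq_trans)
qed

lemma cat_split3: "word_eq (cat (p @ q @ r)) (concat_words [cat p, cat q, cat r])"
proof -
  have "word_eq (cat (p @ q @ r)) (concat_words (map \<rho> p @ map \<rho> q @ map \<rho> r))"
    using word_eq_sym[OF cat_eq[of "p @ q @ r"]] by simp
  moreover have "word_eq (concat_words (map \<rho> p @ map \<rho> q @ map \<rho> r)) (concat_words (cat p # map \<rho> q @ map \<rho> r))"
    using c by (intro flat) auto
  moreover have "word_eq (concat_words (cat p # map \<rho> q @ map \<rho> r)) (concat_words (cat p # cat q # map \<rho> r))"
    using c c_cat by (intro under flat) auto
  moreover have "word_eq (concat_words (cat p # cat q # map \<rho> r)) (concat_words [cat p, cat q, cat r])"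
    using c c_cat by (intro under flat_end) auto
  ultimately show ?thesis by (meson word_eq_trans)
qed

lemma cat_split4: "word_eq (cat (p @ q @ r @ s)) (concat_words [cat p, cat q, cat r, cat s])"
proof -
  have "word_eq (cat (p @ q @ r @ s)) (concat_words (map \<rho> p @ map \<rho> q @ map \<rho> r @ map \<rho> s))"
    using word_eq_sym[OF cat_eq[of "p @ q @ r @ s"]] by simp
  moreover have "word_eq (concat_words (map \<rho> p @ map \<rho> q @ map \<rho> r @ map \<rho> s)) (concat_words (cat p # map \<rho> q @ map \<rho> r @ map \<rho> s))"
    using c by (intro flat) auto
  moreover have "word_eq (concat_words (cat p # map \<rho> q @ map \<rho> r @ map \<rho> s)) (concat_words (cat p # cat q # map \<rho> r @ map \<rho> s))"
    using c c_cat by (intro under flat) auto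
  moreover have "word_eq (concat_words (cat p # cat q # map \<rho> r @ map \<rho> s)) (concat_words (cat p # cat q # cat r # map \<rho> s))"
    using c c_cat by (intro under flat) auto
  moreover have "word_eq (concat_words (cat p # cat q # cat r # map \<rho> s)) (concat_words [cat p, cat q, cat r, cat s])"
    using c c_cat by (intro under flat_end) auto
  ultimately show ?thesis by (meson word_eq_trans)
qed

lemma delete_pair: "delete_step (cat (p @ x # q @ inv_letter x # r)) (cat (p @ q @ r))"
  by (rule delete_step.intros[OF c_cat c c_cat c_cat cat_split5[of p x q "inv_letter x" r, unfolded inv] cat_split3])

lemma swap_blocks: "permute_step (cat (p @ q @ r @ s)) (cat (p @ r @ q @ s))"
  by (rule permute_step.intros[OF c_cat c_cat c_cat c_cat cat_split4 cat_split4])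

text \<open>After all possible deletions, the names that are left are those whose inverse was absent
  from the beginning, since no name occurs twice.\<close>

lemma delete_all:
  assumes "distinct xs"
  shows "delete_step\<^sup>*\<^sup>* (cat xs) (cat (filter (\<lambda>y. inv_letter y \<notin> set xs) xs))"
  using assms
proof (induction "length xs" arbitrary: xs rule: less_induct)
  case less
  show ?case
  proof (cases "\<exists>y\<in>set xs. inv_letter y \<in> set xs")
    case False
    then have "filter (\<lambda>y. inv_letter y \<notin> set xs) xs = xs" by (auto simp: filter_id_conv)
    then show ?thesis by simp
  next
    case True
    then obtain y where y: "y \<in> set xs" "inv_letter y \<in> set xs" by blast
    obtain a b where ab: "xs = a @ y # b" using y(1) by (meson split_list)
    have "\<exists>x p q r. xs = p @ x # q @ inv_letter x # r"
    proof (cases "inv_letter y \<in> set b")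
      case True
      then obtain q r where "b = q @ inv_letter y # r" by (meson split_list)
      then show ?thesis using ab by blast
    next
      case False
      then have "inv_letter y \<in> set a" using y(2) ab by auto
      then obtain p q where "a = p @ inv_letter y # q" by (meson split_list)
      then have "xs = p @ inv_letter y # q @ inv_letter (inv_letter y) # b" using ab by simp
      then show ?thesis by blast
    qed
    then obtain x p q r where xs: "xs = p @ x # q @ inv_letter x # r" by blast
    let ?ys = "p @ q @ r"
    have d: "distinct ?ys" using less.prems unfolding xs by auto
    have n: "x \<notin> set ?ys" "inv_letter x \<notin> set ?ys" using less.prems unfolding xs by auto
    have "filter (\<lambda>y. inv_letter y \<notin> set ?ys) ?ys = filter (\<lambda>y. inv_letter y \<notin> set xs) ?ys"
    proof (rule filter_cong[OF refl])
      fix z assume z: "z \<in> set ?ys"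
      then have "inv_letter z \<noteq> x" "inv_letter z \<noteq> inv_letter x" using n by auto
      then show "(inv_letter z \<notin> set ?ys) = (inv_letter z \<notin> set xs)" unfolding xs by auto
    qed
    also have "\<dots> = filter (\<lambda>y. inv_letter y \<notin> set xs) xs" unfolding xs by simp
    finally have e: "filter (\<lambda>y. inv_letter y \<notin> set ?ys) ?ys = filter (\<lambda>y. inv_letter y \<notin> set xs) xs" .
    have "delete_step (cat xs) (cat ?ys)" unfolding xs by (rule delete_pair)
    moreover have "delete_step\<^sup>*\<^sup>* (cat ?ys) (cat (filter (\<lambda>y. inv_letter y \<notin> set ?ys) ?ys))"
      by (rule less.hyps[OF _ d]) (simp add: xs)
    ultimately show ?thesis unfolding e by (rule converse_rtranclp_into_rtranclp)
  qed
qed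

lemma permute_all:
  assumes "mset xs = mset ys"
  shows "permute_step\<^sup>*\<^sup>* (cat (p @ xs)) (cat (p @ ys))"
  using assms
proof (induction ys arbitrary: p xs)
  case Nil
  then show ?case by simp
next
  case (Cons y ys)
  then have "y \<in> set xs" by (metis list.set_intros(1) set_mset_mset)
  then obtain a b where xs: "xs = a @ y # b" by (meson split_list)
  have "mset (a @ b) = mset ys" using Cons.prems unfolding xs by simp
  then have "permute_step\<^sup>*\<^sup>* (cat ((p @ [y]) @ (a @ b))) (cat ((p @ [y]) @ ys))" by (rule Cons.IH)
  moreover have "permute_step (cat (p @ a @ [y] @ b)) (cat (p @ [y] @ a @ b))" by (rule swap_blocks)
  ultimately show ?case unfolding xs by (simp add: converse_rtranclp_into_rtranclp)
qed

end

lemma concat_words_cong: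
  assumes "\<And>k. k \<in> set ks \<Longrightarrow> countable_word (f k) \<and> countable_word (g k) \<and> word_eq (f k) (g k)"
  shows "word_eq (concat_words (map f ks)) (concat_words (map g ks))"
  using assms
proof (induction ks)
  case Nil show ?case by (auto simp: word_eq_def bij_betw_def concat_words_Nil)
next
  case (Cons k ks)
  then show ?case by (simp, intro concat_words_cong_Cons) auto
qed

lemma reduced_tame_convex:
  assumes "reduced_tame (word_on lab M)" "A \<subseteq> M" "\<And>x y z. x \<in> A \<Longrightarrow> z \<in> A \<Longrightarrow> y \<in> M \<Longrightarrow> x < y \<Longrightarrow> y < z \<Longrightarrow> y \<in> A"
  shows "reduced_tame (word_on lab A)"
  unfolding reduced_tame_def
proof (intro conjI)
  have "countable M" "restricted (word_on lab M)" using assms(1) by (auto simp: reduced_tame_def countable_word_def)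
  then show "countable_word (word_on lab A)" using countable_subset[OF assms(2)] countable_word_on by blast
  show "restricted (word_on lab A)" unfolding restricted_def
  proof
    fix x
    have "{i \<in> idx (word_on lab A). letter_at (word_on lab A) i = x} \<subseteq> {i \<in> idx (word_on lab M). letter_at (word_on lab M) i = x}"
      using assms(2) by auto
    then show "finite {i \<in> idx (word_on lab A). letter_at (word_on lab A) i = x}"
      using \<open>restricted (word_on lab M)\<close> unfolding restricted_def by (meson finite_subset)
  qed
  show "reduced (word_on lab A)"
  proof (rule reduced_embed[of "word_on lab M" id])
    show "reduced (word_on lab M)" using assms(1) by (simp add: reduced_tame_def)
    fix i j k
    assume "i \<in> idx (word_on lab A)" "j \<in> idx (word_on lab A)"
      and k: "prec (word_on lab M) (id i) k" "prec (word_on lab M) k (id j)"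
    then have "i \<in> A" "j \<in> A" by simp_all
    moreover have "k \<in> M" "i < k" "k < j" using k by simp_all
    ultimately have "k \<in> A" by (intro assms(3)[of i j k])
    then show "k \<in> id ` idx (word_on lab A)" by simp
  qed (use assms(2) in \<open>simp_all add: subset_iff\<close>)
qed

section \<open>Words with homologous loops\<close>

text \<open>The slots are, in this order, \<open>V\<inverse>\<close>, \<open>U\<close>, and the signed paths \<open>L'\<close>: the inverse of the loop of
  \<open>U\<close>, the loop of \<open>V\<close> and the sides of the triangles of the 2-chain. The two loops are included
  because the word chosen for the loop of \<open>U\<close> is in general not \<open>U\<close> itself; only the words
  of \<open>L'\<close> come in mirror images.\<close>

lemma transforms_of_homologous:
  assumes U: "reduced_tame U" and V: "reduced_tame V"
    and f: "word_loop U f" and g: "word_loop V g" and hom: "homologous (frag_of (loop_simplex f)) (frag_of (loop_simplex g))"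
  shows "\<exists>T. tame T \<and> transforms_to U T \<and> transforms_to V T"
proof -
  have cU: "countable_word U" "restricted U" "reduced U" and cV: "countable_word V" "restricted V" "reduced V"
    using U V by (auto simp: reduced_tame_def)
  note fp = word_loop_path[OF cU(1,2) f] and gp = word_loop_path[OF cV(1,2) g]
  have sf: "singular_simplex (Suc 0) (top_of_set HE) (loop_simplex f)" by (rule sim_simplex[OF fp(1,2)])
  have letter_sign: "singular_simplex (Suc 0) (top_of_set HE) (loop_simplex g)" by (rule sim_simplex[OF gp(1,2)])
  obtain d where d: "singular_chain 2 (top_of_set HE) d" "chain_boundary 2 d = frag_of (loop_simplex f) - frag_of (loop_simplex g)"
    using hom unfolding homologous_rel_def singular_boundary by (auto simp: numeral_2_eq_2)
  obtain L where L: "\<And>p. p \<in> set L \<Longrightarrow> singular_simplex (Suc 0) (top_of_set HE) (snd p)"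
    "sum_list (map signed_frag L) = chain_boundary 2 d" "\<And>N. sum_list (map (signed_val N) L) = 0"
    using boundary_list[OF d(1)] by blast
  define L' where "L' = (False, loop_simplex f) # (True, loop_simplex g) # L"
  have "sum_list (map signed_frag L') = 0" using L(2) d(2) by (simp add: L'_def signed_frag_def)
  then obtain q0 where q0: "\<And>i. i < length L' \<Longrightarrow> q0 i < length L' \<and> q0 (q0 i) = i \<and> L' ! (q0 i) = flip (L' ! i)"
    using signed_matching by blast
  have simp': "singular_simplex (Suc 0) (top_of_set HE) (snd p)" if "p \<in> set L'" for p
    using that L(1)[of p] sf letter_sign by (auto simp: L'_def)
  have "\<forall>e. \<exists>w. singular_simplex (Suc 0) (top_of_set HE) e \<longrightarrow> good_slot w \<and> (\<forall>N. slot_val N w = path_value N (simplex_path e))"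
  proof
    fix e :: ssimplex
    show "\<exists>w. singular_simplex (Suc 0) (top_of_set HE) e \<longrightarrow> good_slot w \<and> (\<forall>N. slot_val N w = path_value N (simplex_path e))"
    proof (cases "singular_simplex (Suc 0) (top_of_set HE) e")
      case True
      from simplex_word_exists[OF True] obtain M lab where
        "M \<subseteq> {0<..<1::real}" "fin_letters lab M" "irreducible_on lab M" "\<forall>N. word_value N lab M = path_value N (simplex_path e)" by blast
      then show ?thesis by (intro exI[of _ "(M, lab)"]) (simp add: good_slot_def slot_val_def)
    qed simp
  qed
  then obtain W where W: "\<And>e. singular_simplex (Suc 0) (top_of_set HE) e \<Longrightarrow> good_slot (W e)"
    "\<And>e N. singular_simplex (Suc 0) (top_of_set HE) e \<Longrightarrow> slot_val N (W e) = path_value N (simplex_path e)" by metis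
  have word_slot: "\<exists>M lab. good_slot (M, lab) \<and> word_eq X (word_on lab M) \<and> (\<forall>N. slot_val N (M, lab) = path_value N (simplex_path (loop_simplex h)))"
    if X: "countable_word X" "restricted X" "reduced X" "word_loop X h" for X :: "('x, nat) word" and h
  proof -
    obtain M lab where M: "M \<subseteq> {0<..<1::real}" "word_eq X (word_on lab M)"
      "\<And>N. \<exists>\<phi>. is_lift (transition N) {0..1} h \<phi> \<and> - \<phi> 0 + \<phi> 1 = word_value N lab M"
      using word_loop_value[OF X(1,2,4)] by blast
    have fin: "fin_letters lab M" unfolding fin_letters_restricted by (rule word_eq_restricted[OF M(2) X(2)])
    have "irreducible_on lab M" by (rule reduced_irreducible[OF fin word_eq_reduced[OF word_eq_sym[OF M(2)] X(3)]])
    moreover have "word_value N lab M = path_value N (simplex_path (loop_simplex h))" for N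
    proof -
      have "word_value N lab M = path_value N h" using M(3)[of N] path_value_eq by metis
      also have "\<dots> = path_value N (simplex_path (loop_simplex h))" by (rule path_value_cong) (simp only: simplex_path_sim)
      finally show ?thesis .
    qed
    ultimately show ?thesis using M fin by (intro exI[of _ M] exI[of _ lab]) (simp add: good_slot_def slot_val_def)
  qed
  obtain MU lU where MU: "good_slot (MU, lU)" "word_eq U (word_on lU MU)" "\<And>N. slot_val N (MU, lU) = path_value N (simplex_path (loop_simplex f))"
    using word_slot[OF cU f] by blast
  obtain MV lV where MV: "good_slot (MV, lV)" "word_eq V (word_on lV MV)" "\<And>N. slot_val N (MV, lV) = path_value N (simplex_path (loop_simplex g))"
    using word_slot[OF cV g] by blast
  define wd where "wd p = (if fst p then W (snd p) else mirror (W (snd p)))" for p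
  have wd_flip: "wd (flip p) = mirror (wd p)" for p by (auto simp: wd_def flip_def)
  have wd: "good_slot (wd p)" "slot_val N (wd p) = signed_val N p" if "p \<in> set L'" for p N
    using W[OF simp'[OF that]] good_mirror slot_val_mirror(1)
    by (auto simp: wd_def signed_val_def good_slot_def)
  define D where "D = mirror (MV, lV) # (MU, lU) # map wd L'"
  interpret slots D
    by standard (use wd(1) MU(1) good_mirror[OF MV(1)] in \<open>auto simp: D_def\<close>)
  have len: "length D = Suc (Suc (length L'))" by (simp add: D_def)
  have D0: "D ! 0 = mirror (MV, lV)" "D ! 1 = (MU, lU)" by (simp_all add: D_def)
  have Dk: "D ! Suc (Suc i) = wd (L' ! i)" if "i < length L'" for i using that by (simp add: D_def)
  have "word_value N (line_lab D) (line D) = 0" for N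
  proof -
    have m: "map (slot_val N) (map wd L') = map (signed_val N) L'" using wd(2) by simp
    have "word_value N (line_lab D) (line D) = slot_val N (mirror (MV, lV)) + (slot_val N (MU, lU) + sum_list (map (slot_val N) (map wd L')))"
      unfolding line_val by (simp add: D_def)
    also have "slot_val N (mirror (MV, lV)) = - path_value N (simplex_path (loop_simplex g))"
      using slot_val_mirror(1)[of "(MV, lV)"] MV(1,3) by (simp add: good_slot_def)
    also have "sum_list (map (slot_val N) (map wd L')) = - path_value N (simplex_path (loop_simplex f)) + (path_value N (simplex_path (loop_simplex g)) + 0)"
      unfolding m using L(3)[of N] by (simp add: L'_def signed_val_def)
    finally show ?thesis using MU(3)[of N] by (simp add: add.assoc[symmetric])
  qed
  then obtain P where P: "nc_pairing (line_lab D) (line D) P" using word_value_nc_pairing[OF line_fin] by blast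
  \<comment> \<open>The first two slots are \<open>V\<inverse>\<close> and \<open>U\<close>, so slot \<open>i + 2\<close> belongs to entry \<open>i\<close> of \<open>L'\<close>.\<close>
  define q where "q k = Suc (Suc (q0 (k - 2)))" for k
  define Q where "Q y = real (q (slot_of y)) + (1 - (y - real (slot_of y)))" for y
  have Qk: "Q y = real (q k) + (1 - (y - real k))" "1 - (y - real k) \<in> fst (D ! q k)" "q k < length D" "q (q k) = k" "q k \<notin> {0, 1}"
    "line_lab D y = snd (D ! k) (y - real k)" "D ! q k = mirror (D ! k)"
    if y: "y \<in> line D" "slot_of y = k" "k \<notin> {0, 1}" for y k
  proof -
    obtain i where i: "k = Suc (Suc i)" using y(3) by (cases k; cases "k - 1") auto
    have iL: "i < length L'" using lineD(1)[OF y(1)] y(2) len i by simp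
    have qk: "q k = Suc (Suc (q0 i))" by (simp add: q_def i)
    show "Q y = real (q k) + (1 - (y - real k))" by (simp add: Q_def y(2))
    show "q k < length D" "q (q k) = k" "q k \<notin> {0, 1}" using q0[OF iL] len by (auto simp: qk q_def i)
    show m: "D ! q k = mirror (D ! k)"
      unfolding qk unfolding i using Dk[OF iL] Dk[of "q0 i"] q0[OF iL] wd_flip by simp
    have "y - real k \<in> fst (D ! k)" using lineD(3)[OF y(1)] y(2) by simp
    then show "1 - (y - real k) \<in> fst (D ! q k)" unfolding m by (auto simp: mirror_def)
    show "line_lab D y = snd (D ! k) (y - real k)" by (simp add: line_lab_def y(2))
  qed
  interpret ie: interval_exchange "line_lab D" "line D" P Q slot_of q "{0, 1}" "length D"
  proof
    show "fin_letters (line_lab D) (line D)" by (rule line_fin)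
    show "nc_pairing (line_lab D) (line D) P" by (rule P)
    show "slot_of x \<le> slot_of y" if "x \<le> y" for x y using that by (rule slot_of_mono)
    show "slot_of x < length D" if "x \<in> line D" for x using lineD(1)[OF that] .
    show "slot_of (P x) \<noteq> slot_of x" if "x \<in> line D" for x by (rule no_pair_in_slot[OF P that])
    fix x assume x: "x \<in> line D" "slot_of x \<notin> {0, 1}"
    let ?k = "slot_of x"
    note k = Qk[OF x(1) refl x(2)]
    note l = lineI[OF k(3,2), folded k(1)]
    show "Q x \<in> line D" "slot_of (Q x) = q (slot_of x)" "q (slot_of x) \<notin> {0, 1}" using l k by auto
    show "Q (Q x) = x" unfolding Q_def[of "Q x"] l(2) k(4) unfolding k(1) by simp
    show "line_lab D (Q x) = inv_letter (line_lab D x)" unfolding l(3) k(6,7) by (simp add: mirror_def)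
  next
    fix x y assume a: "x \<in> line D" "y \<in> line D" "slot_of x \<notin> {0, 1}" "slot_of x = slot_of y" "x < y"
    then show "Q y < Q x" by (simp add: Q_def)
  qed
  let ?T = "{x \<in> line D. slot_of x \<in> {0, 1}}"
  define piece where "piece y = word_on (line_lab D) {z \<in> ?T. ie.\<nu> z = y}" for y
  have cline: "countable (line D)" using fin_letters_countable[OF line_fin] .
  have cpiece: "countable_word (piece y)" for y
    unfolding piece_def by (rule countable_word_on) (rule countable_subset[OF _ cline], auto)
  have piece_inv: "word_eq (inv_word (piece y)) (piece (inv_letter y))" for y
  proof -
    let ?A = "{z \<in> ?T. ie.\<nu> z = y}"
    have t: "ie.\<tau> z \<in> ?T" "ie.\<nu> (ie.\<tau> z) = inv_letter (ie.\<nu> z)" "ie.\<tau> (ie.\<tau> z) = z" if "z \<in> ?T" for z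
      using ie.\<tau>[of z] ie.\<nu>_\<tau>[of z] ie.\<tau>_inv(2)[of z] that by auto
    have "ie.\<tau> ` ?A = {z \<in> ?T. ie.\<nu> z = inv_letter y}"
    proof
      show "ie.\<tau> ` ?A \<subseteq> {z \<in> ?T. ie.\<nu> z = inv_letter y}" using t by auto
      show "{z \<in> ?T. ie.\<nu> z = inv_letter y} \<subseteq> ie.\<tau> ` ?A"
      proof
        fix z assume z: "z \<in> {z \<in> ?T. ie.\<nu> z = inv_letter y}"
        then have "z \<in> ?T" "ie.\<nu> z = inv_letter y" by auto
        note tz = t[OF this(1)]
        have n: "ie.\<nu> (ie.\<tau> z) = y" using tz(2) \<open>ie.\<nu> z = inv_letter y\<close> by (simp only: inv_letter_inv)
        have "ie.\<tau> z \<in> ?A" by (rule CollectI, rule conjI[OF tz(1) n])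
        from imageI[OF this, of ie.\<tau>] show "z \<in> ie.\<tau> ` ?A" by (simp only: tz(3))
      qed
    qed
    moreover have "word_eq (inv_word (word_on (line_lab D) ?A)) (word_on (line_lab D) (ie.\<tau> ` ?A))"
    proof (rule word_on_image_anti)
      show "ie.\<tau> y' < ie.\<tau> x" if "x \<in> ?A" "y' \<in> ?A" "x < y'" for x y'
        using ie.\<nu>_anti[of x y'] that by auto
      show "line_lab D (ie.\<tau> x) = inv_letter (line_lab D x)" if "x \<in> ?A" for x
        using ie.\<tau>(3)[of x] that by auto
    qed
    ultimately show ?thesis unfolding piece_def by simp
  qed
  define \<rho> where "\<rho> y = (case y of Gen i \<Rightarrow> nat_word (piece (Gen i)) | GenInv i \<Rightarrow> inv_word (nat_word (piece (Gen i))))" for y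
  have \<rho>_eq: "word_eq (piece y) (\<rho> y)" for y
  proof (cases y)
    case (Gen i) then show ?thesis using nat_word_eq[OF cpiece] by (simp add: \<rho>_def)
  next
    case (GenInv i)
    have "word_eq (piece y) (inv_word (piece (Gen i)))" using word_eq_sym[OF piece_inv[of "Gen i"]] GenInv by simp
    then show ?thesis using word_eq_trans[OF _ inv_word_cong[OF nat_word_eq[OF cpiece]]] GenInv by (simp add: \<rho>_def)
  qed
  have c\<rho>: "countable_word (\<rho> y)" for y using word_eq_countable_word[OF \<rho>_eq cpiece] .
  interpret pieces \<rho>
  proof
    show "countable_word (\<rho> y)" for y by (rule c\<rho>)
    show "\<rho> (inv_letter y) = inv_word (\<rho> y)" for y by (cases y) (auto simp: \<rho>_def)
  qed
  have goodU: "MU \<subseteq> {0<..<1}" "fin_letters lU MU" and goodV: "MV \<subseteq> {0<..<1}" "fin_letters lV MV"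
    using MU(1) MV(1) by (auto simp: good_slot_def)
  \<comment> \<open>Names of the pieces of \<open>U\<close> and of \<open>V\<close>, in terms of positions in these words. Slot \<open>0\<close> contains
  the mirror image of \<open>V\<close>, hence the reflection and the inverse name.\<close>
  define kU where "kU x = ie.\<nu> (1 + x)" for x
  define kV where "kV x = inv_letter (ie.\<nu> (1 - x))" for x
  have inU: "1 + x \<in> line D \<and> slot_of (1 + x) = 1 \<and> line_lab D (1 + x) = lU x" if "x \<in> MU" for x
    using lineI[of 1 x] D0(2) len that by simp
  have inV: "1 - x \<in> line D \<and> slot_of (1 - x) = 0 \<and> line_lab D (1 - x) = inv_letter (lV x)" if "x \<in> MV" for x
    using lineI[of 0 "1 - x"] D0(1) len that by (simp add: mirror_def)
  have fromU: "z - 1 \<in> MU" if "z \<in> line D" "slot_of z = 1" for z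
    using lineD(3)[OF that(1)] that(2) D0(2) by simp
  have fromV: "1 - z \<in> MV" if "z \<in> line D" "slot_of z = 0" for z
    using lineD(3)[OF that(1)] that(2) D0(1) by (auto simp: mirror_def)
  have same_slot: "slot_of x = slot_of y" if "x \<in> ?T" "y \<in> ?T" "ie.\<nu> x = ie.\<nu> y" for x y
    using ie.\<nu>_slot[of x y] that by auto
  have pU: "word_eq (word_on lU {x \<in> MU. kU x = y}) (piece y)" if y: "y \<in> kU ` MU" for y
  proof -
    have "{z \<in> ?T. ie.\<nu> z = y} = (\<lambda>x. 1 + x) ` {x \<in> MU. kU x = y}"
    proof
      show "(\<lambda>x. 1 + x) ` {x \<in> MU. kU x = y} \<subseteq> {z \<in> ?T. ie.\<nu> z = y}" using inU by (auto simp: kU_def)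
      show "{z \<in> ?T. ie.\<nu> z = y} \<subseteq> (\<lambda>x. 1 + x) ` {x \<in> MU. kU x = y}"
      proof
        fix z assume z: "z \<in> {z \<in> ?T. ie.\<nu> z = y}"
        obtain x where x: "x \<in> MU" "y = kU x" using y by blast
        have "slot_of z = 1" using same_slot[of z "1 + x"] z inU[OF x(1)] x(2) by (auto simp: kU_def)
        then have "z - 1 \<in> MU" using fromU z by auto
        then show "z \<in> (\<lambda>x. 1 + x) ` {x \<in> MU. kU x = y}" using z by (intro image_eqI[of _ _ "z - 1"]) (auto simp: kU_def)
      qed
    qed
    then show ?thesis unfolding piece_def by (simp only:) (rule word_on_image, use inU in auto)
  qed
  have pV: "word_eq (word_on lV {x \<in> MV. kV x = y}) (piece y)" if y: "y \<in> kV ` MV" for y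
  proof -
    have "{z \<in> ?T. ie.\<nu> z = inv_letter y} = (\<lambda>x. 1 - x) ` {x \<in> MV. kV x = y}"
    proof
      show "(\<lambda>x. 1 - x) ` {x \<in> MV. kV x = y} \<subseteq> {z \<in> ?T. ie.\<nu> z = inv_letter y}" using inV by (auto simp: kV_def)
      show "{z \<in> ?T. ie.\<nu> z = inv_letter y} \<subseteq> (\<lambda>x. 1 - x) ` {x \<in> MV. kV x = y}"
      proof
        fix z assume z: "z \<in> {z \<in> ?T. ie.\<nu> z = inv_letter y}"
        obtain x where x: "x \<in> MV" "y = kV x" using y by blast
        have "slot_of z = 0" using same_slot[of z "1 - x"] z inV[OF x(1)] x(2) by (auto simp: kV_def)
        then have "1 - z \<in> MV" using fromV z by auto
        then show "z \<in> (\<lambda>x. 1 - x) ` {x \<in> MV. kV x = y}" using z by (intro image_eqI[of _ _ "1 - z"]) (auto simp: kV_def)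
      qed
    qed
    then have "word_eq (inv_word (word_on lV {x \<in> MV. kV x = y})) (piece (inv_letter y))"
      unfolding piece_def by (simp only:) (rule word_on_image_anti, use inV in auto)
    from word_eq_trans[OF inv_word_cong[OF this] inv_word_cong[OF word_eq_sym[OF piece_inv]]]
    show ?thesis by simp
  qed
  have finU: "finite (kU ` MU)"
    by (rule finite_subset[OF _ ie.finite_\<nu>]) (use inU in \<open>auto simp: kU_def\<close>)
  have finV: "finite (kV ` MV)"
    by (rule finite_subset[OF _ finite_imageI[OF ie.finite_\<nu>, of inv_letter]]) (use inV in \<open>auto simp: kV_def\<close>)
  have convU: "kU y = kU x" if "x \<in> MU" "y \<in> MU" "z \<in> MU" "x < y" "y < z" "kU x = kU z" for x y z
    using ie.\<nu>_convex[of "1 + x" "1 + y" "1 + z"] inU that by (auto simp: kU_def)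
  have convV: "kV y = kV x" if "x \<in> MV" "y \<in> MV" "z \<in> MV" "x < y" "y < z" "kV x = kV z" for x y z
    using ie.\<nu>_convex[of "1 - z" "1 - y" "1 - x"] inV that by (auto simp: kV_def)
  have exU: "\<exists>ks. distinct ks \<and> set ks = kU ` MU \<and>
      word_eq (word_on lU MU) (concat_words (map (\<lambda>k. nat_word (word_on lU {x \<in> MU. kU x = k})) ks))"
    by (rule word_on_blocks[OF finU fin_letters_countable[OF goodU(2)]]) (rule convU)
  obtain as where as: "distinct as" "set as = kU ` MU"
    "word_eq (word_on lU MU) (concat_words (map (\<lambda>k. nat_word (word_on lU {x \<in> MU. kU x = k})) as))"
    using exU by blast
  have exV: "\<exists>ks. distinct ks \<and> set ks = kV ` MV \<and>
      word_eq (word_on lV MV) (concat_words (map (\<lambda>k. nat_word (word_on lV {x \<in> MV. kV x = k})) ks))"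
    by (rule word_on_blocks[OF finV fin_letters_countable[OF goodV(2)]]) (rule convV)
  obtain bs where bs: "distinct bs" "set bs = kV ` MV"
    "word_eq (word_on lV MV) (concat_words (map (\<lambda>k. nat_word (word_on lV {x \<in> MV. kV x = k})) bs))"
    using exV by blast
  have cblock: "countable_word (word_on l {x \<in> M. Z x})" if "fin_letters l M" for l :: "real \<Rightarrow> nat letter" and M Z
    by (rule countable_word_on) (rule countable_subset[OF _ fin_letters_countable[OF that]], auto)
  have toU: "word_eq U (cat as)"
  proof -
    have "word_eq (concat_words (map (\<lambda>k. nat_word (word_on lU {x \<in> MU. kU x = k})) as)) (concat_words (map \<rho> as))"
    proof (rule concat_words_cong)
      fix k assume k: "k \<in> set as"
      have n: "word_eq (word_on lU {x \<in> MU. kU x = k}) (nat_word (word_on lU {x \<in> MU. kU x = k}))"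
        by (rule nat_word_eq[OF cblock[OF goodU(2)]])
      have "word_eq (word_on lU {x \<in> MU. kU x = k}) (\<rho> k)" using word_eq_trans[OF pU \<rho>_eq] k as(2) by blast
      then show "countable_word (nat_word (word_on lU {x \<in> MU. kU x = k})) \<and> countable_word (\<rho> k) \<and>
          word_eq (nat_word (word_on lU {x \<in> MU. kU x = k})) (\<rho> k)"
        using n c\<rho> word_eq_countable_word[OF n cblock[OF goodU(2)]] word_eq_trans[OF word_eq_sym[OF n]] by blast
    qed
    from word_eq_trans[OF word_eq_trans[OF MU(2) as(3)] word_eq_trans[OF this cat_eq]] show ?thesis .
  qed
  have toV: "word_eq V (cat bs)"
  proof -
    have "word_eq (concat_words (map (\<lambda>k. nat_word (word_on lV {x \<in> MV. kV x = k})) bs)) (concat_words (map \<rho> bs))"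
    proof (rule concat_words_cong)
      fix k assume k: "k \<in> set bs"
      have n: "word_eq (word_on lV {x \<in> MV. kV x = k}) (nat_word (word_on lV {x \<in> MV. kV x = k}))"
        by (rule nat_word_eq[OF cblock[OF goodV(2)]])
      have "word_eq (word_on lV {x \<in> MV. kV x = k}) (\<rho> k)" using word_eq_trans[OF pV \<rho>_eq] k bs(2) by blast
      then show "countable_word (nat_word (word_on lV {x \<in> MV. kV x = k})) \<and> countable_word (\<rho> k) \<and>
          word_eq (nat_word (word_on lV {x \<in> MV. kV x = k})) (\<rho> k)"
        using n c\<rho> word_eq_countable_word[OF n cblock[OF goodV(2)]] word_eq_trans[OF word_eq_sym[OF n]] by blast
    qed
    from word_eq_trans[OF word_eq_trans[OF MV(2) bs(3)] word_eq_trans[OF this cat_eq]] show ?thesis .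
  qed
  define a1 where "a1 = filter (\<lambda>y. inv_letter y \<notin> set as) as"
  define b1 where "b1 = filter (\<lambda>y. inv_letter y \<notin> set bs) bs"
  define R0 where "R0 = ie.\<nu> ` {x \<in> line D. slot_of x = 0}"
  define R1 where "R1 = ie.\<nu> ` {x \<in> line D. slot_of x = 1}"
  have sa: "set as = R1"
  proof
    show "set as \<subseteq> R1" unfolding as(2) R1_def kU_def using inU by blast
    show "R1 \<subseteq> set as"
    proof
      fix y assume "y \<in> R1"
      then obtain z where z: "z \<in> line D" "slot_of z = 1" "y = ie.\<nu> z" by (auto simp: R1_def)
      then show "y \<in> set as" unfolding as(2) kU_def using fromU[OF z(1,2)] by (intro image_eqI[of _ _ "z - 1"]) auto
    qed
  qed
  have sb: "y \<in> set bs \<longleftrightarrow> inv_letter y \<in> R0" for y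
  proof
    assume "y \<in> set bs"
    then show "inv_letter y \<in> R0" unfolding bs(2) R0_def kV_def using inV by auto
  next
    assume "inv_letter y \<in> R0"
    then obtain z where z: "z \<in> line D" "slot_of z = 0" "inv_letter y = ie.\<nu> z" by (auto simp: R0_def)
    from arg_cong[OF z(3), of inv_letter] have "y = inv_letter (ie.\<nu> z)" by simp
    then show "y \<in> set bs" unfolding bs(2) kV_def using fromV[OF z(1,2)] by (intro image_eqI[of _ _ "1 - z"]) auto
  qed
  have disj: "y \<notin> R1" if y0: "y \<in> R0" for y
  proof
    assume "y \<in> R1"
    then obtain z where z: "z \<in> line D" "slot_of z = 1" "y = ie.\<nu> z" unfolding R1_def by blast
    obtain x where x: "x \<in> line D" "slot_of x = 0" "y = ie.\<nu> x" using y0 unfolding R0_def by blast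
    have "slot_of x = slot_of z" by (rule same_slot) (use x z in simp_all)
    then show False using x(2) z(2) by simp
  qed
  have closed: "inv_letter y \<in> R0 \<union> R1" if y: "y \<in> R0 \<union> R1" for y
  proof -
    obtain x where x: "x \<in> line D" "slot_of x \<in> {0, 1}" "y = ie.\<nu> x" using y by (auto simp: R0_def R1_def)
    have "inv_letter y = ie.\<nu> (ie.\<tau> x)" using ie.\<nu>_\<tau>[OF x(1,2)] x(3) by simp
    then show ?thesis using ie.\<tau>(1,2)[OF x(1,2)] unfolding R0_def R1_def by blast
  qed
  \<comment> \<open>The inverse of every name is a name of a piece of \<open>U\<close> or \<open>V\<inverse>\<close>, but not of both. So a name
  without inverse in \<open>U\<close> is one whose inverse names a piece of \<open>V\<inverse>\<close>.\<close>
  have "set b1 = set a1"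
  proof (rule Set.set_eqI)
    fix y
    have "y \<in> set b1 \<longleftrightarrow> inv_letter y \<in> R0 \<and> y \<notin> R0" by (auto simp: b1_def sb)
    moreover have "y \<in> set a1 \<longleftrightarrow> y \<in> R1 \<and> inv_letter y \<notin> R1" by (auto simp: a1_def sa)
    moreover have "inv_letter (inv_letter y) = y" by simp
    ultimately show "y \<in> set b1 \<longleftrightarrow> y \<in> set a1"
      using closed[of y] closed[of "inv_letter y"] disj by auto
  qed
  then have m: "mset b1 = mset a1"
    using as(1) bs(1) unfolding a1_def b1_def by (subst set_eq_iff_mset_eq_distinct[symmetric]) auto
  have "tame (cat a1)"
    unfolding tame_def
  proof (intro exI conjI)
    show "word_eq (cat a1) (concat_words (map \<rho> a1))" by (rule word_eq_sym[OF cat_eq])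
    show "\<forall>W\<in>set (map \<rho> a1). reduced_tame W"
    proof
      fix W assume "W \<in> set (map \<rho> a1)"
      then obtain y where y: "y \<in> kU ` MU" "W = \<rho> y" using as(2) by (auto simp: a1_def)
      have "reduced_tame (word_on lU {x \<in> MU. kU x = y})"
      proof (rule reduced_tame_convex)
        show "reduced_tame (word_on lU MU)" by (rule word_eq_reduced_tame[OF MU(2) U])
        fix x z x' assume "x \<in> {x \<in> MU. kU x = y}" "z \<in> {x \<in> MU. kU x = y}" "x' \<in> MU" "x < x'" "x' < z"
        then show "x' \<in> {x \<in> MU. kU x = y}" using convU[of x x' z] by simp
      qed auto
      then show "reduced_tame W"
        using word_eq_reduced_tame[OF word_eq_trans[OF pU[OF y(1)] \<rho>_eq]] y(2) by simp
    qed
  qed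
  moreover have "transforms_to U (cat a1)"
    unfolding transforms_to_def
    using toU delete_all[OF as(1), folded a1_def] word_eq_refl by blast
  moreover have "transforms_to V (cat a1)"
    unfolding transforms_to_def
    using toV delete_all[OF bs(1), folded b1_def] permute_all[OF m, of "[]"] word_eq_refl by fastforce
  ultimately show ?thesis by blast
qed

theorem theorem8p3:
  fixes U :: "('i, nat) word" and V :: "('j, nat) word"
  assumes "reduced_tame U" and "reduced_tame V"
  shows "(\<exists>c \<in> carrier (homology_group 1 (top_of_set hawaiian_earring)).
            represents U c \<and> represents V c) \<longleftrightarrow>
         (\<exists>T. tame T \<and> transforms_to U T \<and> transforms_to V T)"
proof
  assume "\<exists>c \<in> carrier (homology_group 1 (top_of_set hawaiian_earring)). represents U c \<and> represents V c"
  then obtain f g where "word_loop U f" "word_loop V g" "loop_homology_class HE f = loop_homology_class HE g"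
    unfolding represents_def by metis
  then show "\<exists>T. tame T \<and> transforms_to U T \<and> transforms_to V T"
    using transforms_of_homologous[OF assms] loop_homology_class_eq by blast
next
  assume "\<exists>T. tame T \<and> transforms_to U T \<and> transforms_to V T"
  then show "\<exists>c \<in> carrier (homology_group 1 (top_of_set hawaiian_earring)). represents U c \<and> represents V c"
    using common_class_of_transforms[OF assms] by blast
qed

end
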